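(* Let $(X_t)_{t\in\Delta}$ be the Kuranishi family of the Iwasawa manifold $X=X_0$. Then the space $$H^{2,1}_{[\gamma]}(X,\mathbb C)=H^{2,1}_{[\gamma]}(X_0,\mathbb C)=\big\langle[\alpha\wedge\gamma\wedge\bar\alpha]_{\bar\partial},[\alpha\wedge\gamma\wedge\bar\beta]_{\bar\partial},[\beta\wedge\gamma\wedge\bar\alpha]_{\bar\partial},[\beta\wedge\gamma\wedge\bar\beta]_{\bar\partial}\big\rangle$$ is the fibre over $t=0$ of a $C^\infty$ vector bundle $\Delta_{[\gamma]}\ni t\mapsto H^{2,1}_{[\gamma]}(X_t,\mathbb C)$ of rank $4$ on $\Delta_{[\gamma]}$.
   Context: Iwasawa manifold: $X=X_0=G/\Gamma$, $G$ the Heisenberg group of upper unitriangular complex $3\times3$ matrices $\begin{pmatrix}1&z_1&z_3\\0&1&z_2\\0&0&1\end{pmatrix}$, $\Gamma\subset G$ the subgroup with entries in $\mathbb Z[i]$. $\alpha,\beta,\gamma$ are the holomorphic $1$-forms on $X$ induced by $dz_1,dz_2,dz_3-z_1dz_2$; $d\alpha=d\beta=0$, $d\gamma=-\alpha\wedge\beta$. $\xi_\alpha,\xi_\beta,\xi_\gamma$ is the dual frame of holomorphic vector fields. Deformations: $H^{0,1}(X,T^{1,0}X)$ has basis $\bar\alpha_\lambda\otimes\xi_i$ ($\alpha_1=\alpha,\alpha_2=\beta$, $\xi_1=\xi_\alpha,\xi_2=\xi_\beta,\xi_3=\xi_\gamma$; $\lambda=1,2$, $i=1,2,3$), with coordinates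 $t_{i\lambda}$. The Kuranishi family $(X_t)_{t\in\Delta}$ of $X$ is unobstructed and $\Delta$ is a small open ball about $0$ in this space (which may be shrunk). All $X_t$ have the same underlying $C^\infty$ manifold $X$; with $D(t)=t_{11}t_{22}-t_{12}t_{21}$, the complex structure of $X_t$ has the $(1,0)$-coframe $\alpha_t=\alpha+t_{11}\bar\alpha+t_{12}\bar\beta$, $\beta_t=\beta+t_{21}\bar\alpha+t_{22}\bar\beta$, $\gamma_t=\gamma+t_{31}\bar\alpha+t_{32}\bar\beta-D(t)\bar\gamma$. $\Delta_{[\gamma]}:=\{t\in\Delta: t_{31}=t_{32}=0\}$. $H^{2,1}_{[\gamma]}(X_t,\mathbb C)$, $t\in\Delta_{[\gamma]}$: write $\bar\partial_t\gamma_t=\sigma_{1\bar1}\alpha_t\wedge\bar\alpha_t+\sigma_{1\bar2}\alpha_t\wedge\bar\beta_t+\sigma_{2\bar1}\beta_t\wedge\bar\alpha_t+\sigma_{2\bar2}\beta_t\wedge\bar\beta_t$ and $\partial_t\gamma_t=\sigma_{12}\alpha_t\wedge\beta_t$, the $\sigma$'s being constants depending smoothly on $t$, $\sigma_{12}(0)=-1$, $\sigma_{i\bar j}(0)=0$. Put $\Gamma_1(t)=\alpha_t\wedge\gamma_t\wedge\bar\alpha_t-\frac{\sigma_{2\bar2}}{\bar\sigma_{12}}\alpha_t\wedge\beta_t\wedge\bar\gamma_t$, $\Gamma_2(t)=\alpha_t\wedge\gamma_t\wedge\bar\beta_t+\frac{\sigma_{2\bar1}}{\bar\sigma_{12}}\alpha_t\wedge\beta_t\wedge\bar\gamma_t$,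 $\Gamma_3(t)=\beta_t\wedge\gamma_t\wedge\bar\alpha_t+\frac{\sigma_{1\bar2}}{\bar\sigma_{12}}\alpha_t\wedge\beta_t\wedge\bar\gamma_t$, $\Gamma_4(t)=\beta_t\wedge\gamma_t\wedge\bar\beta_t-\frac{\sigma_{1\bar1}}{\bar\sigma_{12}}\alpha_t\wedge\beta_t\wedge\bar\gamma_t$. Then $H^{2,1}_{[\gamma]}(X_t,\mathbb C):=\langle[\Gamma_1(t)]_{\bar\partial},\dots,[\Gamma_4(t)]_{\bar\partial}\rangle\subset H^{2,1}_{\bar\partial}(X_t,\mathbb C)$. *)

theory Defs
  imports
    "HOL-Analysis.Analysis"
    "HOL-Library.Function_Algebras"
    "HOL-Algebra.Module"
begin

section \<open>Smooth maps\<close>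

text \<open>\<open>Ck_on k S f\<close> is meant for open \<open>S\<close> in a finite-dimensional space, where continuity of
  all iterated directional derivatives is the usual notion of class \<open>C\<^sup>k\<close>.\<close>

primrec Ck_on :: "nat \<Rightarrow> 'a::euclidean_space set \<Rightarrow> ('a \<Rightarrow> 'b::real_normed_vector) \<Rightarrow> bool" where
  "Ck_on 0 S f \<longleftrightarrow> continuous_on S f"
| "Ck_on (Suc k) S f \<longleftrightarrow>
     (\<forall>x\<in>S. f differentiable at x) \<and> (\<forall>v. Ck_on k S (\<lambda>x. frechet_derivative f (at x) v))"

text \<open>On a set that is not open, smoothness means that local smooth extensions exist. For an
  embedded submanifold \<open>S\<close> this is smoothness on the manifold \<open>S\<close>.\<close>

definition smooth_on :: "'a::euclidean_space set \<Rightarrow> ('a \<Rightarrow> 'b::real_normed_vector) \<Rightarrow> bool" where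
  "smooth_on S f \<longleftrightarrow>
     (\<forall>x\<in>S. \<exists>U g. open U \<and> x \<in> U \<and> (\<forall>k. Ck_on k U g) \<and> (\<forall>y\<in>S \<inter> U. g y = f y))"


section \<open>Complex-valued differential forms on the Heisenberg group\<close>

text \<open>A point of \<open>G\<close> is given by its global coordinates \<open>(z\<^sub>1, z\<^sub>2, z\<^sub>3)\<close>. The value of a form at a
  point is a function of the list of tangent vectors; a form of degree \<open>k\<close> vanishes on lists whose
  length is not \<open>k\<close>. Sums and differences of forms are the pointwise ones of the function type.\<close>

type_synonym point = "complex^3"
type_synonym form = "point \<Rightarrow> point list \<Rightarrow> complex"

definition fmult :: "(point \<Rightarrow> complex) \<Rightarrow> form \<Rightarrow> form" where
  "fmult f \<omega> = (\<lambda>z vs. f z * \<omega> z vs)"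

definition fscale :: "complex \<Rightarrow> form \<Rightarrow> form" where
  "fscale c = fmult (\<lambda>_. c)"

definition cnj_form :: "form \<Rightarrow> form" where
  "cnj_form \<omega> = (\<lambda>z vs. cnj (\<omega> z vs))"

text \<open>The wedge product is the sum over shuffles: the arguments at positions in \<open>S\<close> go to the first
  factor, the others to the second, each in increasing order.\<close>

definition shuffle_sign :: "nat \<Rightarrow> nat set \<Rightarrow> complex" where
  "shuffle_sign n S = (-1) ^ card {(i, j). i < j \<and> j < n \<and> i \<notin> S \<and> j \<in> S}"

definition wedge :: "form \<Rightarrow> form \<Rightarrow> form" (infixr \<open>\<and>\<^sub>f\<close> 70) where
  "\<omega> \<and>\<^sub>f \<eta> = (\<lambda>z vs. \<Sum>S\<in>Pow {..<length vs}.
      shuffle_sign (length vs) S * \<omega> z (nths vs S) * \<eta> z (nths vs (- S)))"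

definition form_one :: form where
  "form_one = (\<lambda>z vs. if vs = [] then 1 else 0)"

definition wedge_list :: "form list \<Rightarrow> form" where
  "wedge_list \<omega>s = foldr wedge \<omega>s form_one"

definition ext_deriv :: "form \<Rightarrow> form" where
  "ext_deriv \<omega> = (\<lambda>z vs. \<Sum>i<length vs.
      (-1) ^ i * frechet_derivative (\<lambda>w. \<omega> w (nths vs (- {i}))) (at z) (vs ! i))"

definition dz :: "3 \<Rightarrow> form" where
  "dz i = (\<lambda>z vs. if length vs = 1 then hd vs $ i else 0)"


section \<open>The Iwasawa manifold\<close>

definition heis :: "point \<Rightarrow> complex^3^3" where
  "heis z = (\<chi> i j. if i = j then 1
                    else if i = 1 \<and> j = 2 then z $ 1
                    else if i = 2 \<and> j = 3 then z $ 2
                    else if i = 1 \<and> j = 3 then z $ 3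
                    else 0)"

definition heis_mult :: "point \<Rightarrow> point \<Rightarrow> point" where
  "heis_mult g z = vector [g $ 1 + z $ 1, g $ 2 + z $ 2, g $ 3 + z $ 3 + g $ 1 * z $ 2]"

lemma heis_heis_mult: "heis (heis_mult g z) = heis g ** heis z"
  by (simp add: heis_def heis_mult_def matrix_matrix_mult_def vec_eq_iff forall_3 sum_3)

definition heis_lattice :: "point set" where
  "heis_lattice = {g. \<forall>i. Re (g $ i) \<in> \<int> \<and> Im (g $ i) \<in> \<int>}"

text \<open>The manifold \<open>X\<close> is the quotient of \<open>G\<close> by left translations by the lattice \<open>\<Gamma>\<close>, under
  which \<open>dz\<^sub>1\<close>, \<open>dz\<^sub>2\<close> and \<open>dz\<^sub>3 - z\<^sub>1 dz\<^sub>2\<close> are invariant. Functions and forms on \<open>X\<close> are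
  identified with their pullbacks to \<open>G\<close>, i.e. with the \<open>\<Gamma>\<close>-invariant functions and forms on \<open>G\<close>.\<close>

definition smooth_functions :: "(point \<Rightarrow> complex) set" where
  "smooth_functions = {f. smooth_on UNIV f \<and> (\<forall>g\<in>heis_lattice. \<forall>z. f (heis_mult g z) = f z)}"

definition alpha :: form where "alpha = dz 1"
definition beta :: form where "beta = dz 2"
definition gamma :: form where "gamma = dz 3 - fmult (\<lambda>z. z $ 1) (dz 2)"


section \<open>Dolbeault cohomology of a complex structure given by a coframe\<close>

text \<open>Throughout, \<open>\<theta>\<close> is a global coframe of \<open>(1,0)\<close>-forms of a complex structure on \<open>X\<close>.\<close>

definition pq_basis :: "form list \<Rightarrow> nat set \<Rightarrow> nat set \<Rightarrow> form" where
  "pq_basis \<theta> I J = wedge_list (nths \<theta> I @ nths (map cnj_form \<theta>) J)"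

definition pq_forms :: "form list \<Rightarrow> nat \<Rightarrow> nat \<Rightarrow> form set" where
  "pq_forms \<theta> p q =
     {\<Sum>(I, J) \<in> {I. I \<subseteq> {..<length \<theta>} \<and> card I = p} \<times> {J. J \<subseteq> {..<length \<theta>} \<and> card J = q}.
        fmult (f I J) (pq_basis \<theta> I J) | f. \<forall>I J. f I J \<in> smooth_functions}"

text \<open>For \<open>\<omega>\<close> of degree \<open>p + q\<close>; the decomposition is unique wherever \<open>\<theta>\<close> and its conjugate
  form a coframe.\<close>

definition pq_component :: "form list \<Rightarrow> nat \<Rightarrow> nat \<Rightarrow> form \<Rightarrow> form" where
  "pq_component \<theta> p q \<omega> =
     (THE \<eta>. \<exists>\<phi>. (\<forall>i\<le>p + q. \<phi> i \<in> pq_forms \<theta> i (p + q - i)) \<and>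
                  \<omega> = (\<Sum>i\<le>p + q. \<phi> i) \<and> \<eta> = \<phi> p)"

definition del :: "form list \<Rightarrow> nat \<Rightarrow> nat \<Rightarrow> form \<Rightarrow> form" where
  "del \<theta> p q \<omega> = pq_component \<theta> (Suc p) q (ext_deriv \<omega>)"

definition delbar :: "form list \<Rightarrow> nat \<Rightarrow> nat \<Rightarrow> form \<Rightarrow> form" where
  "delbar \<theta> p q \<omega> = pq_component \<theta> p (Suc q) (ext_deriv \<omega>)"

definition closed_forms :: "form list \<Rightarrow> nat \<Rightarrow> nat \<Rightarrow> form set" where
  "closed_forms \<theta> p q = {\<omega> \<in> pq_forms \<theta> p q. delbar \<theta> p q \<omega> = 0}"

definition exact_forms :: "form list \<Rightarrow> nat \<Rightarrow> nat \<Rightarrow> form set" where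
  "exact_forms \<theta> p q = (case q of 0 \<Rightarrow> {0} | Suc q' \<Rightarrow> delbar \<theta> p q' ` pq_forms \<theta> p q')"

definition dolbeault_class :: "form list \<Rightarrow> nat \<Rightarrow> nat \<Rightarrow> form \<Rightarrow> form set" where
  "dolbeault_class \<theta> p q \<omega> = {\<omega> + \<eta> | \<eta>. \<eta> \<in> exact_forms \<theta> p q}"

definition complex_ring :: "complex ring" where
  "complex_ring = \<lparr>carrier = UNIV, mult = (*), one = 1, zero = 0, add = (+)\<rparr>"

text \<open>The fields \<open>mult\<close> and \<open>one\<close> of the record type of modules play no role for modules.\<close>

definition dolbeault :: "form list \<Rightarrow> nat \<Rightarrow> nat \<Rightarrow> (complex, form set) module" where
  "dolbeault \<theta> p q =
     \<lparr>carrier = dolbeault_class \<theta> p q ` closed_forms \<theta> p q,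
      mult = undefined, one = undefined,
      zero = exact_forms \<theta> p q,
      add = (\<lambda>A B. {a + b | a b. a \<in> A \<and> b \<in> B}),
      smult = (\<lambda>c A. {fscale c a + \<eta> | a \<eta>. a \<in> A \<and> \<eta> \<in> exact_forms \<theta> p q})\<rparr>"

definition span_module :: "(complex, 'v) module \<Rightarrow> 'v set \<Rightarrow> (complex, 'v) module" where
  "span_module M S = M\<lparr>carrier := (\<lambda>N. submodule N complex_ring M) hull S\<rparr>"


section \<open>Smooth vector bundles\<close>

text \<open>A local trivialisation over \<open>U\<close> is given by linear isomorphisms from the fibres over \<open>U\<close> to
  the model fibre; the rank of the bundle is \<open>CARD('r)\<close>.\<close>

definition linear_iso :: "(complex, 'v) module \<Rightarrow> ('v \<Rightarrow> complex^'r) \<Rightarrow> bool" where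
  "linear_iso M \<phi> \<longleftrightarrow> bij_betw \<phi> (carrier M) UNIV \<and>
     (\<forall>x\<in>carrier M. \<forall>y\<in>carrier M. \<phi> (x \<oplus>\<^bsub>M\<^esub> y) = \<phi> x + \<phi> y) \<and>
     (\<forall>c. \<forall>x\<in>carrier M. \<phi> (c \<odot>\<^bsub>M\<^esub> x) = c *s \<phi> x)"

text \<open>The base \<open>B\<close> is meant to be an embedded submanifold. The complex vector spaces \<open>E t\<close> are the
  fibres of a smooth vector bundle with trivialising atlas \<open>\<A>\<close> if the trivialisations in \<open>\<A>\<close> cover
  the base and all transition functions are smooth (being linear in \<open>x\<close>, they are smooth as maps
  to the general linear group if they are so for each fixed \<open>x\<close>).\<close>

definition smooth_vector_bundle ::
  "'b::euclidean_space set \<Rightarrow> ('b \<Rightarrow> (complex, 'v) module) \<Rightarrow>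
   ('b set \<times> ('b \<Rightarrow> 'v \<Rightarrow> complex^'r)) set \<Rightarrow> bool" where
  "smooth_vector_bundle B E \<A> \<longleftrightarrow>
     (\<forall>t\<in>B. Module.module complex_ring (E t)) \<and>
     (\<forall>(U, \<Phi>)\<in>\<A>. openin (top_of_set B) U \<and> (\<forall>t\<in>U. linear_iso (E t) (\<Phi> t))) \<and>
     B \<subseteq> \<Union> (fst ` \<A>) \<and>
     (\<forall>(U, \<Phi>)\<in>\<A>. \<forall>(V, \<Psi>)\<in>\<A>. \<forall>x.
        smooth_on (U \<inter> V) (\<lambda>t. \<Psi> t (inv_into (carrier (E t)) (\<Phi> t) x)))"


section \<open>The Kuranishi family\<close>

text \<open>The component \<open>t $ i $ \<lambda>\<close> is the coordinate \<open>t\<^sub>i\<^sub>\<lambda>\<close>.\<close>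

type_synonym param = "complex^2^3"

definition det_param :: "param \<Rightarrow> complex" where
  "det_param t = t $ 1 $ 1 * t $ 2 $ 2 - t $ 1 $ 2 * t $ 2 $ 1"

definition alpha_t :: "param \<Rightarrow> form" where
  "alpha_t t = alpha + fscale (t $ 1 $ 1) (cnj_form alpha) + fscale (t $ 1 $ 2) (cnj_form beta)"

definition beta_t :: "param \<Rightarrow> form" where
  "beta_t t = beta + fscale (t $ 2 $ 1) (cnj_form alpha) + fscale (t $ 2 $ 2) (cnj_form beta)"

definition gamma_t :: "param \<Rightarrow> form" where
  "gamma_t t = gamma + fscale (t $ 3 $ 1) (cnj_form alpha) + fscale (t $ 3 $ 2) (cnj_form beta)
     - fscale (det_param t) (cnj_form gamma)"

text \<open>The family \<open>X\<^sub>t\<close>, each member given by its \<open>(1,0)\<close>-coframe on the common manifold \<open>X\<close>.\<close>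

definition iwasawa_coframe :: "form list" where
  "iwasawa_coframe = [alpha, beta, gamma]"

definition kuranishi_coframe :: "param \<Rightarrow> form list" where
  "kuranishi_coframe t = [alpha_t t, beta_t t, gamma_t t]"

definition Delta_gamma :: "param set \<Rightarrow> param set" where
  "Delta_gamma \<Delta> = {t \<in> \<Delta>. t $ 3 $ 1 = 0 \<and> t $ 3 $ 2 = 0}"

definition sigma :: "param \<Rightarrow> complex" where
  "sigma t = (THE s. del (kuranishi_coframe t) 1 0 (gamma_t t) = fscale s (alpha_t t \<and>\<^sub>f beta_t t))"

definition sigma_bar :: "param \<Rightarrow> complex^2^2" where
  "sigma_bar t = (THE s. delbar (kuranishi_coframe t) 1 0 (gamma_t t) =
       fscale (s $ 1 $ 1) (alpha_t t \<and>\<^sub>f cnj_form (alpha_t t))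
     + fscale (s $ 1 $ 2) (alpha_t t \<and>\<^sub>f cnj_form (beta_t t))
     + fscale (s $ 2 $ 1) (beta_t t \<and>\<^sub>f cnj_form (alpha_t t))
     + fscale (s $ 2 $ 2) (beta_t t \<and>\<^sub>f cnj_form (beta_t t)))"

definition Gamma1 :: "param \<Rightarrow> form" where
  "Gamma1 t = alpha_t t \<and>\<^sub>f gamma_t t \<and>\<^sub>f cnj_form (alpha_t t)
     - fscale (sigma_bar t $ 2 $ 2 / cnj (sigma t)) (alpha_t t \<and>\<^sub>f beta_t t \<and>\<^sub>f cnj_form (gamma_t t))"

definition Gamma2 :: "param \<Rightarrow> form" where
  "Gamma2 t = alpha_t t \<and>\<^sub>f gamma_t t \<and>\<^sub>f cnj_form (beta_t t)
     + fscale (sigma_bar t $ 2 $ 1 / cnj (sigma t)) (alpha_t t \<and>\<^sub>f beta_t t \<and>\<^sub>f cnj_form (gamma_t t))"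

definition Gamma3 :: "param \<Rightarrow> form" where
  "Gamma3 t = beta_t t \<and>\<^sub>f gamma_t t \<and>\<^sub>f cnj_form (alpha_t t)
     + fscale (sigma_bar t $ 1 $ 2 / cnj (sigma t)) (alpha_t t \<and>\<^sub>f beta_t t \<and>\<^sub>f cnj_form (gamma_t t))"

definition Gamma4 :: "param \<Rightarrow> form" where
  "Gamma4 t = beta_t t \<and>\<^sub>f gamma_t t \<and>\<^sub>f cnj_form (beta_t t)
     - fscale (sigma_bar t $ 1 $ 1 / cnj (sigma t)) (alpha_t t \<and>\<^sub>f beta_t t \<and>\<^sub>f cnj_form (gamma_t t))"

definition H21 :: "param \<Rightarrow> (complex, form set) module" where
  "H21 t = dolbeault (kuranishi_coframe t) 2 1"

definition H21_gamma :: "param \<Rightarrow> (complex, form set) module" where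
  "H21_gamma t = span_module (H21 t)
     (dolbeault_class (kuranishi_coframe t) 2 1 ` {Gamma1 t, Gamma2 t, Gamma3 t, Gamma4 t})"

definition smooth_family :: "param set \<Rightarrow> (param \<Rightarrow> form) \<Rightarrow> bool" where
  "smooth_family U \<omega> \<longleftrightarrow> (\<forall>vs. smooth_on (U \<times> UNIV) (\<lambda>(t, z). \<omega> t z vs))"

text \<open>The smooth structure of the bundle is the one induced by smooth families of forms: its
  trivialisations are those whose local frame \<open>\<Phi>\<^sub>t\<^sup>-\<^sup>1(e\<^sub>j)\<close> is represented by \<open>\<partial>\<close>-bar-closed
  \<open>(2,1)\<close>-forms on \<open>X\<^sub>t\<close> depending smoothly on \<open>t\<close>.\<close>

definition H21_gamma_atlas ::
  "param set \<Rightarrow> (param set \<times> (param \<Rightarrow> form set \<Rightarrow> complex^4)) set" where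
  "H21_gamma_atlas B = {(U, \<Phi>). openin (top_of_set B) U \<and>
     (\<forall>t\<in>U. linear_iso (H21_gamma t) (\<Phi> t)) \<and>
     (\<exists>\<omega>. \<forall>j. smooth_family U (\<omega> j) \<and>
        (\<forall>t\<in>U. \<omega> j t \<in> closed_forms (kuranishi_coframe t) 2 1 \<and>
                dolbeault_class (kuranishi_coframe t) 2 1 (\<omega> j t) \<in> carrier (H21_gamma t) \<and>
                \<Phi> t (dolbeault_class (kuranishi_coframe t) 2 1 (\<omega> j t)) = axis j 1))}"

end

theory Submission
  imports Defs
begin

text \<open>The coframe of \<open>X\<^sub>t\<close> is left-invariant, so \<open>\<partial>\<close>-bar on it is given by structure constants, and a
  computation with these shows that the forms \<open>\<Gamma>\<^sub>i(t)\<close> are even \<open>d\<close>-closed. A \<open>(2,1)\<close>-form has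
  coefficients at \<open>\<alpha>\<^sub>t\<gamma>\<^sub>t\<close> and \<open>\<beta>\<^sub>t\<gamma>\<^sub>t\<close> wedged with the conjugates of \<open>\<alpha>\<^sub>t\<close> and \<open>\<beta>\<^sub>t\<close>. On a
  \<open>\<partial>\<close>-bar-exact form these four coefficients are derivatives of smooth functions on \<open>X\<close> along
  left-invariant vector fields, and such derivatives have mean zero because right translations
  preserve the mean. Hence the four means are well defined on classes, and they are linear
  coordinates on the span of the \<open>[\<Gamma>\<^sub>i(t)]\<close>. They depend smoothly on \<open>t\<close> for every smooth family
  of closed forms, by differentiation under the integral, so that by Cramer's rule the transition
  functions are smooth.\<close>

section \<open>Smooth maps\<close>

text \<open>Why these four coefficients: alpha_t, beta_t and their conjugates span the same space as
  alpha, beta and theirs, so they are closed, and d gamma_t is a combination of their products.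
  Hence d of a (2,0)-monomial contains no gamma_t, and in a delbar-exact (2,1)-form the monomials
  with gamma_t carry only derivatives of coefficient functions. Why the corrections in
  \<open>Gamma1\<close> to \<open>Gamma4\<close>: d of their leading monomials and d of alpha_t
  beta_t conj(gamma_t) are multiples of the single monomial alpha_t beta_t conj(alpha_t)
  conj(beta_t), the latter with factor conj(sigma_12), which is nonzero for small t. The obstacle: a
  form is an arbitrary function on lists of vectors, and types and sigmas are definite descriptions.
  Wedging with a one-form on the left and d both obey a recursion on the first tangent vector, and
  iterated contraction with the dual frame reads off coefficients. This yields uniqueness of the
  descriptions and formulas that are visibly smooth in t. The rank is 4 because the means invert the
  map from c to the sum of the c_i Gamma_i(t).\<close>

lemma Ck_on_subset: "Ck_on k S f \<Longrightarrow> T \<subseteq> S \<Longrightarrow> Ck_on k T f"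
proof (induction k arbitrary: f)
  case 0
  then show ?case using continuous_on_subset by auto
next
  case (Suc k)
  then show ?case by (auto simp: subset_eq)
qed

lemma Ck_on_Suc_imp: "Ck_on (Suc k) S f \<Longrightarrow> Ck_on k S f"
proof (induction k arbitrary: f)
  case 0
  then have "isCont f x" if "x \<in> S" for x
    using that by (simp add: differentiable_imp_continuous_within)
  then show ?case by (simp add: continuous_at_imp_continuous_on)
next
  case (Suc k)
  have "\<forall>x\<in>S. f differentiable at x" using Suc.prems by simp
  moreover have "Ck_on k S (\<lambda>x. frechet_derivative f (at x) v)" for v
    using Suc.prems Suc.IH by simp
  ultimately show ?case by simp
qed

lemma Ck_on_imp_continuous_on: "Ck_on k S f \<Longrightarrow> continuous_on S f"
proof (induction k)
  case (Suc k)
  show ?case by (rule Suc.IH[OF Ck_on_Suc_imp[OF Suc.prems]])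
qed simp

lemma frechet_derivative_cong_open:
  assumes "open S" "x \<in> S" "\<And>y. y \<in> S \<Longrightarrow> f y = g y"
  shows "frechet_derivative f (at x) = frechet_derivative g (at x)"
proof -
  have "(f has_derivative D) (at x) \<longleftrightarrow> (g has_derivative D) (at x)" for D
    using has_derivative_transform_within_open[of f D x UNIV S g]
      has_derivative_transform_within_open[of g D x UNIV S f] assms by auto
  then show ?thesis by (simp add: frechet_derivative_def)
qed

lemma Ck_on_cong:
  assumes "open S" "\<And>y. y \<in> S \<Longrightarrow> f y = g y" "Ck_on k S f"
  shows "Ck_on k S g"
  using assms(2,3)
proof (induction k arbitrary: f g)
  case 0
  then show ?case using continuous_on_cong by force
next
  case (Suc k)
  have "g differentiable at x" if "x \<in> S" for x
  proof -
    from Suc.prems that obtain D where "(f has_derivative D) (at x)"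
      by (auto simp: differentiable_def)
    from has_derivative_transform_within_open[OF this assms(1) that Suc.prems(1)]
    show ?thesis by (auto simp: differentiable_def)
  qed
  moreover have "Ck_on k S (\<lambda>x. frechet_derivative g (at x) v)" for v
  proof (rule Suc.IH)
    show "Ck_on k S (\<lambda>x. frechet_derivative f (at x) v)" using Suc.prems by simp
    show "frechet_derivative f (at y) v = frechet_derivative g (at y) v" if "y \<in> S" for y
      using frechet_derivative_cong_open[OF assms(1) that, of f g] Suc.prems(1) by simp
  qed
  ultimately show ?case by simp
qed

lemma Ck_on_local:
  assumes "\<And>x. x \<in> S \<Longrightarrow> \<exists>W. open W \<and> x \<in> W \<and> Ck_on k W f"
  shows "Ck_on k S f"
  using assms
proof (induction k arbitrary: f)
  case 0
  have "isCont f x" if "x \<in> S" for x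
    using 0[OF that] by (auto simp: continuous_on_eq_continuous_at)
  then show ?case by (simp add: continuous_at_imp_continuous_on)
next
  case (Suc k)
  have "\<forall>x\<in>S. f differentiable at x" using Suc.prems by fastforce
  moreover have "Ck_on k S (\<lambda>x. frechet_derivative f (at x) v)" for v
    using Suc.prems Suc.IH[of "\<lambda>x. frechet_derivative f (at x) v"] by fastforce
  ultimately show ?case by simp
qed

lemma Ck_on_const: "Ck_on k S (\<lambda>x. c)"
proof (induction k arbitrary: c)
  case (Suc k)
  then show ?case by (simp add: frechet_derivative_const)
qed simp

lemma Ck_on_add:
  assumes "open S" "Ck_on k S f" "Ck_on k S g"
  shows "Ck_on k S (\<lambda>x. f x + g x)"
  using assms(2,3)
proof (induction k arbitrary: f g)
  case 0
  then show ?case by (simp add: continuous_on_add)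
next
  case (Suc k)
  have "Ck_on k S (\<lambda>x. frechet_derivative (\<lambda>x. f x + g x) (at x) v)" for v
  proof (rule Ck_on_cong[OF assms(1)])
    show "Ck_on k S (\<lambda>x. frechet_derivative f (at x) v + frechet_derivative g (at x) v)"
      using Suc by simp
    fix y assume "y \<in> S"
    then have "((\<lambda>x. f x + g x) has_derivative
        (\<lambda>v. frechet_derivative f (at y) v + frechet_derivative g (at y) v)) (at y)"
      using Suc.prems by (intro has_derivative_add) (auto simp: frechet_derivative_works[symmetric])
    from frechet_derivative_at[OF this]
    show "frechet_derivative f (at y) v + frechet_derivative g (at y) v
        = frechet_derivative (\<lambda>x. f x + g x) (at y) v" by metis
  qed
  then show ?case using Suc.prems by (auto intro: differentiable_add)
qed

text \<open>The product rule writes a directional derivative as a sum of two terms of the same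
  shape, with one factor differentiated and the other lowered from class \<open>Suc k\<close> to
  \<open>k\<close>, so the induction hypothesis covers both.\<close>

lemma Ck_on_bilinear:
  assumes B: "bounded_bilinear B" and "open S" "Ck_on k S f" "Ck_on k S g"
  shows "Ck_on k S (\<lambda>x. B (f x) (g x))"
  using assms(3,4)
proof (induction k arbitrary: f g)
  case 0
  then show ?case by (simp add: bounded_bilinear.continuous_on[OF B])
next
  case (Suc k)
  have d: "((\<lambda>x. B (f x) (g x)) has_derivative
        (\<lambda>v. B (f y) (frechet_derivative g (at y) v) + B (frechet_derivative f (at y) v) (g y))) (at y)"
    if "y \<in> S" for y
    using Suc.prems that
    by (intro bounded_bilinear.FDERIV[OF B]) (auto simp: frechet_derivative_works[symmetric])
  have "Ck_on k S (\<lambda>x. frechet_derivative (\<lambda>x. B (f x) (g x)) (at x) v)" for v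
  proof (rule Ck_on_cong[OF assms(2)])
    show "Ck_on k S (\<lambda>y. B (f y) (frechet_derivative g (at y) v) + B (frechet_derivative f (at y) v) (g y))"
      by (intro Ck_on_add assms Suc.IH Ck_on_Suc_imp[OF Suc.prems(1)] Ck_on_Suc_imp[OF Suc.prems(2)])
        (use Suc.prems in auto)
    fix y assume "y \<in> S"
    from frechet_derivative_at[OF d[OF this]]
    show "B (f y) (frechet_derivative g (at y) v) + B (frechet_derivative f (at y) v) (g y)
        = frechet_derivative (\<lambda>x. B (f x) (g x)) (at y) v" by metis
  qed
  then show ?case using d by (auto simp: differentiable_def)
qed

lemma Ck_on_bounded_linear_comp:
  assumes L: "bounded_linear L" and "open S" "Ck_on k S f"
  shows "Ck_on k S (\<lambda>x. L (f x))"
proof -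
  \<comment> \<open>Composition with \<open>L\<close> is the case x = 1 of the bilinear map
    \<open>x *\<^sub>R L y\<close>.\<close>
  interpret bounded_bilinear "\<lambda>(x::real) y. x *\<^sub>R L y"
    by (rule bounded_bilinear.comp[OF bounded_bilinear_scaleR bounded_linear_ident L])
  show ?thesis
    using Ck_on_bilinear[OF bounded_bilinear_axioms assms(2) Ck_on_const[of k S 1] assms(3)] by simp
qed

text \<open>An affine inner map has constant derivative, so a directional derivative of the
  composite is again a composite of the same kind, and the induction closes.\<close>

lemma Ck_on_compose_affine:
  assumes L: "bounded_linear L" and "open S" "Ck_on k S f"
  shows "Ck_on k ((\<lambda>x. L x + c) -` S) (\<lambda>x. f (L x + c))"
  using assms(3)
proof (induction k arbitrary: f)
  let ?A = "\<lambda>x. L x + c"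
  have cont: "continuous_on UNIV ?A"
    by (intro continuous_intros linear_continuous_on L)
  {
    case 0
    have "continuous_on (?A -` S) (\<lambda>x. f (?A x))"
      by (rule continuous_on_compose2[OF 0[unfolded Ck_on.simps] continuous_on_subset[OF cont]]) auto
    then show ?case by simp
  }
  case (Suc k)
  have op: "open (?A -` S)" using cont assms(2) by (simp add: open_vimage)
  have d: "((\<lambda>x. f (?A x)) has_derivative (\<lambda>v. frechet_derivative f (at (?A y)) (L v))) (at y)"
    if "?A y \<in> S" for y
  proof -
    have "(?A has_derivative L) (at y)"
      using bounded_linear_imp_has_derivative[OF L, of "at y"] by (auto intro!: derivative_eq_intros)
    moreover have "(f has_derivative frechet_derivative f (at (?A y))) (at (?A y))"
      using Suc.prems that by (auto simp: frechet_derivative_works[symmetric])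
    ultimately show ?thesis by (rule has_derivative_compose)
  qed
  have "Ck_on k (?A -` S) (\<lambda>x. frechet_derivative (\<lambda>x. f (?A x)) (at x) v)" for v
  proof (rule Ck_on_cong[OF op])
    show "Ck_on k (?A -` S) (\<lambda>y. frechet_derivative f (at (?A y)) (L v))"
      using Suc.prems Suc.IH[of "\<lambda>y. frechet_derivative f (at y) (L v)"] by simp
    fix y assume "y \<in> ?A -` S"
    with frechet_derivative_at[OF d[of y]]
    show "frechet_derivative f (at (?A y)) (L v) = frechet_derivative (\<lambda>x. f (?A x)) (at y) v" by (metis vimageE)
  qed
  then show ?case using d by (auto simp: differentiable_def)
qed

lemma Ck_on_bounded_linear:
  assumes "bounded_linear L"
  shows "Ck_on k S L"
proof (cases k)
  case 0
  then show ?thesis using assms by (simp add: linear_continuous_on)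
next
  case (Suc n)
  have "frechet_derivative L (at x) = L" for x
    using frechet_derivative_at bounded_linear_imp_has_derivative[OF assms] by metis
  then show ?thesis using Suc assms
    by (auto simp: Ck_on_const intro: bounded_linear_imp_differentiable)
qed

lemma Ck_on_inverse:
  fixes f :: "'a::euclidean_space \<Rightarrow> 'b::{real_normed_field}"
  assumes "open S" "Ck_on k S f" "\<And>x. x \<in> S \<Longrightarrow> f x \<noteq> 0"
  shows "Ck_on k S (\<lambda>x. inverse (f x))"
  using assms(2)
proof (induction k)
  case 0
  then show ?case using assms(3) by (auto intro: continuous_on_inverse)
next
  case (Suc k)
  have d: "((\<lambda>x. inverse (f x)) has_derivative
        (\<lambda>v. - (inverse (f y) * frechet_derivative f (at y) v * inverse (f y)))) (at y)"
    if "y \<in> S" for y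
    using Suc.prems that assms(3)
    by (intro Deriv.has_derivative_inverse) (auto simp: frechet_derivative_works[symmetric])
  note mult = Ck_on_bilinear[OF bounded_bilinear_mult assms(1)]
  have inv: "Ck_on k S (\<lambda>x. inverse (f x))" by (rule Suc.IH[OF Ck_on_Suc_imp[OF Suc.prems]])
  have "Ck_on k S (\<lambda>x. frechet_derivative (\<lambda>x. inverse (f x)) (at x) v)" for v
  proof (rule Ck_on_cong[OF assms(1)])
    show "Ck_on k S (\<lambda>y. - (inverse (f y) * frechet_derivative f (at y) v * inverse (f y)))"
      using Suc.prems
      by (intro Ck_on_bounded_linear_comp[OF bounded_linear_minus[OF bounded_linear_ident]] mult inv assms) auto
    fix y assume "y \<in> S"
    from frechet_derivative_at[OF d[OF this]]
    show "- (inverse (f y) * frechet_derivative f (at y) v * inverse (f y))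
        = frechet_derivative (\<lambda>x. inverse (f x)) (at y) v" by metis
  qed
  then show ?case using d by (auto simp: differentiable_def)
qed

section \<open>Smoothness on arbitrary sets by local extensions\<close>

lemma smooth_onI:
  assumes "\<And>x. x \<in> S \<Longrightarrow> \<exists>U g. open U \<and> x \<in> U \<and> (\<forall>k. Ck_on k U g) \<and> (\<forall>y\<in>S \<inter> U. g y = f y)"
  shows "smooth_on S f"
  using assms by (simp add: smooth_on_def)

lemma smooth_onE:
  assumes "smooth_on S f" "x \<in> S"
  obtains U g where "open U" "x \<in> U" "\<And>k. Ck_on k U g" "\<And>y. y \<in> S \<Longrightarrow> y \<in> U \<Longrightarrow> g y = f y"
proof -
  have "\<exists>U g. open U \<and> x \<in> U \<and> (\<forall>k. Ck_on k U g) \<and> (\<forall>y\<in>S \<inter> U. g y = f y)"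
    using assms by (simp add: smooth_on_def)
  then obtain U g where "open U" "x \<in> U" "\<forall>k. Ck_on k U g" "\<forall>y\<in>S \<inter> U. g y = f y"
    by blast
  then show ?thesis by (intro that[of U g]) auto
qed

lemma smooth_on_openI: "open S \<Longrightarrow> (\<And>k. Ck_on k S f) \<Longrightarrow> smooth_on S f"
  by (rule smooth_onI, rule exI[of _ S], rule exI[of _ f]) simp

lemma smooth_on_openD:
  assumes "open S" "smooth_on S f"
  shows "Ck_on k S f"
proof (rule Ck_on_local)
  fix x assume "x \<in> S"
  obtain U g where U: "open U" "x \<in> U" "\<And>k. Ck_on k U g" "\<And>y. y \<in> S \<Longrightarrow> y \<in> U \<Longrightarrow> g y = f y"
    by (rule smooth_onE[OF assms(2) \<open>x \<in> S\<close>]) blast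
  have "Ck_on k (S \<inter> U) f"
    using Ck_on_cong[of "S \<inter> U" g f k] Ck_on_subset[OF U(3), of "S \<inter> U"] U assms(1) by auto
  then show "\<exists>W. open W \<and> x \<in> W \<and> Ck_on k W f" using U assms(1) \<open>x \<in> S\<close> by blast
qed

lemma smooth_on_cong:
  assumes "smooth_on S f" "\<And>x. x \<in> S \<Longrightarrow> f x = g x"
  shows "smooth_on S g"
  using assms by (simp add: smooth_on_def)

lemma smooth_on_subset:
  assumes "smooth_on S f" "T \<subseteq> S"
  shows "smooth_on T f"
proof (rule smooth_onI)
  fix x assume "x \<in> T"
  then obtain U g where "open U" "x \<in> U" "\<And>k. Ck_on k U g" "\<And>y. y \<in> S \<Longrightarrow> y \<in> U \<Longrightarrow> g y = f y"
    using smooth_onE[OF assms(1), of x] assms(2) by blast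
  then show "\<exists>U g. open U \<and> x \<in> U \<and> (\<forall>k. Ck_on k U g) \<and> (\<forall>y\<in>T \<inter> U. g y = f y)"
    using assms(2) by (intro exI[of _ U] exI[of _ g]) auto
qed

lemma smooth_on_const: "smooth_on S (\<lambda>x. c)"
  by (rule smooth_on_subset[OF smooth_on_openI[OF open_UNIV Ck_on_const] subset_UNIV])

lemma smooth_on_bounded_linear: "bounded_linear L \<Longrightarrow> smooth_on S L"
  by (rule smooth_on_subset[OF smooth_on_openI[OF open_UNIV Ck_on_bounded_linear] subset_UNIV])

text \<open>Transfers a binary operation from \<open>Ck_on\<close> on open sets to
  \<open>smooth_on\<close>: the local extensions of both arguments are combined on the intersection
  of their domains.\<close>

lemma smooth_on_combine:
  fixes S :: "'a::euclidean_space set"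
  assumes f: "smooth_on S f" and g: "smooth_on S g"
    and h: "\<And>k (W :: 'a set) u v. open W \<Longrightarrow> Ck_on k W u \<Longrightarrow> Ck_on k W v \<Longrightarrow> Ck_on k W (\<lambda>x. h (u x) (v x))"
  shows "smooth_on S (\<lambda>x. h (f x) (g x))"
proof (rule smooth_onI)
  fix x assume "x \<in> S"
  obtain U f' where U: "open U" "x \<in> U" "\<And>k. Ck_on k U f'" "\<And>y. y \<in> S \<Longrightarrow> y \<in> U \<Longrightarrow> f' y = f y"
    by (rule smooth_onE[OF f \<open>x \<in> S\<close>]) blast
  obtain V g' where V: "open V" "x \<in> V" "\<And>k. Ck_on k V g'" "\<And>y. y \<in> S \<Longrightarrow> y \<in> V \<Longrightarrow> g' y = g y"
    by (rule smooth_onE[OF g \<open>x \<in> S\<close>]) blast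
  have "Ck_on k (U \<inter> V) (\<lambda>x. h (f' x) (g' x))" for k
    using U V by (intro h) (auto intro: Ck_on_subset)
  then show "\<exists>U g'. open U \<and> x \<in> U \<and> (\<forall>k. Ck_on k U g') \<and> (\<forall>y\<in>S \<inter> U. g' y = h (f y) (g y))"
    using U V by (intro exI[of _ "U \<inter> V"] exI[of _ "\<lambda>x. h (f' x) (g' x)"]) auto
qed

lemma smooth_on_bilinear:
  assumes "bounded_bilinear B" "smooth_on S f" "smooth_on S g"
  shows "smooth_on S (\<lambda>x. B (f x) (g x))"
  by (rule smooth_on_combine[OF assms(2,3) Ck_on_bilinear[OF assms(1)]])

lemma smooth_on_bounded_linear_comp:
  assumes L: "bounded_linear L" and f: "smooth_on S f"
  shows "smooth_on S (\<lambda>x. L (f x))"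
proof -
  interpret bounded_bilinear "\<lambda>(x::real) y. x *\<^sub>R L y"
    by (rule bounded_bilinear.comp[OF bounded_bilinear_scaleR bounded_linear_ident L])
  show ?thesis
    using smooth_on_bilinear[OF bounded_bilinear_axioms smooth_on_const[of S 1] f] by simp
qed

lemma smooth_on_add: "smooth_on S f \<Longrightarrow> smooth_on S g \<Longrightarrow> smooth_on S (\<lambda>x. f x + g x)"
  by (rule smooth_on_combine[OF _ _ Ck_on_add])

lemma smooth_on_mult:
  fixes f g :: "'a::euclidean_space \<Rightarrow> 'b::real_normed_algebra"
  shows "smooth_on S f \<Longrightarrow> smooth_on S g \<Longrightarrow> smooth_on S (\<lambda>x. f x * g x)"
  by (rule smooth_on_bilinear[OF bounded_bilinear_mult])

lemma smooth_on_minus: "smooth_on S f \<Longrightarrow> smooth_on S (\<lambda>x. - f x)"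
  by (rule smooth_on_bounded_linear_comp[OF bounded_linear_minus[OF bounded_linear_ident]])

lemma smooth_on_diff: "smooth_on S f \<Longrightarrow> smooth_on S g \<Longrightarrow> smooth_on S (\<lambda>x. f x - g x)"
  using smooth_on_add[of S f "\<lambda>x. - g x"] smooth_on_minus[of S g] by simp

lemma smooth_on_sum:
  "(\<And>i. i \<in> I \<Longrightarrow> smooth_on S (f i)) \<Longrightarrow> smooth_on S (\<lambda>x. \<Sum>i\<in>I. f i x)"
  by (induction I rule: infinite_finite_induct) (auto simp: smooth_on_const smooth_on_add)

lemma smooth_on_prod:
  fixes f :: "'i \<Rightarrow> 'a::euclidean_space \<Rightarrow> 'b::real_normed_field"
  shows "(\<And>i. i \<in> I \<Longrightarrow> smooth_on S (f i)) \<Longrightarrow> smooth_on S (\<lambda>x. \<Prod>i\<in>I. f i x)"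
  by (induction I rule: infinite_finite_induct) (auto simp: smooth_on_const smooth_on_mult)

lemma smooth_on_compose_linear:
  assumes L: "bounded_linear L" and f: "smooth_on T f" and "L ` S \<subseteq> T"
  shows "smooth_on S (\<lambda>x. f (L x))"
proof (rule smooth_onI)
  fix x assume "x \<in> S"
  then have Lx: "L x \<in> T" using assms(3) by blast
  obtain U g where U: "open U" "L x \<in> U" "\<And>k. Ck_on k U g" "\<And>y. y \<in> T \<Longrightarrow> y \<in> U \<Longrightarrow> g y = f y"
    by (rule smooth_onE[OF f Lx]) blast
  have "open (L -` U)" using U(1) linear_continuous_on[OF L, of UNIV] by (simp add: open_vimage)
  moreover have "Ck_on k (L -` U) (\<lambda>x. g (L x))" for k
    using Ck_on_compose_affine[OF L U(1) U(3), of k 0] by simp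
  ultimately show "\<exists>U g. open U \<and> x \<in> U \<and> (\<forall>k. Ck_on k U g) \<and> (\<forall>y\<in>S \<inter> U. g y = f (L y))"
    using U assms(3) by (intro exI[of _ "L -` U"] exI[of _ "\<lambda>x. g (L x)"]) auto
qed

lemma smooth_on_imp_continuous_on:
  assumes "smooth_on S f"
  shows "continuous_on S f"
  unfolding continuous_on_eq_continuous_within
proof
  fix x assume "x \<in> S"
  obtain U g where U: "open U" "x \<in> U" "\<And>k. Ck_on k U g" "\<And>y. y \<in> S \<Longrightarrow> y \<in> U \<Longrightarrow> g y = f y"
    by (rule smooth_onE[OF assms \<open>x \<in> S\<close>]) blast
  have "continuous (at x) g" using U(3)[of 0] U(1,2) by (simp add: continuous_on_eq_continuous_at)
  then have "continuous (at x within S) g" by (rule continuous_at_imp_continuous_at_within)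
  then show "continuous (at x within S) f"
    using U \<open>x \<in> S\<close>
    by (auto simp: continuous_within eventually_at_topological elim!: Lim_transform_eventually
        intro!: exI[of _ U])
qed

lemma smooth_on_inverse:
  fixes f :: "'a::euclidean_space \<Rightarrow> 'b::real_normed_field"
  assumes f: "smooth_on S f" and nz: "\<And>x. x \<in> S \<Longrightarrow> f x \<noteq> 0"
  shows "smooth_on S (\<lambda>x. inverse (f x))"
proof (rule smooth_onI)
  fix x assume "x \<in> S"
  obtain U f' where U: "open U" "x \<in> U" "\<And>k. Ck_on k U f'" "\<And>y. y \<in> S \<Longrightarrow> y \<in> U \<Longrightarrow> f' y = f y"
    by (rule smooth_onE[OF f \<open>x \<in> S\<close>]) blast
  \<comment> \<open>The extension \<open>f'\<close> may vanish off \<open>S\<close>, so the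
    neighbourhood is cut down to the points where it does not.\<close>
  define W where "W = U \<inter> f' -` (-{0})"
  have "continuous_on U f'" using U(3)[of 0] by simp
  then have W: "open W" unfolding W_def using U(1) by (intro continuous_open_preimage) auto
  have "x \<in> W" using U nz \<open>x \<in> S\<close> by (auto simp: W_def)
  moreover have "Ck_on k W (\<lambda>x. inverse (f' x))" for k
    by (rule Ck_on_inverse[OF W Ck_on_subset[OF U(3)]]) (auto simp: W_def)
  ultimately show "\<exists>U g'. open U \<and> x \<in> U \<and> (\<forall>k. Ck_on k U g') \<and> (\<forall>y\<in>S \<inter> U. g' y = inverse (f y))"
    using U W by (intro exI[of _ W] exI[of _ "\<lambda>x. inverse (f' x)"]) (auto simp: W_def)
qed

lemma smooth_on_divide:
  fixes f g :: "'a::euclidean_space \<Rightarrow> 'b::real_normed_field"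
  shows "smooth_on S f \<Longrightarrow> smooth_on S g \<Longrightarrow> (\<And>x. x \<in> S \<Longrightarrow> g x \<noteq> 0) \<Longrightarrow> smooth_on S (\<lambda>x. f x / g x)"
  unfolding divide_inverse by (intro smooth_on_mult smooth_on_inverse)

lemma smooth_on_UNIV_differentiable: "smooth_on UNIV f \<Longrightarrow> f differentiable at x"
  using smooth_on_openD[of UNIV f "Suc 0"] by simp

lemma smooth_on_frechet_derivative:
  assumes "open S" "smooth_on S f"
  shows "smooth_on S (\<lambda>x. frechet_derivative f (at x) v)"
  using smooth_on_openD[OF assms, of "Suc _"] assms(1) by (intro smooth_on_openI) auto

lemma smooth_on_cnj: "smooth_on S f \<Longrightarrow> smooth_on S (\<lambda>x. cnj (f x))"
  by (rule smooth_on_bounded_linear_comp[OF bounded_linear_cnj])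

lemma smooth_on_vec:
  fixes f :: "'a::euclidean_space \<Rightarrow> complex^'n"
  assumes "\<And>i. smooth_on S (\<lambda>x. f x $ i)"
  shows "smooth_on S f"
proof -
  have ax: "bounded_linear (\<lambda>c::complex. axis i c :: complex^'n)" for i
    by (intro linear_conv_bounded_linear[THEN iffD1] linearI) (auto simp: axis_def vec_eq_iff)
  have "smooth_on S (\<lambda>x. \<Sum>i\<in>UNIV. axis i (f x $ i))"
    by (intro smooth_on_sum smooth_on_bounded_linear_comp[OF ax] assms)
  moreover have "(\<Sum>i\<in>UNIV. axis i (f x $ i)) = f x" for x
    by (simp add: vec_eq_iff axis_def if_distrib cong: if_cong)
  ultimately show ?thesis by simp
qed

text \<open>The solution of a linear system is a quotient of determinants, which are polynomials in
  the smooth data.\<close>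

lemma smooth_on_matrix_inverse:
  fixes A :: "'a::euclidean_space \<Rightarrow> complex^'n^'n"
  assumes A: "\<And>i j. smooth_on S (\<lambda>x. A x $ i $ j)" and b: "\<And>i. smooth_on S (\<lambda>x. b x $ i)"
    and nz: "\<And>x. x \<in> S \<Longrightarrow> det (A x) \<noteq> 0" and y: "\<And>x. x \<in> S \<Longrightarrow> A x *v y x = b x"
  shows "smooth_on S (\<lambda>x. y x $ k)"
proof -
  have det: "smooth_on S (\<lambda>x. det (C x))" if "\<And>i j. smooth_on S (\<lambda>x. C x $ i $ j)"
    for C :: "'a \<Rightarrow> complex^'n^'n"
    unfolding det_def by (intro smooth_on_sum smooth_on_mult smooth_on_const smooth_on_prod that)
  have "smooth_on S (\<lambda>x. det (\<chi> i j. if j = k then b x $ i else A x $ i $ j) / det (A x))"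
  proof (intro smooth_on_divide det A nz)
    fix i j show "smooth_on S (\<lambda>x. (\<chi> i j. if j = k then b x $ i else A x $ i $ j) $ i $ j)"
      using A b by (cases "j = k") auto
  qed
  then show ?thesis
  proof (rule smooth_on_cong)
    fix x assume "x \<in> S"
    then have "y x = (\<chi> k. det (\<chi> i j. if j = k then b x $ i else A x $ i $ j) / det (A x))"
      using cramer[OF nz, of x "y x" "b x"] y by simp
    then show "det (\<chi> i j. if j = k then b x $ i else A x $ i $ j) / det (A x) = y x $ k"
      by simp
  qed
qed

text \<open>Differentiating in direction v replaces the integrand by its partial derivative in
  direction (v, 0). This is again an integrand of the same kind, one class lower, which is why the
  induction runs over all \<open>f\<close>.\<close>

lemma Ck_on_integral:
  fixes f :: "'a::euclidean_space \<times> 'b::euclidean_space \<Rightarrow> 'c::euclidean_space"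
  assumes "open S" "Ck_on k (S \<times> UNIV) f"
  shows "Ck_on k S (\<lambda>x. integral (cbox a b) (\<lambda>t. f (x, t)))"
  using assms(2)
proof (induction k arbitrary: f)
  case 0
  have "continuous_on (S \<times> cbox a b) (\<lambda>(x, t). f (x, t))"
    using 0 continuous_on_subset[of "S \<times> UNIV" f "S \<times> cbox a b"] by auto
  then show ?case using integral_continuous_on_param[of S a b "\<lambda>x t. f (x, t)"] by simp
next
  case (Suc k)
  have op: "open (S \<times> (UNIV :: 'b set))" using assms(1) by (simp add: open_Times)
  \<comment> \<open>\<open>leibniz_rule\<close> takes the partial derivative as a bounded linear map
    depending continuously on both arguments; continuity is checked on basis vectors below.\<close>
  define D where "D = (\<lambda>x t. Blinfun (\<lambda>v. frechet_derivative f (at (x, t)) (v, 0)))"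
  have f': "(f has_derivative frechet_derivative f (at (x, t))) (at (x, t))" if "x \<in> S" for x t
    using Suc.prems that by (auto simp: frechet_derivative_works[symmetric])
  have D: "blinfun_apply (D x t) = (\<lambda>v. frechet_derivative f (at (x, t)) (v, 0))" if "x \<in> S" for x t
  proof -
    have "bounded_linear (\<lambda>v::'a. (v, 0::'b))"
      by (rule bounded_linear_Pair[OF bounded_linear_ident bounded_linear_zero])
    from bounded_linear_compose[OF has_derivative_bounded_linear[OF f'[OF that]] this]
    show ?thesis unfolding D_def by (rule bounded_linear_Blinfun_apply)
  qed
  have cont: "continuous_on (S \<times> UNIV) f"
    by (rule Ck_on_imp_continuous_on[OF Suc.prems])
  have C: "Ck_on k (S \<times> UNIV) (\<lambda>p. frechet_derivative f (at p) (v, 0))" for v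
    using Suc.prems by simp
  have cD: "continuous_on (S \<times> UNIV) (\<lambda>p. frechet_derivative f (at p) (v, 0))" for v
    by (rule Ck_on_imp_continuous_on[OF C])
  have cD': "continuous_on (S \<times> cbox a b) (\<lambda>(x, t). D x t)"
  proof (rule continuous_on_blinfun_componentwise)
    fix i :: 'a
    have "continuous_on (S \<times> cbox a b) (\<lambda>p. frechet_derivative f (at p) (i, 0))"
      by (rule continuous_on_subset[OF cD]) auto
    then show "continuous_on (S \<times> cbox a b) (\<lambda>p. blinfun_apply (case p of (x, t) \<Rightarrow> D x t) i)"
      by (rule continuous_on_eq) (auto simp: D)
  qed
  have d: "((\<lambda>x. integral (cbox a b) (\<lambda>t. f (x, t))) has_derivative
      (\<lambda>v. integral (cbox a b) (\<lambda>t. frechet_derivative f (at (y, t)) (v, 0)))) (at y)"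
    if "y \<in> S" for y
  proof -
    \<comment> \<open>\<open>leibniz_rule\<close> works on a convex set, hence the ball around
      \<open>y\<close> inside \<open>S\<close>.\<close>
    from openE[OF assms(1) that] obtain e where e: "e > 0" "ball y e \<subseteq> S" .
    have "((\<lambda>x. integral (cbox a b) (\<lambda>t. f (x, t))) has_derivative
        blinfun_apply (integral (cbox a b) (D y))) (at y within ball y e)"
    proof (rule leibniz_rule)
      fix x t assume x: "x \<in> ball y e"
      have "((\<lambda>x. (x, t::'b)) has_derivative (\<lambda>v. (v, 0))) (at x)"
        by (rule has_derivative_Pair[OF has_derivative_ident has_derivative_const])
      moreover have xS: "x \<in> S" using x e by blast
      ultimately have "((\<lambda>x. f (x, t)) has_derivative (\<lambda>v. frechet_derivative f (at (x, t)) (v, 0))) (at x)"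
        using has_derivative_compose f'[OF xS] by fast
      then show "((\<lambda>x. f (x, t)) has_derivative blinfun_apply (D x t)) (at x within ball y e)"
        using D[OF xS] by (simp add: has_derivative_at_withinI)
    next
      show "(\<lambda>t. f (x, t)) integrable_on cbox a b" if "x \<in> ball y e" for x
      proof -
        note x = that
        have "continuous_on (cbox a b) (\<lambda>t. (x, t))" by (intro continuous_intros)
        moreover have "Pair x ` cbox a b \<subseteq> S \<times> UNIV" using x e by blast
        ultimately have "continuous_on (cbox a b) (\<lambda>t. f (x, t))"
          by (rule continuous_on_compose2[OF cont])
        then show ?thesis by (rule integrable_continuous)
      qed
    next
      show "continuous_on (ball y e \<times> cbox a b) (\<lambda>(x, t). D x t)"
        using e by (intro continuous_on_subset[OF cD']) auto
    qed (use e in auto)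
    moreover have "blinfun_apply (integral (cbox a b) (D y)) = (\<lambda>v.
        integral (cbox a b) (\<lambda>t. frechet_derivative f (at (y, t)) (v, 0)))"
    proof -
      have "continuous_on (cbox a b) (D y)"
      proof -
        have "continuous_on (cbox a b) (\<lambda>t. (y, t))" by (intro continuous_intros)
        moreover have "Pair y ` cbox a b \<subseteq> S \<times> cbox a b" using that by blast
        ultimately show ?thesis using continuous_on_compose2[OF cD'] by fastforce
      qed
      then have "D y integrable_on cbox a b" by (rule integrable_continuous)
      then show ?thesis using D[OF that] by (auto simp: blinfun_apply_integral)
    qed
    ultimately show ?thesis using e by (simp add: at_within_open[of y "ball y e"])
  qed
  have "Ck_on k S (\<lambda>x. frechet_derivative (\<lambda>x. integral (cbox a b) (\<lambda>t. f (x, t))) (at x) v)" for v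
  proof (rule Ck_on_cong[OF assms(1)])
    show "Ck_on k S (\<lambda>x. integral (cbox a b) (\<lambda>t. frechet_derivative f (at (x, t)) (v, 0)))"
      by (rule Suc.IH[OF C])
    fix y assume "y \<in> S"
    from frechet_derivative_at[OF d[OF this]]
    show "integral (cbox a b) (\<lambda>t. frechet_derivative f (at (y, t)) (v, 0))
        = frechet_derivative (\<lambda>x. integral (cbox a b) (\<lambda>t. f (x, t))) (at y) v" by metis
  qed
  then show ?case using d by (auto simp: differentiable_def)
qed


section \<open>Exterior calculus with one-forms\<close>

definition one_form :: "form \<Rightarrow> bool" where
  "one_form \<phi> \<longleftrightarrow> (\<forall>z vs. length vs \<noteq> 1 \<longrightarrow> \<phi> z vs = 0)"

definition insert_vec :: "point \<Rightarrow> form \<Rightarrow> form" where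
  "insert_vec v \<eta> = (\<lambda>z vs. \<eta> z (v # vs))"

definition dir_deriv :: "point \<Rightarrow> form \<Rightarrow> form" where
  "dir_deriv v \<eta> = (\<lambda>z vs. frechet_derivative (\<lambda>w. \<eta> w vs) (at z) v)"

definition diff_form :: "form \<Rightarrow> bool" where
  "diff_form \<eta> \<longleftrightarrow> (\<forall>z vs. (\<lambda>w. \<eta> w vs) differentiable (at z))"

definition total_diff :: "(point \<Rightarrow> complex) \<Rightarrow> form" where
  "total_diff f = (\<lambda>z vs. if length vs = 1 then frechet_derivative f (at z) (hd vs) else 0)"

lemma fmult_apply: "fmult f \<eta> z vs = f z * \<eta> z vs"
  by (simp add: fmult_def)

lemma one_formD: "one_form \<phi> \<Longrightarrow> length vs \<noteq> 1 \<Longrightarrow> \<phi> z vs = 0"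
  by (simp add: one_form_def)

lemma one_form_total_diff: "one_form (total_diff f)"
  by (simp add: one_form_def total_diff_def)

lemma total_diff_const: "total_diff (\<lambda>_. c) = 0"
  by (simp add: total_diff_def frechet_derivative_const fun_eq_iff)

section \<open>Wedge products with a one-form on the left\<close>

lemma nths_singleton: "i < length vs \<Longrightarrow> nths vs {i} = [vs ! i]"
proof (induction vs arbitrary: i)
  case (Cons a vs)
  show ?case
  proof (cases i)
    case 0
    then show ?thesis by (simp add: nths_Cons)
  next
    case (Suc j)
    then have "{k. Suc k \<in> {i}} = {j}" by auto
    then show ?thesis using Suc Cons by (simp add: nths_Cons)
  qed
qed simp

lemma shuffle_sign_singleton:
  assumes "i < n"
  shows "shuffle_sign n {i} = (-1) ^ i"
proof -
  have "{(a, b). a < b \<and> b < n \<and> a \<notin> {i} \<and> b \<in> {i}} = (\<lambda>a. (a, i)) ` {..<i}"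
    using assms by auto
  then show ?thesis by (simp add: shuffle_sign_def card_image inj_on_def)
qed

text \<open>Only the shuffles that give exactly one argument to \<open>\<phi>\<close> contribute,
  because a one-form vanishes on lists of any other length.\<close>

lemma wedge_one_form:
  assumes "one_form \<phi>"
  shows "(\<phi> \<and>\<^sub>f \<eta>) z vs = (\<Sum>i<length vs. (-1) ^ i * \<phi> z [vs ! i] * \<eta> z (nths vs (- {i})))"
proof -
  let ?g = "\<lambda>S. shuffle_sign (length vs) S * \<phi> z (nths vs S) * \<eta> z (nths vs (- S))"
  have "(\<phi> \<and>\<^sub>f \<eta>) z vs = sum ?g (Pow {..<length vs})" by (simp add: wedge_def)
  also have "\<dots> = sum ?g ((\<lambda>i. {i}) ` {..<length vs})"
  proof (rule sum.mono_neutral_right)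
    show "\<forall>S\<in>Pow {..<length vs} - (\<lambda>i. {i}) ` {..<length vs}. ?g S = 0"
    proof
      fix S assume S: "S \<in> Pow {..<length vs} - (\<lambda>i. {i}) ` {..<length vs}"
      then have "length (nths vs S) = card S"
        by (auto simp: length_nths intro!: arg_cong[of _ _ card])
      moreover have "card S \<noteq> 1" using S by (auto simp: card_1_singleton_iff)
      ultimately show "?g S = 0" using one_formD[OF assms] by simp
    qed
  qed auto
  also have "\<dots> = (\<Sum>i<length vs. ?g {i})"
    by (subst sum.reindex) (auto simp: inj_on_def)
  also have "\<dots> = (\<Sum>i<length vs. (-1) ^ i * \<phi> z [vs ! i] * \<eta> z (nths vs (- {i})))"
    by (intro sum.cong) (auto simp: nths_singleton shuffle_sign_singleton)
  finally show ?thesis .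
qed

lemma nths_Cons_compl_0: "nths (v # vs) (- {0}) = vs"
  by (simp add: nths_Cons nths_all)

lemma nths_Cons_compl_Suc: "nths (v # vs) (- {Suc i}) = v # nths vs (- {i})"
proof -
  have "{j. Suc j \<in> - {Suc i}} = - {i}" by auto
  then show ?thesis by (simp add: nths_Cons)
qed

lemma wedge_one_form_Nil: "one_form \<phi> \<Longrightarrow> (\<phi> \<and>\<^sub>f \<eta>) z [] = 0"
  by (simp add: wedge_one_form)

text \<open>Insertion of a vector is an antiderivation. Together with the value on the empty list
  this determines the product by recursion on the tangent vectors; \<open>ext_deriv_Cons\<close> is
  the analogous recursion for d, Cartan's formula for a constant vector field. Identities of forms
  can then be proved by induction on that list, with the right-hand factor left arbitrary.\<close>

lemma wedge_one_form_Cons: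
  assumes "one_form \<phi>"
  shows "(\<phi> \<and>\<^sub>f \<eta>) z (v # vs) = \<phi> z [v] * \<eta> z vs - (\<phi> \<and>\<^sub>f insert_vec v \<eta>) z vs"
  by (simp add: wedge_one_form[OF assms] sum.lessThan_Suc_shift nths_Cons_compl_0 nths_Cons_compl_Suc
      insert_vec_def sum_negf[symmetric] del: sum.lessThan_Suc)

lemma ext_deriv_Nil: "ext_deriv \<eta> z [] = 0"
  by (simp add: ext_deriv_def)

lemma ext_deriv_Cons:
  "ext_deriv \<eta> z (v # vs) = dir_deriv v \<eta> z vs - ext_deriv (insert_vec v \<eta>) z vs"
  by (simp add: ext_deriv_def sum.lessThan_Suc_shift nths_Cons_compl_0 nths_Cons_compl_Suc
      insert_vec_def dir_deriv_def sum_negf[symmetric] del: sum.lessThan_Suc)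

lemma wedge_add_right: "\<phi> \<and>\<^sub>f (\<eta> + \<zeta>) = \<phi> \<and>\<^sub>f \<eta> + \<phi> \<and>\<^sub>f \<zeta>"
  by (simp add: wedge_def fun_eq_iff distrib_left sum.distrib)

lemma wedge_add_left: "(\<eta> + \<zeta>) \<and>\<^sub>f \<phi> = \<eta> \<and>\<^sub>f \<phi> + \<zeta> \<and>\<^sub>f \<phi>"
  by (simp add: wedge_def fun_eq_iff distrib_left distrib_right sum.distrib)

lemma wedge_fmult_right: "\<phi> \<and>\<^sub>f fmult f \<eta> = fmult f (\<phi> \<and>\<^sub>f \<eta>)"
  by (simp add: wedge_def fun_eq_iff fmult_def sum_distrib_left algebra_simps)

lemma wedge_fmult_left: "fmult f \<phi> \<and>\<^sub>f \<eta> = fmult f (\<phi> \<and>\<^sub>f \<eta>)"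
  by (simp add: wedge_def fun_eq_iff fmult_def sum_distrib_left algebra_simps)

lemma wedge_zero_right: "\<phi> \<and>\<^sub>f 0 = 0"
  by (simp add: wedge_def fun_eq_iff)

lemma wedge_zero_left: "0 \<and>\<^sub>f \<phi> = 0"
  by (simp add: wedge_def fun_eq_iff)

lemma wedge_minus_right: "\<phi> \<and>\<^sub>f (- \<eta>) = - (\<phi> \<and>\<^sub>f \<eta>)"
  by (simp add: wedge_def fun_eq_iff sum_negf)

lemma wedge_diff_right: "\<phi> \<and>\<^sub>f (\<eta> - \<zeta>) = \<phi> \<and>\<^sub>f \<eta> - \<phi> \<and>\<^sub>f \<zeta>"
  by (simp add: wedge_def fun_eq_iff right_diff_distrib sum_subtractf)

lemma wedge_sum_right: "\<phi> \<and>\<^sub>f (\<Sum>i\<in>I. \<eta> i) = (\<Sum>i\<in>I. \<phi> \<and>\<^sub>f \<eta> i)"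
  by (induction I rule: infinite_finite_induct)
    (simp_all only: sum.infinite sum.empty sum.insert wedge_zero_right wedge_add_right not_False_eq_True)

lemma wedge_sum_left: "(\<Sum>i\<in>I. \<eta> i) \<and>\<^sub>f \<phi> = (\<Sum>i\<in>I. \<eta> i \<and>\<^sub>f \<phi>)"
  by (induction I rule: infinite_finite_induct)
    (simp_all only: sum.infinite sum.empty sum.insert wedge_zero_left wedge_add_left not_False_eq_True)

lemma insert_vec_wedge:
  assumes "one_form \<phi>"
  shows "insert_vec v (\<phi> \<and>\<^sub>f \<eta>) = fmult (\<lambda>z. \<phi> z [v]) \<eta> - \<phi> \<and>\<^sub>f insert_vec v \<eta>"
  using wedge_one_form_Cons[OF assms] by (simp add: fun_eq_iff insert_vec_def fmult_def)

text \<open>After inserting a vector, the terms that pair it with \<open>\<phi>\<close> or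
  \<open>\<psi>\<close> match on both sides, and what remains is the claim for
  \<open>insert_vec v \<eta>\<close>.\<close>

lemma wedge_anticomm:
  assumes "one_form \<phi>" "one_form \<psi>"
  shows "\<phi> \<and>\<^sub>f \<psi> \<and>\<^sub>f \<eta> = - (\<psi> \<and>\<^sub>f \<phi> \<and>\<^sub>f \<eta>)"
proof -
  have "(\<phi> \<and>\<^sub>f \<psi> \<and>\<^sub>f \<eta>) z vs = - (\<psi> \<and>\<^sub>f \<phi> \<and>\<^sub>f \<eta>) z vs" for z vs
  proof (induction vs arbitrary: \<eta>)
    case Nil
    then show ?case by (simp add: wedge_one_form_Nil assms)
  next
    case (Cons v vs)
    show ?case
      using Cons[of "insert_vec v \<eta>"]
      by (simp add: wedge_one_form_Cons assms insert_vec_wedge wedge_diff_right wedge_fmult_right fmult_apply)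
  qed
  then show ?thesis by (simp add: fun_eq_iff)
qed

lemma wedge_self:
  assumes "one_form \<phi>"
  shows "\<phi> \<and>\<^sub>f \<phi> \<and>\<^sub>f \<eta> = 0"
proof (intro ext)
  fix z vs
  have "(\<phi> \<and>\<^sub>f \<phi> \<and>\<^sub>f \<eta>) z vs = - (\<phi> \<and>\<^sub>f \<phi> \<and>\<^sub>f \<eta>) z vs"
    using wedge_anticomm[OF assms assms, of \<eta>] by (metis fun_Compl_def)
  then show "(\<phi> \<and>\<^sub>f \<phi> \<and>\<^sub>f \<eta>) z vs = 0 z vs" by simp
qed

lemma wedge_form_one:
  assumes "one_form \<phi>"
  shows "\<phi> \<and>\<^sub>f form_one = \<phi>"
proof (intro ext)
  fix z vs
  have 0: "insert_vec v form_one = 0" for v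
    by (simp add: insert_vec_def form_one_def fun_eq_iff)
  have 1: "form_one z us = (if us = [] then 1 else 0)" for us
    by (simp add: form_one_def)
  show "(\<phi> \<and>\<^sub>f form_one) z vs = \<phi> z vs"
    by (cases vs) (simp_all add: wedge_one_form_Nil wedge_one_form_Cons 0 1 wedge_zero_right assms one_formD)
qed

section \<open>The exterior derivative and its Leibniz rules\<close>

lemma diff_formD: "diff_form \<eta> \<Longrightarrow> (\<lambda>w. \<eta> w vs) differentiable (at z)"
  by (simp add: diff_form_def)

lemma diff_form_insert_vec: "diff_form \<eta> \<Longrightarrow> diff_form (insert_vec v \<eta>)"
  by (simp add: diff_form_def insert_vec_def)

lemma diff_form_add: "diff_form \<eta> \<Longrightarrow> diff_form \<zeta> \<Longrightarrow> diff_form (\<eta> + \<zeta>)"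
  by (simp add: diff_form_def differentiable_add)

lemma diff_form_zero: "diff_form 0"
  by (simp add: diff_form_def)

lemma diff_form_sum: "(\<And>i. i \<in> I \<Longrightarrow> diff_form (\<eta> i)) \<Longrightarrow> diff_form (\<Sum>i\<in>I. \<eta> i)"
  by (induction I rule: infinite_finite_induct) (auto simp: diff_form_zero diff_form_add)

lemma diff_form_fmult:
  "(\<And>z. f differentiable (at z)) \<Longrightarrow> diff_form \<eta> \<Longrightarrow> diff_form (fmult f \<eta>)"
  by (simp add: diff_form_def fmult_def differentiable_mult)

lemma diff_form_wedge:
  assumes "one_form \<phi>" "diff_form \<phi>" "diff_form \<eta>"
  shows "diff_form (\<phi> \<and>\<^sub>f \<eta>)"
  using assms(2,3) unfolding diff_form_def wedge_one_form[OF assms(1)]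
  by (auto intro!: differentiable_sum differentiable_mult)

lemma frechet_derivative_add:
  assumes "f differentiable (at z)" "g differentiable (at z)"
  shows "frechet_derivative (\<lambda>w. f w + g w) (at z) v
    = frechet_derivative f (at z) v + frechet_derivative g (at z) v"
proof -
  have "((\<lambda>w. f w + g w) has_derivative
      (\<lambda>v. frechet_derivative f (at z) v + frechet_derivative g (at z) v)) (at z)"
    using assms by (intro has_derivative_add) (simp_all add: frechet_derivative_works[symmetric])
  from frechet_derivative_at[OF this] show ?thesis by metis
qed

lemma frechet_derivative_mult:
  fixes f g :: "'a::real_normed_vector \<Rightarrow> 'b::real_normed_algebra"
  assumes "f differentiable (at z)" "g differentiable (at z)"
  shows "frechet_derivative (\<lambda>w. f w * g w) (at z) v
    = f z * frechet_derivative g (at z) v + frechet_derivative f (at z) v * g z"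
proof -
  have "((\<lambda>w. f w * g w) has_derivative
      (\<lambda>v. f z * frechet_derivative g (at z) v + frechet_derivative f (at z) v * g z)) (at z)"
    using assms by (intro has_derivative_mult) (simp_all add: frechet_derivative_works[symmetric])
  from frechet_derivative_at[OF this] show ?thesis by metis
qed

lemma ext_deriv_add:
  "diff_form \<eta> \<Longrightarrow> diff_form \<zeta> \<Longrightarrow> ext_deriv (\<eta> + \<zeta>) = ext_deriv \<eta> + ext_deriv \<zeta>"
  by (simp add: fun_eq_iff ext_deriv_def frechet_derivative_add diff_formD distrib_left sum.distrib)

lemma ext_deriv_zero: "ext_deriv 0 = 0"
  by (simp add: fun_eq_iff ext_deriv_def frechet_derivative_const)

lemma ext_deriv_sum:
  "(\<And>i. i \<in> I \<Longrightarrow> diff_form (\<eta> i)) \<Longrightarrow> ext_deriv (\<Sum>i\<in>I. \<eta> i) = (\<Sum>i\<in>I. ext_deriv (\<eta> i))"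
  by (induction I rule: infinite_finite_induct)
    (auto simp: ext_deriv_zero ext_deriv_add diff_form_sum)

lemma ext_deriv_fmult:
  assumes "\<And>z. f differentiable (at z)" "diff_form \<eta>"
  shows "ext_deriv (fmult f \<eta>) = total_diff f \<and>\<^sub>f \<eta> + fmult f (ext_deriv \<eta>)"
proof (intro ext)
  fix z vs
  have "(total_diff f \<and>\<^sub>f \<eta>) z vs = (\<Sum>i<length vs. (-1) ^ i *
      frechet_derivative f (at z) (vs ! i) * \<eta> z (nths vs (- {i})))"
    by (simp add: wedge_one_form[OF one_form_total_diff], simp add: total_diff_def)
  then show "ext_deriv (fmult f \<eta>) z vs = (total_diff f \<and>\<^sub>f \<eta> + fmult f (ext_deriv \<eta>)) z vs"
    using assms
    by (simp add: ext_deriv_def fmult_def frechet_derivative_mult diff_formD sum.distrib sum_distrib_left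
        algebra_simps)
qed

lemma frechet_derivative_cmult:
  fixes f :: "'a::real_normed_vector \<Rightarrow> 'b::real_normed_algebra"
  assumes "f differentiable (at z)"
  shows "frechet_derivative (\<lambda>w. c * f w) (at z) v = c * frechet_derivative f (at z) v"
  using frechet_derivative_mult[of "\<lambda>_. c" z f v] assms by (simp add: frechet_derivative_const)

lemma frechet_derivative_sum:
  assumes "\<And>i. i \<in> I \<Longrightarrow> f i differentiable (at z)"
  shows "frechet_derivative (\<lambda>w. \<Sum>i\<in>I. f i w) (at z) v = (\<Sum>i\<in>I. frechet_derivative (f i) (at z) v)"
  using assms
proof (induction I rule: infinite_finite_induct)
  case (insert i I)
  have "(\<lambda>w. \<Sum>i\<in>I. f i w) differentiable (at z)" using insert by (intro differentiable_sum) auto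
  then show ?case using insert by (simp add: frechet_derivative_add)
qed (auto simp: frechet_derivative_const)

lemma dir_deriv_wedge:
  assumes "one_form \<phi>" "\<And>z w vs. \<phi> z vs = \<phi> w vs" "diff_form \<eta>"
  shows "dir_deriv v (\<phi> \<and>\<^sub>f \<eta>) = \<phi> \<and>\<^sub>f dir_deriv v \<eta>"
proof (intro ext)
  fix z vs
  have c: "\<phi> = (\<lambda>w. \<phi> z)" by (intro ext assms(2))
  have "(\<lambda>w. (\<phi> \<and>\<^sub>f \<eta>) w vs)
      = (\<lambda>w. \<Sum>i<length vs. ((-1) ^ i * \<phi> z [vs ! i]) * \<eta> w (nths vs (- {i})))"
    by (simp only: wedge_one_form[OF assms(1)]) (subst c, rule refl)
  then show "dir_deriv v (\<phi> \<and>\<^sub>f \<eta>) z vs = (\<phi> \<and>\<^sub>f dir_deriv v \<eta>) z vs"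
    using assms(3)
    by (simp add: dir_deriv_def wedge_one_form[OF assms(1)] frechet_derivative_sum frechet_derivative_cmult
        diff_formD differentiable_mult)
qed

text \<open>A one-form with constant coefficients is closed, so only one term of the Leibniz rule
  remains. In the induction, the pairing of \<open>\<phi>\<close> with the inserted vector is a
  constant and passes through d, while the directional derivative commutes with wedging by
  \<open>\<phi>\<close>.\<close>

lemma ext_deriv_wedge_const:
  assumes "one_form \<phi>" "\<And>z w vs. \<phi> z vs = \<phi> w vs" "diff_form \<eta>"
  shows "ext_deriv (\<phi> \<and>\<^sub>f \<eta>) = - (\<phi> \<and>\<^sub>f ext_deriv \<eta>)"
proof -
  have c: "\<phi> = (\<lambda>z. \<phi> 0)" using assms(2) by (intro ext)
  have d\<phi>: "diff_form \<phi>" by (subst c) (simp add: diff_form_def)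
  have "ext_deriv (\<phi> \<and>\<^sub>f \<eta>) z vs = - (\<phi> \<and>\<^sub>f ext_deriv \<eta>) z vs" for z vs
    using assms(3)
  proof (induction vs arbitrary: \<eta>)
    case Nil
    then show ?case by (simp add: ext_deriv_Nil wedge_one_form_Nil assms)
  next
    case (Cons v vs)
    let ?i = "insert_vec v \<eta>"
    have di: "diff_form ?i" using Cons.prems by (rule diff_form_insert_vec)
    have "insert_vec v (\<phi> \<and>\<^sub>f \<eta>) = fmult (\<lambda>z. \<phi> z [v]) \<eta> + fmult (\<lambda>_. -1) (\<phi> \<and>\<^sub>f ?i)"
      by (simp add: insert_vec_wedge assms fun_eq_iff fmult_def)
    moreover have "total_diff (\<lambda>z. \<phi> z [v]) = 0" "total_diff (\<lambda>_. -1) = 0"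
    proof -
      have "(\<lambda>z. \<phi> z [v]) = (\<lambda>z. \<phi> 0 [v])" by (intro ext assms(2))
      then have "total_diff (\<lambda>z. \<phi> z [v]) = total_diff (\<lambda>z. \<phi> 0 [v])" by (rule arg_cong)
      then show "total_diff (\<lambda>z. \<phi> z [v]) = 0" by (simp only: total_diff_const)
    qed (rule total_diff_const)
    ultimately have e: "ext_deriv (insert_vec v (\<phi> \<and>\<^sub>f \<eta>))
        = fmult (\<lambda>z. \<phi> z [v]) (ext_deriv \<eta>) + fmult (\<lambda>_. -1) (ext_deriv (\<phi> \<and>\<^sub>f ?i))"
      using Cons.prems di d\<phi> assms(1)
      by (simp add: ext_deriv_add ext_deriv_fmult diff_form_fmult diff_form_wedge wedge_zero_left diff_formD)
    have "insert_vec v (ext_deriv \<eta>) = dir_deriv v \<eta> - ext_deriv ?i"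
      by (simp add: fun_eq_iff insert_vec_def[of v "ext_deriv \<eta>"] ext_deriv_Cons)
    then have "(\<phi> \<and>\<^sub>f ext_deriv \<eta>) z (v # vs)
        = \<phi> z [v] * ext_deriv \<eta> z vs - (\<phi> \<and>\<^sub>f dir_deriv v \<eta>) z vs + (\<phi> \<and>\<^sub>f ext_deriv ?i) z vs"
      by (simp add: wedge_one_form_Cons assms wedge_diff_right)
    moreover have "ext_deriv (\<phi> \<and>\<^sub>f \<eta>) z (v # vs)
        = (\<phi> \<and>\<^sub>f dir_deriv v \<eta>) z vs - \<phi> z [v] * ext_deriv \<eta> z vs + ext_deriv (\<phi> \<and>\<^sub>f ?i) z vs"
      by (simp add: ext_deriv_Cons e dir_deriv_wedge[OF assms(1,2) Cons.prems] fmult_def)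
    ultimately show ?case using Cons.IH[OF di] by simp
  qed
  then show ?thesis by (simp add: fun_eq_iff)
qed


section \<open>The mean of a function on the Iwasawa manifold\<close>

text \<open>Integer shifts change nothing, so \<open>w\<close> is replaced by its fractional part r.
  The interval from r to 1 + r is cut at 1, and the piece beyond 1 moves back by one period.\<close>

lemma integral_unit_shift:
  fixes p :: "real \<Rightarrow> complex"
  assumes c: "continuous_on UNIV p" and per: "\<And>x. p (x + 1) = p x"
  shows "integral {0..1} (\<lambda>x. p (x + w)) = integral {0..1} p"
proof -
  have pern: "p (x + of_nat n) = p x" for x n
  proof (induction n)
    case (Suc n)
    then show ?case using per[of "x + of_nat n"] by (simp add: ac_simps)
  qed simp
  have peri: "p (x + of_int n) = p x" for x n
  proof (cases "n \<ge> 0")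
    case True
    then show ?thesis using pern[of x "nat n"] by simp
  next
    case False
    then show ?thesis using pern[of "x + of_int n" "nat (- n)"] by simp
  qed
  define r where "r = frac w"
  have r: "0 \<le> r" "r < 1" by (auto simp: r_def frac_lt_1)
  have i: "p integrable_on {a..b}" for a b
    by (rule integrable_continuous_interval[OF continuous_on_subset[OF c]]) simp
  have sh: "integral {a..b} (\<lambda>x. p (x + d)) = integral {a + d..b + d} p" for a b d
    using integral_shift[of a d b p] continuous_on_subset[OF c] by (simp add: o_def)
  have "p (x + w) = p (x + r)" for x
    using peri[of "x + r" "\<lfloor>w\<rfloor>"] by (simp add: r_def frac_def)
  then have "integral {0..1} (\<lambda>x. p (x + w)) = integral {r..1 + r} p"
    using sh[of 0 1 r] by simp
  also have "\<dots> = integral {r..1} p + integral {1..1 + r} p"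
    using r i by (intro Henstock_Kurzweil_Integration.integral_combine[symmetric]) auto
  also have "integral {1..1 + r} p = integral {0..r} p"
    using sh[of 0 r 1] per by (simp add: add.commute)
  also have "integral {r..1} p + integral {0..r} p = integral {0..1} p"
    using r i Henstock_Kurzweil_Integration.integral_combine[of 0 r 1 p]
    by (simp add: add.commute)
  finally show ?thesis .
qed

text \<open>The unit square is a fundamental domain of the Gaussian integers in the complex plane,
  so for doubly periodic \<open>u\<close> this is the mean over the torus.\<close>

definition square_mean :: "(real \<times> real \<Rightarrow> complex) \<Rightarrow> complex" where
  "square_mean u = integral (cbox (0, 0) (1, 1)) u"

lemma continuous_on_square_mean:
  fixes g :: "'a::topological_space \<times> (real \<times> real) \<Rightarrow> complex"
  assumes "continuous_on UNIV g"
  shows "continuous_on UNIV (\<lambda>a. square_mean (\<lambda>c. g (a, c)))"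
  unfolding square_mean_def
  by (rule integral_continuous_on_param) (use assms in \<open>auto intro: continuous_on_subset\<close>)

lemma square_mean_shift:
  assumes u: "continuous_on UNIV u"
    and per: "\<And>p. u (p + (1, 0)) = u p" "\<And>p. u (p + (0, 1)) = u p"
  shows "square_mean (\<lambda>p. u (p + w)) = square_mean u"
proof -
  obtain a b where w: "w = (a, b)" by (cases w)
  have fub: "square_mean v = integral {0..1} (\<lambda>x. integral {0..1} (\<lambda>y. v (x, y)))"
    if "continuous_on UNIV v" for v
    unfolding square_mean_def
    using integral_prod_continuous[of 0 0 1 1 v] continuous_on_subset[OF that] by simp
  have uw: "continuous_on UNIV (\<lambda>p. u (p + w))"
    by (rule continuous_on_compose2[OF u]) (auto intro!: continuous_intros)
  have ux: "continuous_on UNIV (\<lambda>y. u (x, y))" for x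
    by (rule continuous_on_compose2[OF u]) (auto intro!: continuous_intros)
  define q where "q x = integral {0..1} (\<lambda>y. u (x, y))" for x
  have q: "continuous_on UNIV q"
    unfolding q_def using integral_continuous_on_param[of UNIV 0 1 "\<lambda>x y. u (x, y)"]
      continuous_on_subset[OF u] by (simp add: case_prod_eta)
  have qper: "q (x + 1) = q x" for x
  proof -
    have "u (x + 1, y) = u (x, y)" for y using per(1)[of "(x, y)"] by simp
    then show ?thesis by (simp add: q_def)
  qed
  have "square_mean (\<lambda>p. u (p + w)) = integral {0..1} (\<lambda>x. integral {0..1} (\<lambda>y. u (x + a, y + b)))"
    using fub[OF uw] by (simp add: w)
  also have "\<dots> = integral {0..1} (\<lambda>x. q (x + a))"
  proof -
    have "u (x, y + 1) = u (x, y)" for x y using per(2)[of "(x, y)"] by simp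
    then show ?thesis by (simp add: q_def integral_unit_shift[OF ux])
  qed
  also have "\<dots> = integral {0..1} q" by (rule integral_unit_shift[OF q qper])
  also have "\<dots> = square_mean u" using fub[OF u] by (simp add: q_def[abs_def])
  finally show ?thesis .
qed

definition cpair :: "complex \<Rightarrow> real \<times> real" where "cpair w = (Re w, Im w)"

definition cplx :: "real \<times> real \<Rightarrow> complex" where "cplx p = Complex (fst p) (snd p)"

lemma cplx_cpair [simp]: "cplx (cpair w) = w"
  by (simp add: cplx_def cpair_def)

lemma cplx_add: "cplx (p + q) = cplx p + cplx q"
  by (simp add: cplx_def complex_eq_iff)

type_synonym box_point = "(real \<times> real) \<times> (real \<times> real) \<times> (real \<times> real)"

definition box_pt :: "box_point \<Rightarrow> point" where
  "box_pt p = vector [cplx (fst p), cplx (fst (snd p)), cplx (snd (snd p))]"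

text \<open>The unit box is, up to its boundary, a fundamental domain for left translations by
  \<open>heis_lattice\<close>, and Lebesgue measure in these coordinates is a Haar measure. For
  invariant \<open>f\<close> this is therefore the normalised integral over the Iwasawa
  manifold.\<close>

definition mean :: "(point \<Rightarrow> complex) \<Rightarrow> complex" where
  "mean f = integral (cbox ((0, 0), (0, 0), (0, 0)) ((1, 1), (1, 1), (1, 1))) (\<lambda>p. f (box_pt p))"

lemma continuous_on_vector3 [continuous_intros]:
  fixes a b c :: "'a::topological_space \<Rightarrow> complex"
  assumes "continuous_on S a" "continuous_on S b" "continuous_on S c"
  shows "continuous_on S (\<lambda>x. vector [a x, b x, c x] :: point)"
proof -
  have e: "(\<lambda>x. vector [a x, b x, c x] :: point) = (\<lambda>x. \<chi> i. if i = 1 then a x else if i = 2 then b x else c x)"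
    by (simp add: fun_eq_iff vec_eq_iff forall_3 vector_3)
  show ?thesis unfolding e
  proof (rule continuous_on_vec_lambda)
    fix i :: 3
    show "continuous_on S (\<lambda>x. if i = 1 then a x else if i = 2 then b x else c x)"
      using assms by (cases "i = 1"; cases "i = 2") simp_all
  qed
qed

lemma continuous_on_cplx [continuous_intros]: "continuous_on S f \<Longrightarrow> continuous_on S (\<lambda>x. cplx (f x))"
  unfolding cplx_def Complex_eq by (intro continuous_intros)

lemma bounded_linear_box_pt: "bounded_linear box_pt"
  unfolding linear_conv_bounded_linear[symmetric]
  by (rule linearI) (simp_all add: box_pt_def cplx_def vec_eq_iff forall_3 vector_3 complex_eq_iff)

lemma continuous_on_box_pt [continuous_intros]: "continuous_on S f \<Longrightarrow> continuous_on S (\<lambda>x. box_pt (f x))"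
  by (rule bounded_linear.continuous_on[OF bounded_linear_box_pt])

lemma continuous_on_heis_mult [continuous_intros]:
  fixes f g :: "'a::topological_space \<Rightarrow> point"
  assumes "continuous_on S f" "continuous_on S g"
  shows "continuous_on S (\<lambda>x. heis_mult (f x) (g x))"
  unfolding heis_mult_def using assms by (intro continuous_intros)

lemma mean_const: "mean (\<lambda>_. c) = c"
  by (simp add: mean_def content_Pair)

lemma box_integrable:
  fixes f :: "point \<Rightarrow> complex"
  assumes "continuous_on UNIV f"
  shows "(\<lambda>p. f (box_pt p)) integrable_on cbox a b"
  by (intro integrable_continuous continuous_on_compose2[OF assms] continuous_intros) auto

lemma mean_add:
  "continuous_on UNIV f \<Longrightarrow> continuous_on UNIV g \<Longrightarrow> mean (\<lambda>z. f z + g z) = mean f + mean g"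
  unfolding mean_def by (rule integral_add; rule box_integrable)

lemma mean_cmult: "mean (\<lambda>z. c * f z) = c * mean f"
  by (simp add: mean_def)

lemma mean_iterated:
  assumes f: "continuous_on UNIV f"
  shows "mean f = square_mean (\<lambda>a. square_mean (\<lambda>b. square_mean (\<lambda>c. f (box_pt (a, b, c)))))"
proof -
  have g: "continuous_on UNIV (\<lambda>p. f (box_pt p))"
    by (rule continuous_on_compose2[OF f]) (auto intro!: continuous_intros)
  have ga: "continuous_on UNIV (\<lambda>p. f (box_pt (a, p)))" for a
    by (rule continuous_on_compose2[OF f]) (auto intro!: continuous_intros)
  have "mean f = integral (cbox (0, 0) (1, 1)) (\<lambda>a. integral (cbox ((0, 0), (0, 0)) ((1, 1), (1, 1)))
      (\<lambda>p. f (box_pt (a, p))))"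
    unfolding mean_def by (rule integral_prod_continuous) (rule continuous_on_subset[OF g], simp)
  also have "(\<lambda>a. integral (cbox ((0, 0), (0, 0)) ((1, 1), (1, 1))) (\<lambda>p. f (box_pt (a, p))))
      = (\<lambda>a. square_mean (\<lambda>b. square_mean (\<lambda>c. f (box_pt (a, b, c)))))"
    unfolding square_mean_def
    by (intro ext integral_prod_continuous) (rule continuous_on_subset[OF ga], simp)
  finally show ?thesis by (simp add: square_mean_def)
qed

text \<open>In coordinates (a, b, c) the right translation shifts a and b by constants and c by an
  amount depending on a. An invariant function is periodic in c and in b, but in a only up to a
  shift of c that depends on b. So the shifts are removed from the inside out: the integral over c
  absorbs every shift of c, which makes the inner mean \<open>F\<close> periodic in a as
  well.\<close>

lemma mean_right_translation:
  assumes f: "continuous_on UNIV f" and inv: "\<And>g z. g \<in> heis_lattice \<Longrightarrow> f (heis_mult g z) = f z"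
  shows "mean (\<lambda>z. f (heis_mult z h)) = mean f"
proof -
  define G where "G a b c = f (box_pt (a, b, c))" for a b c
  have G: "continuous_on UNIV (\<lambda>x. G (\<alpha> x) (\<beta> x) (\<gamma> x))"
    if "continuous_on UNIV \<alpha>" "continuous_on UNIV \<beta>" "continuous_on UNIV \<gamma>"
    for \<alpha> \<beta> \<gamma> :: "'x::topological_space \<Rightarrow> real \<times> real"
    unfolding G_def by (rule continuous_on_compose2[OF f]) (auto intro!: continuous_intros that)
  have lat: "f (heis_mult (vector [x, y, w]) z) = f z"
    if "{x, y, w} \<subseteq> {0, 1, \<i>}" for x y w z
    using that by (intro inv) (auto simp: heis_lattice_def forall_3 vector_3)
  have m: "cplx m \<in> {1, \<i>}" if "m \<in> {(1, 0), (0, 1)}" for m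
    using that by (auto simp: cplx_def complex_eq_iff)
  have p3: "G a b (c + m) = G a b c" if "m \<in> {(1, 0), (0, 1)}" for a b c m
  proof -
    have "box_pt (a, b, c + m) = heis_mult (vector [0, 0, cplx m]) (box_pt (a, b, c))"
      by (simp add: heis_mult_def box_pt_def cplx_add vector_3 add.commute)
    then show ?thesis using lat m[OF that] by (simp add: G_def)
  qed
  have p2: "G a (b + m) c = G a b c" if "m \<in> {(1, 0), (0, 1)}" for a b c m
  proof -
    have "box_pt (a, b + m, c) = heis_mult (vector [0, cplx m, 0]) (box_pt (a, b, c))"
      by (simp add: heis_mult_def box_pt_def cplx_add vector_3 add.commute)
    then show ?thesis using lat m[OF that] by (simp add: G_def)
  qed
  then have p2': "G a (b + m) = G a b" if "m \<in> {(1, 0), (0, 1)}" for a b m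
    using that by (intro ext) blast
  have p1: "G (a + m) b (c + cpair (cplx m * cplx b)) = G a b c" if "m \<in> {(1, 0), (0, 1)}" for a b c m
  proof -
    have "box_pt (a + m, b, c + cpair (cplx m * cplx b)) = heis_mult (vector [cplx m, 0, 0]) (box_pt (a, b, c))"
      by (simp add: heis_mult_def box_pt_def cplx_add vector_3 add.commute)
    then show ?thesis using lat m[OF that] by (simp add: G_def)
  qed
  have s3: "square_mean (\<lambda>c. G a b (c + w)) = square_mean (G a b)" for a b w
    by (rule square_mean_shift) (auto simp: p3 intro!: G continuous_intros)
  define F where "F a b = square_mean (G a b)" for a b
  have F: "continuous_on UNIV (\<lambda>p. F (fst p) (snd p))"
    unfolding F_def
    using continuous_on_square_mean[of "\<lambda>x. G (fst (fst x)) (snd (fst x)) (snd x)"]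
      G[of "\<lambda>x. fst (fst x)" "\<lambda>x. snd (fst x)" snd]
    by (simp add: continuous_intros)
  have Fa: "continuous_on UNIV (F a)" for a
    using continuous_on_compose2[OF F, of UNIV "\<lambda>b. (a, b)"] by (simp add: continuous_intros)
  have s2: "square_mean (\<lambda>b. F a (b + w)) = square_mean (F a)" for a w
    by (rule square_mean_shift[OF Fa]) (simp_all add: F_def p2')
  define E where "E a = square_mean (F a)" for a
  have E: "continuous_on UNIV E"
    using continuous_on_square_mean[OF F] by (simp add: E_def[abs_def])
  have F1: "F (a + m) b = F a b" if "m \<in> {(1, 0), (0, 1)}" for a b m
    using s3[of "a + m" b "cpair (cplx m * cplx b)"] p1[OF that] by (simp add: F_def)
  then have F1': "F (a + m) = F a" if "m \<in> {(1, 0), (0, 1)}" for a m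
    using that by (intro ext) blast
  have s1: "square_mean (\<lambda>a. E (a + w)) = square_mean E" for w
    by (rule square_mean_shift[OF E]) (simp_all add: E_def F1')
  have "mean (\<lambda>z. f (heis_mult z h)) = square_mean (\<lambda>a. square_mean (\<lambda>b. square_mean (\<lambda>c.
      G (a + cpair (h $ 1)) (b + cpair (h $ 2)) (c + cpair (h $ 3 + cplx a * h $ 2)))))"
    by (subst mean_iterated)
      (auto intro!: continuous_on_compose2[OF f] continuous_intros
        simp: G_def heis_mult_def box_pt_def vector_3 cplx_add add.assoc)
  also have "\<dots> = mean f"
    by (simp add: s3 F_def[symmetric] s2 E_def[symmetric] s1 mean_iterated[OF f] G_def[symmetric])
  finally show ?thesis .
qed

text \<open>The left-invariant vector field with value \<open>v\<close> at the identity, that is,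
  the velocity at s = 0 of the curve \<open>heis_mult z (s *\<^sub>R v)\<close>.\<close>

definition inv_vec :: "point \<Rightarrow> point \<Rightarrow> point" where
  "inv_vec z v = vector [v $ 1, v $ 2, v $ 3 + z $ 1 * v $ 2]"

definition inv_deriv :: "point \<Rightarrow> (point \<Rightarrow> complex) \<Rightarrow> point \<Rightarrow> complex" where
  "inv_deriv v f = (\<lambda>z. frechet_derivative f (at z) (inv_vec z v))"

lemma smooth_functionsD:
  assumes "f \<in> smooth_functions"
  shows "smooth_on UNIV f" "g \<in> heis_lattice \<Longrightarrow> f (heis_mult g z) = f z"
    "continuous_on UNIV f" "f differentiable (at z)" "linear (frechet_derivative f (at z))"
    "(f has_derivative frechet_derivative f (at z)) (at z)"
proof -
  show s: "smooth_on UNIV f" and "g \<in> heis_lattice \<Longrightarrow> f (heis_mult g z) = f z"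
    using assms by (auto simp: smooth_functions_def)
  show "continuous_on UNIV f" by (rule smooth_on_imp_continuous_on[OF s])
  show d: "f differentiable (at z)" by (rule smooth_on_UNIV_differentiable[OF s])
  show "linear (frechet_derivative f (at z))" by (rule linear_frechet_derivative[OF d])
  show "(f has_derivative frechet_derivative f (at z)) (at z)" using d by (simp add: frechet_derivative_works[symmetric])
qed

lemma smooth_functions_add: "f \<in> smooth_functions \<Longrightarrow> g \<in> smooth_functions \<Longrightarrow> (\<lambda>z. f z + g z) \<in> smooth_functions"
  by (simp add: smooth_functions_def smooth_on_add)

lemma smooth_functions_mult: "f \<in> smooth_functions \<Longrightarrow> g \<in> smooth_functions \<Longrightarrow> (\<lambda>z. f z * g z) \<in> smooth_functions"
  by (simp add: smooth_functions_def smooth_on_mult)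

lemma smooth_functions_const: "(\<lambda>z. c) \<in> smooth_functions"
  by (simp add: smooth_functions_def smooth_on_const)

lemma smooth_functions_sum: "(\<And>i. i \<in> I \<Longrightarrow> f i \<in> smooth_functions) \<Longrightarrow> (\<lambda>z. \<Sum>i\<in>I. f i z) \<in> smooth_functions"
  by (induction I rule: infinite_finite_induct) (simp_all add: smooth_functions_const smooth_functions_add)

text \<open>A Frechet derivative is linear over the reals only, so the complex entry of the field is
  split into multiples of the real and the imaginary direction of the third coordinate before
  linearity is applied.\<close>

lemma inv_vec_split:
  "inv_vec z v = v + Re (z $ 1 * v $ 2) *\<^sub>R vector [0, 0, 1] + Im (z $ 1 * v $ 2) *\<^sub>R vector [0, 0, \<i>]"
  by (simp add: inv_vec_def vec_eq_iff forall_3 vector_3 complex_eq_iff)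

lemma inv_deriv_smooth:
  assumes f: "f \<in> smooth_functions"
  shows "inv_deriv v f \<in> smooth_functions"
proof -
  let ?D = "\<lambda>z. frechet_derivative f (at z)"
  have e: "inv_deriv v f z = ?D z v + of_real (Re (z $ 1 * v $ 2)) * ?D z (vector [0, 0, 1])
      + of_real (Im (z $ 1 * v $ 2)) * ?D z (vector [0, 0, \<i>])" for z
    using smooth_functionsD(5)[OF f, of z]
    by (simp add: inv_deriv_def inv_vec_split linear_add linear_cmul) (simp add: scaleR_conv_of_real)
  have l: "bounded_linear (\<lambda>z::point. complex_of_real (Re (z $ 1 * c)))"
    "bounded_linear (\<lambda>z::point. complex_of_real (Im (z $ 1 * c)))" for c
    unfolding linear_conv_bounded_linear[symmetric]
    by (rule linearI; simp add: complex_eq_iff algebra_simps)+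
  have "smooth_on UNIV (inv_deriv v f)"
    unfolding e[abs_def]
    by (intro smooth_on_add smooth_on_mult smooth_on_bounded_linear l
        smooth_on_frechet_derivative[OF open_UNIV smooth_functionsD(1)[OF f]])
  moreover have "inv_deriv v f (heis_mult g z) = inv_deriv v f z" if g: "g \<in> heis_lattice" for g z
  proof -
    \<comment> \<open>Left translation by \<open>g\<close> is affine with linear part
      \<open>L\<close>, and \<open>L\<close> carries the field at \<open>z\<close> to the field at
      \<open>heis_mult g z\<close>. Invariance of \<open>f\<close> thus passes to its derivative
      along the field.\<close>
    define L where "L w = (vector [w $ 1, w $ 2, w $ 3 + g $ 1 * w $ 2] :: point)" for w :: point
    have L: "bounded_linear L"
      unfolding linear_conv_bounded_linear[symmetric] L_def
      by (rule linearI) (simp_all add: vec_eq_iff forall_3 vector_3 algebra_simps)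
    have gL: "heis_mult g w = L w + g" for w
      by (simp add: heis_mult_def L_def vec_eq_iff forall_3 vector_3 add.commute)
    have "(heis_mult g has_derivative L) (at z)"
      unfolding gL[abs_def] using bounded_linear_imp_has_derivative[OF L, of "at z"]
      by (auto intro!: derivative_eq_intros)
    from has_derivative_compose[OF this smooth_functionsD(6)[OF f]]
    have "(f has_derivative (\<lambda>w. ?D (heis_mult g z) (L w))) (at z)"
      using smooth_functionsD(2)[OF f g] by simp
    from frechet_derivative_at[OF this]
    have "?D (heis_mult g z) (L w) = ?D z w" for w by metis
    moreover have "inv_vec (heis_mult g z) v = L (inv_vec z v)"
      by (simp add: inv_vec_def heis_mult_def L_def vec_eq_iff forall_3 vector_3 algebra_simps)
    ultimately show ?thesis by (simp add: inv_deriv_def)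
  qed
  ultimately show ?thesis by (simp add: smooth_functions_def)
qed

lemma mean_inv_deriv:
  assumes f: "f \<in> smooth_functions"
  shows "mean (inv_deriv v f) = 0"
proof -
  let ?D = "\<lambda>z. frechet_derivative f (at z)"
  let ?box = "cbox ((0, 0), (0, 0), (0, 0)) ((1, 1), (1, 1), (1, 1)) :: box_point set"
  \<comment> \<open>Multiplication is affine in its second factor, so the curve is a straight line
    with velocity \<open>inv_vec z v\<close>. The mean of the right translates of \<open>f\<close>
    is constant in s, and its derivative at s = 0 is the mean of
    \<open>inv_deriv v f\<close>.\<close>
  have curve: "heis_mult z (s *\<^sub>R v) = z + s *\<^sub>R inv_vec z v" for z s
    by (simp add: heis_mult_def inv_vec_def vec_eq_iff forall_3 vector_3 algebra_simps)
  have cD: "continuous_on UNIV (\<lambda>z. ?D z b)" for b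
    by (rule smooth_on_imp_continuous_on[OF smooth_on_frechet_derivative[OF open_UNIV smooth_functionsD(1)[OF f]]])
  have "((\<lambda>s. integral ?box (\<lambda>p. f (heis_mult (box_pt p) (s *\<^sub>R v)))) has_vector_derivative
      integral ?box (\<lambda>p. ?D (heis_mult (box_pt p) (0 *\<^sub>R v)) (inv_vec (box_pt p) v))) (at 0 within UNIV)"
  proof (rule leibniz_rule_vector_derivative)
    fix s :: real and p
    have "((\<lambda>s. heis_mult (box_pt p) (s *\<^sub>R v)) has_derivative (\<lambda>s. s *\<^sub>R inv_vec (box_pt p) v)) (at s)"
      unfolding curve by (auto intro!: derivative_eq_intros)
    from has_derivative_compose[OF this smooth_functionsD(6)[OF f]]
    show "((\<lambda>s. f (heis_mult (box_pt p) (s *\<^sub>R v))) has_vector_derivative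
        ?D (heis_mult (box_pt p) (s *\<^sub>R v)) (inv_vec (box_pt p) v)) (at s within UNIV)"
      using linear_cmul[OF smooth_functionsD(5)[OF f]] by (simp add: has_vector_derivative_def)
  next
    fix s :: real
    show "(\<lambda>p. f (heis_mult (box_pt p) (s *\<^sub>R v))) integrable_on ?box"
      by (intro integrable_continuous continuous_on_compose2[OF smooth_functionsD(3)[OF f]] continuous_intros) auto
  next
    have e: "?D z (inv_vec w v) = ?D z v + of_real (Re (w $ 1 * v $ 2)) * ?D z (vector [0, 0, 1])
      + of_real (Im (w $ 1 * v $ 2)) * ?D z (vector [0, 0, \<i>])" for z w
      using smooth_functionsD(5)[OF f, of z]
      by (simp add: inv_vec_split linear_add linear_cmul) (simp add: scaleR_conv_of_real)
    show "continuous_on (UNIV \<times> ?box)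
        (\<lambda>(s, p). ?D (heis_mult (box_pt p) (s *\<^sub>R v)) (inv_vec (box_pt p) v))"
      unfolding e split_beta
      by (intro continuous_intros continuous_on_compose2[OF cD]) auto
  qed auto
  moreover have "integral ?box (\<lambda>p. f (heis_mult (box_pt p) (s *\<^sub>R v))) = mean f" for s
    using mean_right_translation[OF smooth_functionsD(3)[OF f] smooth_functionsD(2)[OF f], of "s *\<^sub>R v"]
    by (simp add: mean_def)
  ultimately have "((\<lambda>s::real. mean f) has_vector_derivative
      integral ?box (\<lambda>p. ?D (heis_mult (box_pt p) (0 *\<^sub>R v)) (inv_vec (box_pt p) v))) (at 0)"
    by simp
  then have "integral ?box (\<lambda>p. ?D (heis_mult (box_pt p) (0 *\<^sub>R v)) (inv_vec (box_pt p) v)) = 0"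
    using vector_derivative_unique_at has_vector_derivative_const by blast
  then show ?thesis unfolding curve by (simp add: mean_def inv_deriv_def)
qed


section \<open>The standard left-invariant frame\<close>

lemma sum_form_apply: "(\<Sum>i\<in>I. \<eta> i) z vs = (\<Sum>i\<in>I. (\<eta> i :: form) z vs)"
  by (induction I rule: infinite_finite_induct) simp_all

lemma fscale_apply: "fscale c \<eta> z vs = c * \<eta> z vs"
  by (simp add: fscale_def fmult_apply)

lemma fmult_add: "fmult f (\<eta> + \<zeta>) = fmult f \<eta> + fmult f \<zeta>"
  by (simp add: fun_eq_iff fmult_apply algebra_simps)

lemma fmult_add_left: "fmult (\<lambda>z. f z + g z) \<eta> = fmult f \<eta> + fmult g \<eta>"
  by (simp add: fun_eq_iff fmult_apply algebra_simps)

lemma fmult_fmult: "fmult f (fmult g \<eta>) = fmult (\<lambda>z. f z * g z) \<eta>"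
  by (simp add: fun_eq_iff fmult_apply algebra_simps)

lemma fmult_zero: "fmult f 0 = 0"
  by (simp add: fun_eq_iff fmult_apply)

lemma fmult_zero_left: "fmult (\<lambda>_. 0) \<eta> = 0"
  by (simp add: fun_eq_iff fmult_apply)

lemma fmult_one_left: "fmult (\<lambda>_. 1) \<eta> = \<eta>"
  by (simp add: fun_eq_iff fmult_apply)

lemma fmult_sum: "fmult f (\<Sum>i\<in>I. \<eta> i) = (\<Sum>i\<in>I. fmult f (\<eta> i))"
  by (simp add: fun_eq_iff fmult_apply sum_form_apply sum_distrib_left)

lemma fmult_sum_left: "fmult (\<lambda>z. \<Sum>i\<in>I. f i z) \<eta> = (\<Sum>i\<in>I. fmult (f i) \<eta>)"
  by (simp add: fun_eq_iff fmult_apply sum_form_apply sum_distrib_right)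

text \<open>The algebra of contraction with a complex vector field. A form takes real tangent
  vectors, so contraction with a field of type (1,0) or (0,1) is a combination of insertions with
  function coefficients; this class of operators is closed under such combinations. The function
  \<open>h \<phi> z []\<close> is the value of the one-form \<open>\<phi>\<close> on the
  field.\<close>

definition contraction :: "(form \<Rightarrow> form) \<Rightarrow> bool" where
  "contraction h \<longleftrightarrow> (\<forall>\<eta> \<zeta>. h (\<eta> + \<zeta>) = h \<eta> + h \<zeta>) \<and> (\<forall>f \<eta>. h (fmult f \<eta>) = fmult f (h \<eta>)) \<and>
     (\<forall>\<phi> \<eta>. one_form \<phi> \<longrightarrow> h (\<phi> \<and>\<^sub>f \<eta>) = fmult (\<lambda>z. h \<phi> z []) \<eta> - \<phi> \<and>\<^sub>f h \<eta>)"

lemma contractionD: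
  assumes "contraction h"
  shows "h (\<eta> + \<zeta>) = h \<eta> + h \<zeta>" "h (fmult f \<eta>) = fmult f (h \<eta>)"
    "one_form \<phi> \<Longrightarrow> h (\<phi> \<and>\<^sub>f \<eta>) = fmult (\<lambda>z. h \<phi> z []) \<eta> - \<phi> \<and>\<^sub>f h \<eta>"
  using assms by (auto simp: contraction_def)

lemma contraction_insert_vec: "contraction (insert_vec v)"
  unfolding contraction_def
  by (auto simp: insert_vec_wedge) (auto simp: insert_vec_def fun_eq_iff fmult_apply)

lemma contraction_fmult:
  assumes "contraction h"
  shows "contraction (\<lambda>\<eta>. fmult g (h \<eta>))"
  unfolding contraction_def
  by (auto simp: contractionD[OF assms] fmult_add wedge_fmult_right)
    (simp_all add: fun_eq_iff fmult_apply algebra_simps)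

lemma contraction_add:
  assumes "contraction h" "contraction g"
  shows "contraction (\<lambda>\<eta>. h \<eta> + g \<eta>)"
  unfolding contraction_def
  by (auto simp: contractionD[OF assms(1)] contractionD[OF assms(2)] fmult_add wedge_add_right fmult_add_left)

lemma contraction_zero: "contraction (\<lambda>\<eta>. 0)"
  by (simp add: contraction_def fmult_zero fmult_zero_left wedge_zero_right)

lemma contraction_sum: "(\<And>i. i \<in> I \<Longrightarrow> contraction (h i)) \<Longrightarrow> contraction (\<lambda>\<eta>. \<Sum>i\<in>I. h i \<eta>)"
  by (induction I rule: infinite_finite_induct) (simp_all add: contraction_zero contraction_add)

text \<open>The indices \<open>0, 1, 2\<close> refer to the \<open>(1,0)\<close>-part of a frame or coframe and \<open>3, 4, 5\<close> to its conjugate.\<close>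

definition base_form :: "nat \<Rightarrow> form" where
  "base_form k = [alpha, beta, gamma, cnj_form alpha, cnj_form beta, cnj_form gamma] ! k"

definition base_vec :: "nat \<Rightarrow> point" where
  "base_vec k = [vector [1, 0, 0], vector [0, 1, 0], vector [0, 0, 1]] ! (k mod 3)"

definition conj_sign :: "nat \<Rightarrow> complex" where
  "conj_sign k = (if k < 3 then -1 else 1)"

text \<open>The Wirtinger combination of the derivatives along v and i v, with the minus sign for
  the (1,0)-field and the plus sign for its conjugate.\<close>

definition frame_deriv :: "nat \<Rightarrow> (point \<Rightarrow> complex) \<Rightarrow> point \<Rightarrow> complex" where
  "frame_deriv k f = (\<lambda>z. 1 / 2 * (inv_deriv (base_vec k) f z
     + conj_sign k * \<i> * inv_deriv (\<i> *s base_vec k) f z))"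

definition const_hook :: "point \<Rightarrow> nat \<Rightarrow> form \<Rightarrow> form" where
  "const_hook v k \<eta> = fmult (\<lambda>_. 1 / 2) (insert_vec v \<eta> + fmult (\<lambda>_. conj_sign k * \<i>) (insert_vec (\<i> *s v) \<eta>))"

text \<open>Since gamma = dz3 - z1 dz2, the field dual to beta is the second coordinate field plus
  z1 times the third. This explains the extra term for k = 1 and its conjugate for k = 4.\<close>

definition base_hook :: "nat \<Rightarrow> form \<Rightarrow> form" where
  "base_hook k \<eta> = const_hook (base_vec k) k \<eta> +
     fmult (\<lambda>z. if k = 1 then z $ 1 else if k = 4 then cnj (z $ 1) else 0) (const_hook (base_vec 2) k \<eta>)"

lemma less_6_cases: "(k::nat) < 6 \<Longrightarrow> k = 0 \<or> k = 1 \<or> k = 2 \<or> k = 3 \<or> k = 4 \<or> k = 5"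
  by presburger

lemma sum_lessThan_6: "(\<Sum>k<(6::nat). f k) = f 0 + f 1 + f 2 + f 3 + f 4 + f 5"
  for f :: "nat \<Rightarrow> 'a::ab_group_add"
  by (simp add: eval_nat_numeral add.assoc)

lemma frame_deriv_smooth: "f \<in> smooth_functions \<Longrightarrow> frame_deriv k f \<in> smooth_functions"
  unfolding frame_deriv_def
  by (intro smooth_functions_add smooth_functions_mult smooth_functions_const inv_deriv_smooth)

lemma mean_frame_deriv:
  assumes f: "f \<in> smooth_functions"
  shows "mean (frame_deriv k f) = 0"
proof -
  let ?g = "inv_deriv (base_vec k) f" and ?h = "inv_deriv (\<i> *s base_vec k) f"
  have "(\<lambda>z. conj_sign k * \<i> * ?h z) \<in> smooth_functions"
    by (intro smooth_functions_mult smooth_functions_const inv_deriv_smooth f)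
  then have "mean (\<lambda>z. ?g z + conj_sign k * \<i> * ?h z) = mean ?g + conj_sign k * \<i> * mean ?h"
    by (subst mean_add) (simp_all add: mean_cmult smooth_functionsD(3) inv_deriv_smooth f)
  then show ?thesis unfolding frame_deriv_def mean_cmult by (simp add: mean_inv_deriv f)
qed

lemma contraction_const_hook: "contraction (const_hook v k)"
  unfolding const_hook_def[abs_def]
  by (intro contraction_fmult contraction_add contraction_insert_vec)

lemma contraction_base_hook: "contraction (base_hook k)"
  unfolding base_hook_def[abs_def]
  by (intro contraction_fmult contraction_add contraction_const_hook)

lemma base_form_eval:
  "base_form 0 z vs = (if length vs = 1 then hd vs $ 1 else 0)"
  "base_form (Suc 0) z vs = (if length vs = 1 then hd vs $ 2 else 0)"
  "base_form 2 z vs = (if length vs = 1 then hd vs $ 3 - z $ 1 * hd vs $ 2 else 0)"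
  "base_form 3 z vs = (if length vs = 1 then cnj (hd vs $ 1) else 0)"
  "base_form 4 z vs = (if length vs = 1 then cnj (hd vs $ 2) else 0)"
  "base_form 5 z vs = (if length vs = 1 then cnj (hd vs $ 3 - z $ 1 * hd vs $ 2) else 0)"
  by (simp_all add: base_form_def alpha_def beta_def gamma_def dz_def fmult_def cnj_form_def)

lemma one_form_base_form: "k < 6 \<Longrightarrow> one_form (base_form k)"
  by (drule less_6_cases) (auto simp: one_form_def base_form_eval)

lemma differentiable_coord: "(\<lambda>z::point. z $ i) differentiable (at z)"
  by (rule bounded_linear_imp_differentiable[OF bounded_linear_vec_nth])

lemma differentiable_cnj_coord: "(\<lambda>z::point. cnj (z $ i)) differentiable (at z)"
  by (rule bounded_linear_imp_differentiable[OF bounded_linear_compose[OF bounded_linear_cnj bounded_linear_vec_nth]])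

lemma diff_form_base_form: "k < 6 \<Longrightarrow> diff_form (base_form k)"
  unfolding diff_form_def
proof (intro allI)
  fix z vs assume "k < 6"
  then show "(\<lambda>w. base_form k w vs) differentiable (at z)"
    using less_6_cases[OF \<open>k < 6\<close>]
    by (cases "length vs = Suc 0"; elim disjE)
      (simp_all add: base_form_eval differentiable_diff differentiable_mult differentiable_coord differentiable_cnj_coord)
qed

lemma base_vec_eval: "base_vec 0 = vector [1, 0, 0]" "base_vec (Suc 0) = vector [0, 1, 0]" "base_vec 2 = vector [0, 0, 1]"
  "base_vec 3 = vector [1, 0, 0]" "base_vec 4 = vector [0, 1, 0]" "base_vec 5 = vector [0, 0, 1]"
  by (simp_all add: base_vec_def)

lemma base_hook_base_form:
  assumes "k < 6" "j < 6"
  shows "base_hook k (base_form j) z [] = (if k = j then 1 else 0)"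
proof -
  have i: "\<i> * (c * \<i>) = - c" for c by (simp add: complex_eq_iff)
  show ?thesis
    using less_6_cases[OF assms(1)] less_6_cases[OF assms(2)]
    by (elim disjE)
      (simp_all add: base_hook_def const_hook_def fmult_apply insert_vec_def base_form_eval base_vec_eval
        conj_sign_def vector_3 i)
qed

lemma total_diff_base:
  assumes f: "f \<in> smooth_functions"
  shows "total_diff f = (\<Sum>k<6. fmult (frame_deriv k f) (base_form k))"
proof (intro ext)
  fix z vs
  let ?D = "frechet_derivative f (at z)"
  show "total_diff f z vs = (\<Sum>k<6. fmult (frame_deriv k f) (base_form k)) z vs"
  proof (cases "length vs = 1")
    case True
    then obtain v where vs: "vs = [v]" by (cases vs) auto
    \<comment> \<open>This is the value of gamma on \<open>v\<close>, so v has components v1, v2 and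
      u3 in the left-invariant frame.\<close>
    define u3 where "u3 = v $ 3 - z $ 1 * v $ 2"
    have v: "v = Re (v $ 1) *\<^sub>R inv_vec z (base_vec 0) + Im (v $ 1) *\<^sub>R inv_vec z (\<i> *s base_vec 0)
      + (Re (v $ 2) *\<^sub>R inv_vec z (base_vec 1) + Im (v $ 2) *\<^sub>R inv_vec z (\<i> *s base_vec 1))
      + (Re u3 *\<^sub>R inv_vec z (base_vec 2) + Im u3 *\<^sub>R inv_vec z (\<i> *s base_vec 2))"
      by (simp add: u3_def vec_eq_iff forall_3 inv_vec_def base_vec_eval vector_3 complex_eq_iff algebra_simps)
    define A B where "A k = ?D (inv_vec z (base_vec k))" and "B k = ?D (inv_vec z (\<i> *s base_vec k))" for k
    \<comment> \<open>Expressing real and imaginary parts by a coordinate and its conjugate turns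
      the derivatives along v and i v into the Wirtinger pair.\<close>
    have c: "of_real (Re w) * a + of_real (Im w) * b = (a - \<i> * b) / 2 * w + (a + \<i> * b) / 2 * cnj w"
      for w a b :: complex
      by (simp add: complex_eq_iff field_simps)
    have "?D v = of_real (Re (v $ 1)) * A 0 + of_real (Im (v $ 1)) * B 0
      + (of_real (Re (v $ 2)) * A 1 + of_real (Im (v $ 2)) * B 1)
      + (of_real (Re u3) * A 2 + of_real (Im u3) * B 2)"
      unfolding A_def B_def
      by (subst v, simp only: linear_add[OF smooth_functionsD(5)[OF f]] linear_cmul[OF smooth_functionsD(5)[OF f]])
        (simp only: scaleR_conv_of_real)
    then have Dv: "?D v = (A 0 - \<i> * B 0) / 2 * v $ 1 + (A 0 + \<i> * B 0) / 2 * cnj (v $ 1)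
      + ((A 1 - \<i> * B 1) / 2 * v $ 2 + (A 1 + \<i> * B 1) / 2 * cnj (v $ 2))
      + ((A 2 - \<i> * B 2) / 2 * u3 + (A 2 + \<i> * B 2) / 2 * cnj u3)"
      by (simp only: c)
    have bv: "base_vec 3 = base_vec 0" "base_vec 4 = base_vec (Suc 0)" "base_vec 5 = base_vec 2"
      by (simp_all add: base_vec_eval)
    have fd: "frame_deriv 0 f z = (A 0 - \<i> * B 0) / 2" "frame_deriv (Suc 0) f z = (A 1 - \<i> * B 1) / 2"
      "frame_deriv 2 f z = (A 2 - \<i> * B 2) / 2" "frame_deriv 3 f z = (A 0 + \<i> * B 0) / 2"
      "frame_deriv 4 f z = (A 1 + \<i> * B 1) / 2" "frame_deriv 5 f z = (A 2 + \<i> * B 2) / 2"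
      by (simp_all add: frame_deriv_def inv_deriv_def conj_sign_def bv A_def B_def)
    have "(\<Sum>k<6. fmult (frame_deriv k f) (base_form k)) z vs
        = (\<Sum>k<6. frame_deriv k f z * base_form k z [v])"
      by (simp only: sum_form_apply fmult_apply vs)
    also have "\<dots> = ?D v"
      unfolding Dv by (simp add: sum_lessThan_6 fd base_form_eval u3_def add_ac)
    finally show ?thesis by (simp add: vs total_diff_def)
  next
    case False
    then have "base_form k z vs = 0" if "k < 6" for k
      using one_form_base_form[OF that] by (simp add: one_formD)
    with False show ?thesis by (simp add: total_diff_def sum_form_apply fmult_apply)
  qed
qed

lemma total_diff_coord: "total_diff (\<lambda>z. z $ i) = dz i" "total_diff (\<lambda>z. cnj (z $ i)) = cnj_form (dz i)"
proof -
  have "frechet_derivative (\<lambda>z::point. z $ i) (at z) = (\<lambda>z. z $ i)" for z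
    using frechet_derivative_at[OF bounded_linear_imp_has_derivative[OF bounded_linear_vec_nth]] by metis
  moreover have "frechet_derivative (\<lambda>z::point. cnj (z $ i)) (at z) = (\<lambda>z. cnj (z $ i))" for z
    using frechet_derivative_at[OF bounded_linear_imp_has_derivative
        [OF bounded_linear_compose[OF bounded_linear_cnj bounded_linear_vec_nth]]] by metis
  ultimately show "total_diff (\<lambda>z. z $ i) = dz i" "total_diff (\<lambda>z. cnj (z $ i)) = cnj_form (dz i)"
    by (simp_all add: total_diff_def dz_def cnj_form_def fun_eq_iff)
qed

text \<open>Minus the exterior derivative of \<open>base_form k\<close>, wedged with
  \<open>\<eta>\<close>: d gamma = - alpha beta, its conjugate, and zero for the closed
  forms.\<close>

definition base_curv :: "nat \<Rightarrow> form \<Rightarrow> form" where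
  "base_curv k \<eta> = (if k = 2 then base_form 0 \<and>\<^sub>f base_form 1 \<and>\<^sub>f \<eta>
     else if k = 5 then base_form 3 \<and>\<^sub>f base_form 4 \<and>\<^sub>f \<eta> else 0)"

text \<open>Made for gamma and its conjugate, whose coefficient at dz2 or its conjugate varies: d
  also falls on \<open>f\<close>, which produces the structure equation.\<close>

lemma ext_deriv_wedge_affine:
  assumes "one_form \<phi>" "\<And>z w vs. \<phi> z vs = \<phi> w vs" "one_form \<psi>" "\<And>z w vs. \<psi> z vs = \<psi> w vs"
    and f: "\<And>z. f differentiable (at z)" and \<eta>: "diff_form \<eta>"
  shows "ext_deriv ((\<phi> - fmult f \<psi>) \<and>\<^sub>f \<eta>)
    = - ((\<phi> - fmult f \<psi>) \<and>\<^sub>f ext_deriv \<eta>) - total_diff f \<and>\<^sub>f \<psi> \<and>\<^sub>f \<eta>"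
proof -
  have diff_const: "diff_form \<zeta>" if "\<And>z w vs. \<zeta> z vs = \<zeta> w vs" for \<zeta>
  proof -
    have c: "\<zeta> = (\<lambda>z. \<zeta> 0)" by (intro ext that)
    show ?thesis by (subst c) (simp add: diff_form_def)
  qed
  have "(\<phi> - fmult f \<psi>) \<and>\<^sub>f \<zeta> = \<phi> \<and>\<^sub>f \<zeta> + fmult (\<lambda>_. -1) (fmult f (\<psi> \<and>\<^sub>f \<zeta>))" for \<zeta>
    by (simp add: fun_eq_iff wedge_def fmult_apply sum_distrib_left algebra_simps sum_subtractf sum_negf)
  moreover have "diff_form (\<phi> \<and>\<^sub>f \<eta>)" "diff_form (\<psi> \<and>\<^sub>f \<eta>)"
    by (rule diff_form_wedge[OF assms(1) diff_const[OF assms(2)] \<eta>],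
        rule diff_form_wedge[OF assms(3) diff_const[OF assms(4)] \<eta>])
  ultimately show ?thesis
    using f by (simp add: ext_deriv_add ext_deriv_fmult diff_form_fmult ext_deriv_wedge_const[OF assms(1,2) \<eta>]
        ext_deriv_wedge_const[OF assms(3,4) \<eta>] total_diff_const wedge_zero_left)
      (simp add: fun_eq_iff fmult_apply)
qed

lemma ext_deriv_base_wedge:
  assumes "k < 6" and \<eta>: "diff_form \<eta>"
  shows "ext_deriv (base_form k \<and>\<^sub>f \<eta>) = - (base_form k \<and>\<^sub>f ext_deriv \<eta>) - base_curv k \<eta>"
proof -
  have one: "one_form (dz i)" "one_form (cnj_form (dz i))" for i
    by (auto simp: one_form_def dz_def cnj_form_def)
  have const: "dz i z vs = dz i w vs" "cnj_form (dz i) z vs = cnj_form (dz i) w vs" for i z w vs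
    by (auto simp: dz_def cnj_form_def)
  have cg: "cnj_form gamma = cnj_form (dz 3) - fmult (\<lambda>z. cnj (z $ 1)) (cnj_form (dz 2))"
    by (simp add: gamma_def cnj_form_def fmult_def fun_eq_iff)
  have "base_form 0 = dz 1" "base_form (Suc 0) = dz 2" "base_form 2 = dz 3 - fmult (\<lambda>z. z $ 1) (dz 2)"
    "base_form 3 = cnj_form (dz 1)" "base_form 4 = cnj_form (dz 2)"
    "base_form 5 = cnj_form (dz 3) - fmult (\<lambda>z. cnj (z $ 1)) (cnj_form (dz 2))"
    by (simp_all add: base_form_def cg[symmetric], simp_all add: alpha_def beta_def gamma_def)
  note e = this
  from less_6_cases[OF assms(1)] show ?thesis
    by (elim disjE)
      (simp_all add: e base_curv_def ext_deriv_wedge_const[OF one(1) const(1) \<eta>]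
        ext_deriv_wedge_const[OF one(2) const(2) \<eta>]
        ext_deriv_wedge_affine[OF one(1) const(1) one(1) const(1) differentiable_coord \<eta>]
        ext_deriv_wedge_affine[OF one(2) const(2) one(2) const(2) differentiable_cnj_coord \<eta>]
        total_diff_coord)
qed


section \<open>Left-invariant coframes\<close>

text \<open>As rewrite rules these eta-expand sums and differences of forms, which then escape all
  equations between forms.\<close>

declare plus_fun_apply [simp del] zero_fun_apply [simp del] minus_apply [simp del] uminus_apply [simp del]

lemmas form_apply = minus_apply uminus_apply plus_fun_apply zero_fun_apply sum_form_apply fmult_apply

text \<open>A left-invariant coframe \<open>\<Theta>\<close> with components \<open>M\<close> in the standard coframe, closed under conjugation.
  The last two assumptions say that \<open>\<alpha>, \<beta>\<close> and their conjugates span the same forms as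
  \<open>\<Theta>\<^sub>0, \<Theta>\<^sub>1, \<Theta>\<^sub>3, \<Theta>\<^sub>4\<close>.\<close>

locale heis_coframe =
  fixes M N :: "nat \<Rightarrow> nat \<Rightarrow> complex"
  assumes MN: "\<And>i j. i < 6 \<Longrightarrow> j < 6 \<Longrightarrow> (\<Sum>k<6. M i k * N k j) = (if i = j then 1 else 0)"
    and NM: "\<And>i j. i < 6 \<Longrightarrow> j < 6 \<Longrightarrow> (\<Sum>k<6. N i k * M k j) = (if i = j then 1 else 0)"
    and M_conj: "\<And>i k. i < 3 \<Longrightarrow> k < 3 \<Longrightarrow> M (i + 3) k = cnj (M i (k + 3)) \<and> M (i + 3) (k + 3) = cnj (M i k)"
    and N_conj: "\<And>i k. i < 3 \<Longrightarrow> k < 3 \<Longrightarrow> N (i + 3) k = cnj (N i (k + 3)) \<and> N (i + 3) (k + 3) = cnj (N i k)"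
    and M_block: "\<And>i k. i \<in> {0, 1, 3, 4} \<Longrightarrow> k \<in> {2, 5} \<Longrightarrow> M i k = 0"
    and N_block: "\<And>i k. i \<in> {0, 1, 3, 4} \<Longrightarrow> k \<in> {2, 5} \<Longrightarrow> N i k = 0"
begin

definition \<Theta> :: "nat \<Rightarrow> form" where
  "\<Theta> i = (\<Sum>k<6. fmult (\<lambda>_. M i k) (base_form k))"

text \<open>Contraction with the j-th field of the frame dual to \<open>\<Theta>\<close>. As
  \<open>N\<close> inverts \<open>M\<close>, the components of that field in the standard frame form
  column j of \<open>N\<close>.\<close>

definition hook :: "nat \<Rightarrow> form \<Rightarrow> form" where
  "hook j \<eta> = (\<Sum>k<6. fmult (\<lambda>_. N k j) (base_hook k \<eta>))"

definition D :: "nat \<Rightarrow> (point \<Rightarrow> complex) \<Rightarrow> point \<Rightarrow> complex" where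
  "D j f = (\<lambda>z. \<Sum>k<6. N k j * frame_deriv k f z)"

text \<open>By \<open>d\<gamma> = - \<alpha> \<and> \<beta>\<close>, the form \<open>d\<Theta>\<^sub>i\<close> is the sum over all \<open>a, b\<close> (not only \<open>a < b\<close>) of
  \<open>struc i a b \<Theta>\<^sub>a \<and> \<Theta>\<^sub>b\<close>.\<close>

definition struc :: "nat \<Rightarrow> nat \<Rightarrow> nat \<Rightarrow> complex" where
  "struc i a b = - (M i 2 * (N 0 a * N 1 b) + M i 5 * (N 3 a * N 4 b))"

definition w :: "nat list \<Rightarrow> form" where
  "w js = wedge_list (map \<Theta> js)"

lemma w_simps [simp]: "w [] = form_one" "w (j # js) = \<Theta> j \<and>\<^sub>f w js"
  by (simp_all add: w_def wedge_list_def)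

lemma one_form_\<Theta>: "one_form (\<Theta> i)"
  unfolding one_form_def \<Theta>_def
  by (auto simp: sum_form_apply fmult_apply one_formD[OF one_form_base_form])

lemma diff_form_\<Theta>: "diff_form (\<Theta> i)"
  unfolding \<Theta>_def by (auto intro!: diff_form_sum diff_form_fmult diff_form_base_form)

lemma contraction_hook: "contraction (hook j)"
  unfolding hook_def[abs_def] by (intro contraction_sum contraction_fmult contraction_base_hook)

lemmas hook_add = contractionD(1)[OF contraction_hook]
lemmas hook_fmult = contractionD(2)[OF contraction_hook]

lemma contraction_zero_arg: "contraction h \<Longrightarrow> h 0 = 0"
  using contractionD(2)[of h "\<lambda>_. 0" 0] by (simp add: fmult_zero_left)

lemma contraction_sum_arg: "contraction h \<Longrightarrow> h (\<Sum>i\<in>I. \<eta> i) = (\<Sum>i\<in>I. h (\<eta> i))"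
  by (induction I rule: infinite_finite_induct) (simp_all add: contraction_zero_arg contractionD)

lemma hook_\<Theta>:
  assumes "i < 6" "j < 6"
  shows "hook j (\<Theta> i) z [] = (if i = j then 1 else 0)"
proof -
  have "hook j (\<Theta> i) z [] = (\<Sum>k<6. N k j * (\<Sum>l<6. M i l * base_hook k (base_form l) z []))"
    by (simp add: hook_def \<Theta>_def contraction_sum_arg[OF contraction_base_hook]
        contractionD(2)[OF contraction_base_hook] sum_form_apply fmult_apply)
  also have "\<dots> = (\<Sum>k<6. N k j * (\<Sum>l<6. M i l * (if k = l then 1 else 0)))"
    by (intro sum.cong refl arg_cong2[of _ _ _ _ "(*)"]) (auto simp: base_hook_base_form)
  also have "\<dots> = (\<Sum>k<6. M i k * N k j)"
    by (intro sum.cong refl) (simp add: if_distrib sum.delta cong: if_cong)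
  finally show ?thesis using MN assms by simp
qed

lemma hook_wedge: 
  assumes "i < 6" "j < 6"
  shows "hook j (\<Theta> i \<and>\<^sub>f \<eta>) = (if i = j then \<eta> else 0) - \<Theta> i \<and>\<^sub>f hook j \<eta>"
  using assms
  by (simp add: contractionD(3)[OF contraction_hook one_form_\<Theta>] hook_\<Theta> fmult_zero_left fmult_one_left)

lemma base_form_expand:
  assumes "k < 6"
  shows "base_form k = (\<Sum>j<6. fmult (\<lambda>_. N k j) (\<Theta> j))"
proof (intro ext)
  fix z vs
  have "(\<Sum>j<6. fmult (\<lambda>_. N k j) (\<Theta> j)) z vs = (\<Sum>j<6. \<Sum>l<6. N k j * M j l * base_form l z vs)"
    by (simp add: \<Theta>_def sum_form_apply fmult_apply sum_distrib_left mult.assoc)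
  also have "\<dots> = (\<Sum>l<6. (\<Sum>j<6. N k j * M j l) * base_form l z vs)"
    by (subst sum.swap) (simp add: sum_distrib_right)
  also have "\<dots> = (\<Sum>l<6. (if k = l then 1 else 0) * base_form l z vs)"
    using assms by (intro sum.cong refl) (simp add: NM)
  also have "\<dots> = base_form k z vs"
    using assms by (simp add: if_distrib[of "\<lambda>x. x * _"] sum.delta cong: if_cong)
  finally show "base_form k z vs = (\<Sum>j<6. fmult (\<lambda>_. N k j) (\<Theta> j)) z vs" ..
qed

lemma D_smooth: "f \<in> smooth_functions \<Longrightarrow> D j f \<in> smooth_functions"
  unfolding D_def
  by (intro smooth_functions_sum smooth_functions_mult smooth_functions_const frame_deriv_smooth)

lemma total_diff_\<Theta>:
  assumes "f \<in> smooth_functions"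
  shows "total_diff f = (\<Sum>j<6. fmult (D j f) (\<Theta> j))"
proof -
  have "total_diff f = (\<Sum>k<6. fmult (frame_deriv k f) (\<Sum>j<6. fmult (\<lambda>_. N k j) (\<Theta> j)))"
    unfolding total_diff_base[OF assms] by (intro sum.cong refl) (simp add: base_form_expand[symmetric])
  also have "\<dots> = (\<Sum>j<6. \<Sum>k<6. fmult (\<lambda>z. N k j * frame_deriv k f z) (\<Theta> j))"
    by (subst sum.swap) (simp only: fmult_sum fmult_fmult mult.commute)
  finally show ?thesis by (simp only: D_def fmult_sum_left)
qed

lemma ext_deriv_\<Theta>_wedge:
  assumes "diff_form \<eta>"
  shows "ext_deriv (\<Theta> i \<and>\<^sub>f \<eta>)
    = - (\<Theta> i \<and>\<^sub>f ext_deriv \<eta>) + (\<Sum>a<6. \<Sum>b<6. fmult (\<lambda>_. struc i a b) (\<Theta> a \<and>\<^sub>f \<Theta> b \<and>\<^sub>f \<eta>))"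
proof -
  have e2: "base_form k \<and>\<^sub>f base_form l \<and>\<^sub>f \<eta>
      = (\<Sum>a<6. \<Sum>b<6. fmult (\<lambda>_. N k a * N l b) (\<Theta> a \<and>\<^sub>f \<Theta> b \<and>\<^sub>f \<eta>))" if "k < 6" "l < 6" for k l
    unfolding base_form_expand[OF that(1)] base_form_expand[OF that(2)]
    by (simp only: wedge_sum_left wedge_sum_right wedge_fmult_left wedge_fmult_right fmult_sum fmult_fmult,
        subst sum.swap, simp only: mult.commute)
  have e01: "base_form 0 \<and>\<^sub>f base_form 1 \<and>\<^sub>f \<eta>
      = (\<Sum>a<6. \<Sum>b<6. fmult (\<lambda>_. N 0 a * N 1 b) (\<Theta> a \<and>\<^sub>f \<Theta> b \<and>\<^sub>f \<eta>))"
    and e34: "base_form 3 \<and>\<^sub>f base_form 4 \<and>\<^sub>f \<eta>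
      = (\<Sum>a<6. \<Sum>b<6. fmult (\<lambda>_. N 3 a * N 4 b) (\<Theta> a \<and>\<^sub>f \<Theta> b \<and>\<^sub>f \<eta>))"
    by (rule e2; simp)+
  have "ext_deriv (\<Theta> i \<and>\<^sub>f \<eta>) = (\<Sum>k<6. ext_deriv (fmult (\<lambda>_. M i k) (base_form k \<and>\<^sub>f \<eta>)))"
    unfolding \<Theta>_def wedge_sum_left wedge_fmult_left
    by (rule ext_deriv_sum)
      (auto intro!: diff_form_fmult diff_form_wedge one_form_base_form diff_form_base_form assms)
  also have "\<dots> = (\<Sum>k<6. fmult (\<lambda>_. M i k) (- (base_form k \<and>\<^sub>f ext_deriv \<eta>) - base_curv k \<eta>))"
    by (intro sum.cong refl)
      (simp add: ext_deriv_fmult diff_form_wedge one_form_base_form diff_form_base_form assms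
        total_diff_const wedge_zero_left ext_deriv_base_wedge)
  also have "\<dots> = - (\<Theta> i \<and>\<^sub>f ext_deriv \<eta>) - (\<Sum>k<6. fmult (\<lambda>_. M i k) (base_curv k \<eta>))"
    unfolding \<Theta>_def wedge_sum_left wedge_fmult_left
    by (simp add: fun_eq_iff form_apply algebra_simps sum_negf sum.distrib sum_subtractf)
  also have "(\<Sum>k<6. fmult (\<lambda>_. M i k) (base_curv k \<eta>))
      = fmult (\<lambda>_. M i 2) (base_form 0 \<and>\<^sub>f base_form 1 \<and>\<^sub>f \<eta>) + fmult (\<lambda>_. M i 5) (base_form 3 \<and>\<^sub>f base_form 4 \<and>\<^sub>f \<eta>)"
    by (simp add: sum_lessThan_6 base_curv_def fmult_zero)
  also have "- (\<Theta> i \<and>\<^sub>f ext_deriv \<eta>) - \<dots> = - (\<Theta> i \<and>\<^sub>f ext_deriv \<eta>)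
      + (\<Sum>a<6. \<Sum>b<6. fmult (\<lambda>_. struc i a b) (\<Theta> a \<and>\<^sub>f \<Theta> b \<and>\<^sub>f \<eta>))"
    by (simp only: e01 e34)
      (simp add: fun_eq_iff form_apply struc_def sum_distrib_left sum_subtractf algebra_simps
        sum.distrib sum_negf)
  finally show ?thesis .
qed

text \<open>The right-hand sides of the structure equations involve only alpha, beta and their
  conjugates, which by \<open>N_block\<close> have no component along \<open>\<Theta> 2\<close> and
  \<open>\<Theta> 5\<close>. By \<open>M_block\<close> the remaining four forms are combinations of
  closed forms.\<close>

lemma struc_block:
  "a \<in> {2, 5} \<Longrightarrow> struc i a b = 0" "b \<in> {2, 5} \<Longrightarrow> struc i a b = 0" "i \<in> {0, 1, 3, 4} \<Longrightarrow> struc i a b = 0"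
  by (auto simp: struc_def N_block M_block)

lemma w_swap: "w (i # j # js) = - w (j # i # js)"
  unfolding w_simps by (rule wedge_anticomm[OF one_form_\<Theta> one_form_\<Theta>])

lemma w_insort: "\<exists>s. w (i # js) = fmult (\<lambda>_. s) (w (insort i js))"
proof (induction js)
  case Nil
  show ?case by (rule exI[of _ 1]) (simp add: fmult_one_left)
next
  case (Cons j js)
  show ?case
  proof (cases "i \<le> j")
    case True
    then show ?thesis by (intro exI[of _ 1]) (simp add: fmult_one_left)
  next
    case False
    obtain s where s: "w (i # js) = fmult (\<lambda>_. s) (w (insort i js))" using Cons.IH by blast
    have "w (i # j # js) = fmult (\<lambda>_. - s) (w (j # insort i js))"
      using w_swap[of i j js] s
      by (simp add: wedge_fmult_right) (simp add: fun_eq_iff form_apply)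
    then show ?thesis using False by auto
  qed
qed

lemma w_sort: "\<exists>s. w js = fmult (\<lambda>_. s) (w (sort js))"
proof (induction js)
  case Nil
  show ?case by (rule exI[of _ 1]) (simp add: fmult_one_left)
next
  case (Cons j js)
  obtain s where s: "w js = fmult (\<lambda>_. s) (w (sort js))" using Cons.IH by blast
  obtain t where t: "w (j # sort js) = fmult (\<lambda>_. t) (w (insort j (sort js)))" using w_insort by blast
  have "w (j # js) = fmult (\<lambda>_. s * t) (w (sort (j # js)))"
    using s t by (simp add: wedge_fmult_right fmult_fmult)
  then show ?case by blast
qed

lemma w_sorted_not_distinct: "sorted js \<Longrightarrow> \<not> distinct js \<Longrightarrow> w js = 0"
proof (induction js)
  case (Cons j js)
  show ?case
  proof (cases "j \<in> set js")
    case True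
    then obtain k ks where js: "js = k # ks" by (cases js) auto
    then have "k = j" using True Cons.prems(1) by fastforce
    then show ?thesis using js wedge_self[OF one_form_\<Theta>] by simp
  next
    case False
    then show ?thesis using Cons by (simp add: wedge_zero_right)
  qed
qed simp

lemma w_not_distinct: "\<not> distinct js \<Longrightarrow> w js = 0"
  using w_sort[of js] w_sorted_not_distinct[of "sort js"] by (auto simp: fmult_zero)

text \<open>Forms of degree n with smooth coefficients, of all types together. Index lists may be
  unsorted and may repeat, so products and exterior derivatives of monomials stay in the set without
  normalisation; sorting takes place only in \<open>T_decompose\<close>.\<close>

inductive_set T :: "nat \<Rightarrow> form set" for n where
  T_zero: "0 \<in> T n"
| T_step: "f \<in> smooth_functions \<Longrightarrow> set js \<subseteq> {..<6} \<Longrightarrow> length js = n \<Longrightarrow> \<omega> \<in> T n \<Longrightarrow> fmult f (w js) + \<omega> \<in> T n"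

lemma T_monomial: "f \<in> smooth_functions \<Longrightarrow> set js \<subseteq> {..<6} \<Longrightarrow> length js = n \<Longrightarrow> fmult f (w js) \<in> T n"
  using T_step[OF _ _ _ T_zero] by simp

lemma T_add: "\<omega> \<in> T n \<Longrightarrow> \<eta> \<in> T n \<Longrightarrow> \<omega> + \<eta> \<in> T n"
  by (induction rule: T.induct) (auto simp: add.assoc intro: T.intros)

lemma T_sum: "(\<And>i. i \<in> I \<Longrightarrow> \<omega> i \<in> T n) \<Longrightarrow> (\<Sum>i\<in>I. \<omega> i) \<in> T n"
  by (induction I rule: infinite_finite_induct) (simp_all add: T_zero T_add)

lemma T_fmult: "\<omega> \<in> T n \<Longrightarrow> f \<in> smooth_functions \<Longrightarrow> fmult f \<omega> \<in> T n"
  by (induction rule: T.induct)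
    (auto simp: fmult_zero fmult_add fmult_fmult intro: T.intros smooth_functions_mult)

lemma T_wedge: "\<omega> \<in> T n \<Longrightarrow> i < 6 \<Longrightarrow> \<Theta> i \<and>\<^sub>f \<omega> \<in> T (Suc n)"
proof (induction rule: T.induct)
  case (T_step f js \<omega>)
  then show ?case
    using T.T_step[of f "i # js" "Suc n" "\<Theta> i \<and>\<^sub>f \<omega>"] by (simp add: wedge_add_right wedge_fmult_right)
qed (simp add: wedge_zero_right T_zero)

lemma diff_form_w: "diff_form (w js)"
proof (induction js)
  case Nil
  show ?case by (simp add: diff_form_def form_one_def)
next
  case (Cons j js)
  then show ?case by (simp add: diff_form_wedge one_form_\<Theta> diff_form_\<Theta>)
qed

lemma diff_form_T: "\<omega> \<in> T n \<Longrightarrow> diff_form \<omega>"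
  by (induction rule: T.induct)
    (simp_all add: diff_form_zero diff_form_add diff_form_fmult diff_form_w smooth_functionsD(4))

lemma T_minus: "\<omega> \<in> T n \<Longrightarrow> - \<omega> \<in> T n"
proof -
  assume "\<omega> \<in> T n"
  moreover have "- \<omega> = fmult (\<lambda>_. -1) \<omega>" by (simp add: fun_eq_iff form_apply)
  ultimately show ?thesis using T_fmult smooth_functions_const by metis
qed

lemma ext_deriv_form_one: "ext_deriv form_one = 0"
  by (simp add: fun_eq_iff form_apply ext_deriv_def form_one_def frechet_derivative_const)

lemma ext_deriv_w: "set js \<subseteq> {..<6} \<Longrightarrow> ext_deriv (w js) \<in> T (Suc (length js))"
proof (induction js)
  case Nil
  then show ?case by (simp add: ext_deriv_form_one T_zero)
next
  case (Cons j js)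
  have "fmult (\<lambda>_. struc j a b) (\<Theta> a \<and>\<^sub>f \<Theta> b \<and>\<^sub>f w js) \<in> T (Suc (Suc (length js)))" if "a < 6" "b < 6" for a b
    using T_monomial[of "\<lambda>_. struc j a b" "a # b # js"] that Cons.prems by (simp add: smooth_functions_const)
  moreover have "\<Theta> j \<and>\<^sub>f ext_deriv (w js) \<in> T (Suc (Suc (length js)))"
    using Cons by (intro T_wedge) auto
  ultimately show ?case
    unfolding w_simps ext_deriv_\<Theta>_wedge[OF diff_form_w] length_Cons
    by (intro T_add T_minus T_sum) auto
qed

lemma ext_deriv_monomial:
  assumes "f \<in> smooth_functions"
  shows "ext_deriv (fmult f (w js)) = (\<Sum>j<6. fmult (D j f) (w (j # js))) + fmult f (ext_deriv (w js))"
  using assms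
  by (simp add: ext_deriv_fmult smooth_functionsD(4) diff_form_w total_diff_\<Theta> wedge_sum_left wedge_fmult_left)

lemma ext_deriv_T: "\<omega> \<in> T n \<Longrightarrow> ext_deriv \<omega> \<in> T (Suc n)"
proof (induction rule: T.induct)
  case T_zero
  show ?case by (simp add: ext_deriv_zero T.T_zero)
next
  case (T_step f js \<omega>)
  have "ext_deriv (fmult f (w js) + \<omega>) = ext_deriv (fmult f (w js)) + ext_deriv \<omega>"
    using T_step by (intro ext_deriv_add diff_form_fmult diff_form_w smooth_functionsD(4) diff_form_T[of \<omega> n])
  moreover have "ext_deriv (fmult f (w js)) \<in> T (Suc n)"
    unfolding ext_deriv_monomial[OF T_step(1)]
    using T_step by (intro T_add T_sum T_monomial D_smooth T_fmult) (auto intro: ext_deriv_w)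
  ultimately show ?case using T_step T_add by simp
qed

end


section \<open>Dolbeault cohomology as a quotient\<close>

definition form_subspace :: "form set \<Rightarrow> bool" where
  "form_subspace S \<longleftrightarrow> 0 \<in> S \<and> (\<forall>a\<in>S. \<forall>b\<in>S. a + b \<in> S) \<and> (\<forall>c. \<forall>a\<in>S. fscale c a \<in> S)"

lemma form_subspaceD:
  assumes "form_subspace S"
  shows "0 \<in> S" "a \<in> S \<Longrightarrow> b \<in> S \<Longrightarrow> a + b \<in> S" "a \<in> S \<Longrightarrow> fscale c a \<in> S" "a \<in> S \<Longrightarrow> b \<in> S \<Longrightarrow> a - b \<in> S"
proof -
  show *: "0 \<in> S" "a \<in> S \<Longrightarrow> b \<in> S \<Longrightarrow> a + b \<in> S" "a \<in> S \<Longrightarrow> fscale c a \<in> S" for a b c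
    using assms by (auto simp: form_subspace_def)
  have e: "a - b = a + fscale (-1) b"
    by (simp add: fun_eq_iff form_apply fscale_apply)
  show "a \<in> S \<Longrightarrow> b \<in> S \<Longrightarrow> a - b \<in> S" unfolding e by (rule *(2)[OF _ *(3)])
qed

lemma cring_complex_ring: "cring complex_ring"
proof (rule cringI)
  show "abelian_group complex_ring"
    by (rule abelian_groupI) (auto simp: complex_ring_def intro: exI[of _ "- x" for x] left_minus)
  show "comm_monoid complex_ring"
    by unfold_locales (auto simp: complex_ring_def)
qed (simp add: complex_ring_def algebra_simps)

locale dolbeault_subspaces =
  fixes \<theta> :: "form list" and p q :: nat
  assumes closed: "form_subspace (closed_forms \<theta> p q)" and exact: "form_subspace (exact_forms \<theta> p q)"
begin

abbreviation "E \<equiv> exact_forms \<theta> p q"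
abbreviation "cls \<equiv> dolbeault_class \<theta> p q"
abbreviation "H \<equiv> dolbeault \<theta> p q"

lemma mem_cls: "x \<in> cls \<omega> \<longleftrightarrow> x - \<omega> \<in> E"
proof
  assume "x \<in> cls \<omega>"
  then show "x - \<omega> \<in> E" by (auto simp: dolbeault_class_def)
next
  assume "x - \<omega> \<in> E"
  moreover have "x = \<omega> + (x - \<omega>)" by simp
  ultimately show "x \<in> cls \<omega>" unfolding dolbeault_class_def by blast
qed

lemma add_cls: "cls \<omega> \<oplus>\<^bsub>H\<^esub> cls \<eta> = cls (\<omega> + \<eta>)"
proof (rule Set.set_eqI)
  fix x
  have "x \<in> cls \<omega> \<oplus>\<^bsub>H\<^esub> cls \<eta> \<longleftrightarrow> (\<exists>a b. x = a + b \<and> a - \<omega> \<in> E \<and> b - \<eta> \<in> E)"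
    by (auto simp: dolbeault_def mem_cls)
  also have "\<dots> \<longleftrightarrow> x - (\<omega> + \<eta>) \<in> E"
  proof
    assume "\<exists>a b. x = a + b \<and> a - \<omega> \<in> E \<and> b - \<eta> \<in> E"
    then obtain a b where "x = a + b" "a - \<omega> \<in> E" "b - \<eta> \<in> E" by blast
    then show "x - (\<omega> + \<eta>) \<in> E"
      using form_subspaceD(2)[OF exact, of "a - \<omega>" "b - \<eta>"] by (simp add: algebra_simps)
  next
    assume "x - (\<omega> + \<eta>) \<in> E"
    then show "\<exists>a b. x = a + b \<and> a - \<omega> \<in> E \<and> b - \<eta> \<in> E"
      using form_subspaceD(1)[OF exact]
      by (intro exI[of _ "x - \<eta>"] exI[of _ \<eta>]) (simp add: algebra_simps)
  qed
  finally show "x \<in> cls \<omega> \<oplus>\<^bsub>H\<^esub> cls \<eta> \<longleftrightarrow> x \<in> cls (\<omega> + \<eta>)" by (simp add: mem_cls)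
qed

lemma smult_cls: "c \<odot>\<^bsub>H\<^esub> cls \<omega> = cls (fscale c \<omega>)"
proof (rule Set.set_eqI)
  fix x
  have s: "fscale c a - fscale c \<omega> = fscale c (a - \<omega>)" for a
    by (simp add: fun_eq_iff form_apply fscale_apply algebra_simps)
  have "x \<in> c \<odot>\<^bsub>H\<^esub> cls \<omega> \<longleftrightarrow> (\<exists>a e. x = fscale c a + e \<and> a - \<omega> \<in> E \<and> e \<in> E)"
    by (auto simp: dolbeault_def mem_cls)
  also have "\<dots> \<longleftrightarrow> x - fscale c \<omega> \<in> E"
  proof
    assume "\<exists>a e. x = fscale c a + e \<and> a - \<omega> \<in> E \<and> e \<in> E"
    then obtain a e where a: "x = fscale c a + e" "a - \<omega> \<in> E" "e \<in> E" by blast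
    have "x - fscale c \<omega> = fscale c (a - \<omega>) + e" using a(1) by (simp add: s[symmetric])
    then show "x - fscale c \<omega> \<in> E"
      using form_subspaceD(2)[OF exact form_subspaceD(3)[OF exact a(2), of c] a(3)] by (simp only:)
  next
    assume "x - fscale c \<omega> \<in> E"
    then show "\<exists>a e. x = fscale c a + e \<and> a - \<omega> \<in> E \<and> e \<in> E"
      using form_subspaceD(1)[OF exact]
      by (intro exI[of _ \<omega>] exI[of _ "x - fscale c \<omega>"]) simp
  qed
  finally show "x \<in> c \<odot>\<^bsub>H\<^esub> cls \<omega> \<longleftrightarrow> x \<in> cls (fscale c \<omega>)" by (simp add: mem_cls)
qed

lemma zero_cls: "\<zero>\<^bsub>H\<^esub> = cls 0"
  by (auto simp: dolbeault_def mem_cls)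

lemma carrier_H: "carrier H = cls ` closed_forms \<theta> p q"
  by (simp add: dolbeault_def)

lemma module_H: "Module.module complex_ring H"
proof (rule moduleI)
  show "cring complex_ring" by (rule cring_complex_ring)
  show "abelian_group H"
  proof (rule abelian_groupI)
    fix x assume "x \<in> carrier H"
    then obtain a where a: "x = cls a" "a \<in> closed_forms \<theta> p q" by (auto simp: carrier_H)
    have "fscale (-1) a + a = 0" by (simp add: fun_eq_iff form_apply fscale_apply)
    then have "cls (fscale (-1) a) \<oplus>\<^bsub>H\<^esub> x = \<zero>\<^bsub>H\<^esub>" by (simp add: a add_cls zero_cls)
    moreover have "cls (fscale (-1) a) \<in> carrier H"
      using form_subspaceD(3)[OF closed a(2)] by (simp add: carrier_H)
    ultimately show "\<exists>y\<in>carrier H. y \<oplus>\<^bsub>H\<^esub> x = \<zero>\<^bsub>H\<^esub>" by blast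
  qed (auto simp: carrier_H add_cls zero_cls add_ac form_subspaceD[OF closed])
next
  fix a b x y
  assume "x \<in> carrier H" "y \<in> carrier H"
  then obtain u v where u: "x = cls u" "u \<in> closed_forms \<theta> p q" "y = cls v" "v \<in> closed_forms \<theta> p q"
    by (auto simp: carrier_H)
  have fs: "fscale (a + b) u = fscale a u + fscale b u" "fscale a (u + v) = fscale a u + fscale a v"
    "fscale (a * b) u = fscale a (fscale b u)" "fscale 1 u = u"
    by (simp_all add: fun_eq_iff form_apply fscale_apply algebra_simps)
  show "a \<odot>\<^bsub>H\<^esub> x \<in> carrier H"
    using form_subspaceD(3)[OF closed u(2)] by (simp add: u smult_cls carrier_H)
  show "(a \<oplus>\<^bsub>complex_ring\<^esub> b) \<odot>\<^bsub>H\<^esub> x = a \<odot>\<^bsub>H\<^esub> x \<oplus>\<^bsub>H\<^esub> b \<odot>\<^bsub>H\<^esub> x"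
    by (simp add: u smult_cls add_cls complex_ring_def fs)
  show "a \<odot>\<^bsub>H\<^esub> (x \<oplus>\<^bsub>H\<^esub> y) = a \<odot>\<^bsub>H\<^esub> x \<oplus>\<^bsub>H\<^esub> a \<odot>\<^bsub>H\<^esub> y"
    by (simp add: u smult_cls add_cls fs)
  show "(a \<otimes>\<^bsub>complex_ring\<^esub> b) \<odot>\<^bsub>H\<^esub> x = a \<odot>\<^bsub>H\<^esub> (b \<odot>\<^bsub>H\<^esub> x)"
    by (simp add: u smult_cls complex_ring_def fs)
  show "\<one>\<^bsub>complex_ring\<^esub> \<odot>\<^bsub>H\<^esub> x = x"
    by (simp add: u smult_cls complex_ring_def fs)
qed

lemma submodule_cls:
  assumes S: "form_subspace S" "S \<subseteq> closed_forms \<theta> p q"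
  shows "submodule (cls ` S) complex_ring H"
proof -
  interpret Module.module complex_ring H by (rule module_H)
  have sm: "a \<odot>\<^bsub>H\<^esub> x \<in> cls ` S" if "x \<in> cls ` S" for a x
    using that form_subspaceD(3)[OF S(1)] by (auto simp: smult_cls)
  show ?thesis
  proof (rule submoduleI)
    show "cls ` S \<subseteq> carrier H" using S(2) by (auto simp: carrier_H)
    \<comment> \<open>Negation is multiplication by the scalar -1, so closure under scalars gives
      closure under negatives.\<close>
    then have "\<ominus>\<^bsub>H\<^esub> x = (\<ominus>\<^bsub>complex_ring\<^esub> \<one>\<^bsub>complex_ring\<^esub>) \<odot>\<^bsub>H\<^esub> x" if "x \<in> cls ` S" for x
      using that by (subst smult_l_minus) auto
    then show "\<ominus>\<^bsub>H\<^esub> x \<in> cls ` S" if "x \<in> cls ` S" for x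
      using that sm by simp
  qed (use sm form_subspaceD[OF S(1)] in \<open>auto simp: zero_cls add_cls\<close>)
qed

text \<open>The span is computed on forms: the preimage of a submodule under the class map is a
  subspace of forms, so minimality of \<open>S\<close> among subspaces containing \<open>A\<close>
  carries over to the quotient.\<close>

lemma span_module_cls:
  assumes S: "form_subspace S" "S \<subseteq> closed_forms \<theta> p q" "A \<subseteq> S"
    and min: "\<And>S'. form_subspace S' \<Longrightarrow> A \<subseteq> S' \<Longrightarrow> S \<subseteq> S'"
  shows "span_module H (cls ` A) = H\<lparr>carrier := cls ` S\<rparr>"
proof -
  interpret Module.module complex_ring H by (rule module_H)
  have "(\<lambda>N. submodule N complex_ring H) hull (cls ` A) = cls ` S"
  proof (rule hull_unique)
    show "cls ` A \<subseteq> cls ` S" using S(3) by blast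
    show "submodule (cls ` S) complex_ring H" by (rule submodule_cls[OF S(1,2)])
    fix N assume N: "cls ` A \<subseteq> N" "submodule N complex_ring H"
    have "\<zero>\<^bsub>H\<^esub> \<in> N" using subgroup.one_closed[OF submodule.axioms(1)[OF N(2)]] by simp
    then have "form_subspace {\<omega>. cls \<omega> \<in> N}"
      using submoduleE(4,5)[OF N(2)]
      by (auto simp: form_subspace_def zero_cls add_cls[symmetric] smult_cls[symmetric] complex_ring_def)
    from min[OF this] N(1) show "cls ` S \<subseteq> N" by blast
  qed
  then show ?thesis by (simp add: span_module_def)
qed

lemma module_span_module_cls:
  assumes S: "form_subspace S" "S \<subseteq> closed_forms \<theta> p q"
  shows "Module.module complex_ring (H\<lparr>carrier := cls ` S\<rparr>)"
  by (rule submodule.submodule_is_module[OF submodule_cls[OF S] module_H])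

end


section \<open>Decomposition into types\<close>

lemma insert_vec_form_one: "insert_vec v form_one = 0"
  by (simp add: insert_vec_def form_one_def fun_eq_iff form_apply)

text \<open>Encodes a pair (I, J) as one strictly increasing list, with conjugate indices moved up
  by 3, so that a single coefficient extraction serves all types (p, q) of the same degree.\<close>

definition klist :: "nat set \<Rightarrow> nat set \<Rightarrow> nat list" where
  "klist I J = nths [0, 1, 2] I @ nths [3, 4, 5] J"

definition pq_index :: "nat \<Rightarrow> nat \<Rightarrow> (nat set \<times> nat set) set" where
  "pq_index p q = {I. I \<subseteq> {..<3} \<and> card I = p} \<times> {J. J \<subseteq> {..<3} \<and> card J = q}"

lemma finite_pq_index: "finite (pq_index p q)"
proof -
  have "finite {I. I \<subseteq> {..<3::nat} \<and> card I = n}" for n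
    by (rule finite_subset[of _ "Pow {..<3}"]) auto
  then show ?thesis by (simp add: pq_index_def)
qed

lemma klist_props:
  "sorted (klist I J)" "distinct (klist I J)" "set (klist I J) \<subseteq> {..<6}"
proof -
  show "sorted (klist I J)" "distinct (klist I J)" by (simp_all add: klist_def nths_Cons)
  have "set (nths [0, 1, 2::nat] I) \<subseteq> {0, 1, 2}" "set (nths [3, 4, 5::nat] J) \<subseteq> {3, 4, 5}"
    by (rule order_trans[OF set_nths_subset]; simp)+
  then show "set (klist I J) \<subseteq> {..<6}" by (fastforce simp: klist_def)
qed

lemma klist_mem_lt: "i < 3 \<Longrightarrow> i \<in> set (klist I J) \<longleftrightarrow> i \<in> I"
proof -
  assume "i < 3"
  then have "i = 0 \<or> i = 1 \<or> i = 2" by presburger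
  then show ?thesis by (elim disjE) (simp_all add: klist_def nths_Cons numeral_2_eq_2)
qed

lemma klist_mem_ge: "j < 3 \<Longrightarrow> j + 3 \<in> set (klist I J) \<longleftrightarrow> j \<in> J"
proof -
  assume "j < 3"
  then have "j = 0 \<or> j = 1 \<or> j = 2" by presburger
  then show ?thesis by (elim disjE) (simp_all add: klist_def nths_Cons numeral_2_eq_2[symmetric])
qed

lemma klist_inject:
  assumes "(I, J) \<in> pq_index p q" "(I', J') \<in> pq_index p' q'" "set (klist I J) = set (klist I' J')"
  shows "I = I' \<and> J = J'"
proof
  have lt: "I \<subseteq> {..<3}" "J \<subseteq> {..<3}" "I' \<subseteq> {..<3}" "J' \<subseteq> {..<3}"
    using assms by (auto simp: pq_index_def)
  have "i \<in> I \<longleftrightarrow> i \<in> I'" for i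
    using lt klist_mem_lt[of i I J] klist_mem_lt[of i I' J'] assms(3) by auto
  then show "I = I'" by blast
  have "j \<in> J \<longleftrightarrow> j \<in> J'" for j
    using lt klist_mem_ge[of j I J] klist_mem_ge[of j I' J'] assms(3) by auto
  then show "J = J'" by blast
qed

lemma length_klist:
  assumes "(I, J) \<in> pq_index p q"
  shows "length (klist I J) = p + q"
proof -
  have "{i. i < 3 \<and> i \<in> K} = K" if "K \<subseteq> {..<3}" for K :: "nat set" using that by auto
  then show ?thesis using assms by (simp add: klist_def length_nths pq_index_def numeral_3_eq_3)
qed

lemma klist_surj:
  assumes "sorted ks" "distinct ks" "set ks \<subseteq> {..<6}"
  obtains I J p q where "(I, J) \<in> pq_index p q" "ks = klist I J" "p + q = length ks"
proof -
  define I J where "I = {i. i < 3 \<and> i \<in> set ks}" and "J = {j. j < 3 \<and> j + 3 \<in> set ks}"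
  have IJ: "(I, J) \<in> pq_index (card I) (card J)" by (auto simp: pq_index_def I_def J_def)
  have "n \<in> set ks \<longleftrightarrow> n \<in> set (klist I J)" for n
  proof (cases "n < 3")
    case True
    then show ?thesis by (simp add: klist_mem_lt I_def)
  next
    case False
    show ?thesis
    proof (cases "n < 6")
      case True
      have "n - 3 < 3" "n - 3 + 3 = n" using True False by auto
      then show ?thesis using klist_mem_ge[of "n - 3" I J] by (simp add: J_def)
    next
      case False
      then show ?thesis using assms(3) klist_props(3)[of I J] by (auto simp: subset_eq)
    qed
  qed
  then have "ks = klist I J"
    using assms klist_props by (intro sorted_distinct_set_unique) auto
  then show ?thesis using that[OF IJ] length_klist[OF IJ] by simp
qed

context heis_coframe
begin

abbreviation "\<theta> \<equiv> [\<Theta> 0, \<Theta> (Suc 0), \<Theta> 2]"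

lemma cnj_\<Theta>:
  assumes "i < 3"
  shows "cnj_form (\<Theta> i) = \<Theta> (i + 3)"
proof (intro ext)
  fix z vs
  have c: "cnj (base_form 0 z vs) = base_form 3 z vs" "cnj (base_form 1 z vs) = base_form 4 z vs"
    "cnj (base_form 2 z vs) = base_form 5 z vs" "cnj (base_form 3 z vs) = base_form 0 z vs"
    "cnj (base_form 4 z vs) = base_form 1 z vs" "cnj (base_form 5 z vs) = base_form 2 z vs"
    by (simp_all add: base_form_eval)
  show "cnj_form (\<Theta> i) z vs = \<Theta> (i + 3) z vs"
    using M_conj[OF assms, of 0] M_conj[OF assms, of 1] M_conj[OF assms, of 2]
    by (simp add: cnj_form_def \<Theta>_def sum_form_apply fmult_apply)
      (simp add: sum_lessThan_6 c[simplified])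
qed

lemma pq_basis_eq: "pq_basis \<theta> I J = w (klist I J)"
proof -
  have "map cnj_form \<theta> = map \<Theta> [3, 4, 5]" using cnj_\<Theta>[of 0] cnj_\<Theta>[of 1] cnj_\<Theta>[of 2] by simp
  moreover have "\<theta> = map \<Theta> [0, 1, 2]" by simp
  ultimately show ?thesis by (simp only: pq_basis_def klist_def w_def map_append nths_map)
qed

lemma pq_forms_eq: "pq_forms \<theta> p q = {\<Sum>(I, J)\<in>pq_index p q. fmult (f I J) (w (klist I J)) | f.
    \<forall>I J. f I J \<in> smooth_functions}"
proof -
  have "length \<theta> = 3" by simp
  then show ?thesis by (simp only: pq_forms_def pq_basis_eq pq_index_def)
qed

text \<open>Iterated contraction with the frame dual to \<open>\<Theta>\<close> reads off coefficients.\<close>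

primrec ex :: "nat list \<Rightarrow> form \<Rightarrow> point \<Rightarrow> complex" where
  "ex [] = (\<lambda>\<omega> z. \<omega> z [])"
| "ex (k # ks) = (\<lambda>\<omega>. ex ks (hook k \<omega>))"

lemma ex_add: "ex ks (\<omega> + \<eta>) z = ex ks \<omega> z + ex ks \<eta> z"
  by (induction ks arbitrary: \<omega> \<eta>) (simp_all add: form_apply hook_add)

lemma ex_fmult: "ex ks (fmult f \<omega>) z = f z * ex ks \<omega> z"
  by (induction ks arbitrary: \<omega>) (simp_all add: form_apply hook_fmult)

lemma ex_zero: "ex ks 0 z = 0"
  using ex_fmult[of ks "\<lambda>_. 0" 0 z] by (simp add: fmult_zero_left)

lemma ex_sum: "ex ks (\<Sum>i\<in>I. \<omega> i) z = (\<Sum>i\<in>I. ex ks (\<omega> i) z)"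
  by (induction I rule: infinite_finite_induct) (simp_all add: ex_zero ex_add)

lemma hook_w_notin: "set js \<subseteq> {..<6} \<Longrightarrow> k < 6 \<Longrightarrow> k \<notin> set js \<Longrightarrow> hook k (w js) = 0"
proof (induction js)
  case Nil
  have "const_hook v k form_one = 0" for v k
    by (simp add: const_hook_def insert_vec_form_one fmult_zero)
  then have "base_hook l form_one = 0" for l by (simp add: base_hook_def fmult_zero)
  then show ?case by (simp add: hook_def fmult_zero)
next
  case (Cons j js)
  then show ?case by (simp add: hook_wedge wedge_zero_right)
qed

lemma hook_w_in:
  "set js \<subseteq> {..<6} \<Longrightarrow> distinct js \<Longrightarrow> k \<in> set js \<Longrightarrow> \<exists>s. hook k (w js) = fmult (\<lambda>_. s) (w (remove1 k js))"
proof (induction js)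
  case (Cons j js)
  show ?case
  proof (cases "k = j")
    case True
    then have "hook k (w (j # js)) = fmult (\<lambda>_. 1) (w (remove1 k (j # js)))"
      using Cons.prems by (simp add: hook_wedge hook_w_notin wedge_zero_right fmult_one_left)
    then show ?thesis by blast
  next
    case False
    then obtain s where "hook k (w js) = fmult (\<lambda>_. s) (w (remove1 k js))" using Cons by auto
    moreover have "j < 6" "k < 6" using Cons.prems by auto
    ultimately have "hook k (w (j # js)) = - fmult (\<lambda>_. s) (w (remove1 k (j # js)))"
      using False by (simp add: hook_wedge wedge_fmult_right)
    also have "\<dots> = fmult (\<lambda>_. - s) (w (remove1 k (j # js)))"
      by (simp only: fun_eq_iff form_apply) simp
    finally show ?thesis by blast
  qed
qed simp

text \<open>Each contraction either kills the monomial or removes its own index from it, so a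
  nonzero result has used up exactly the indices present.\<close>

lemma ex_w_nonzero:
  "set ks \<subseteq> {..<6} \<Longrightarrow> set js \<subseteq> {..<6} \<Longrightarrow> distinct js \<Longrightarrow> length ks = length js \<Longrightarrow>
     ex ks (w js) z \<noteq> 0 \<Longrightarrow> set ks = set js"
proof (induction ks arbitrary: js)
  case (Cons k ks)
  have k: "k \<in> set js"
  proof (rule ccontr)
    assume "k \<notin> set js"
    then have "hook k (w js) = 0" using Cons.prems by (intro hook_w_notin) auto
    then show False using Cons.prems(5) by (simp add: ex_zero)
  qed
  then obtain s where s: "hook k (w js) = fmult (\<lambda>_. s) (w (remove1 k js))"
    using hook_w_in Cons.prems by blast
  have "set ks = set (remove1 k js)"
  proof (rule Cons.IH)
    show "set (remove1 k js) \<subseteq> {..<6}" using Cons.prems(2) set_remove1_subset by fast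
    show "length ks = length (remove1 k js)" using k Cons.prems(4) by (simp add: length_remove1)
    show "ex ks (w (remove1 k js)) z \<noteq> 0" using Cons.prems(5) by (auto simp: s ex_fmult)
  qed (use Cons.prems in auto)
  then show ?case using k Cons.prems(3) by auto
qed simp

text \<open>Contracting in the order of the list strips the head each time, so no sign
  arises.\<close>

lemma ex_w_self: "set ks \<subseteq> {..<6} \<Longrightarrow> distinct ks \<Longrightarrow> ex ks (w ks) z = 1"
  by (induction ks) (simp_all add: form_one_def hook_wedge hook_w_notin wedge_zero_right)

lemma ex_w_sorted:
  assumes "sorted ks" "distinct ks" "set ks \<subseteq> {..<6}" "sorted js" "distinct js" "set js \<subseteq> {..<6}" "length ks = length js"
  shows "ex ks (w js) z = (if ks = js then 1 else 0)"
  using ex_w_self[of ks z] ex_w_nonzero[of ks js z] sorted_distinct_set_unique[of ks js] assms by auto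

lemma ex_pq_sum:
  assumes "(I, J) \<in> pq_index p' q'" "p + q = p' + q'"
  shows "ex (klist I J) (\<Sum>(I', J')\<in>pq_index p q. fmult (f I' J') (w (klist I' J'))) z
    = (if p = p' \<and> q = q' then f I J z else 0)"
proof -
  have "ex (klist I J) (\<Sum>(I', J')\<in>pq_index p q. fmult (f I' J') (w (klist I' J'))) z
    = (\<Sum>x\<in>pq_index p q. f (fst x) (snd x) z * ex (klist I J) (w (klist (fst x) (snd x))) z)"
    by (simp add: ex_sum split_beta ex_fmult)
  also have "\<dots> = (\<Sum>x\<in>pq_index p q. if x = (I, J) then f I J z else 0)"
  proof (rule sum.cong[OF refl])
    fix x assume "x \<in> pq_index p q"
    then obtain I' J' where x: "x = (I', J')" "(I', J') \<in> pq_index p q" by (cases x) auto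
    have "klist I J = klist I' J' \<longleftrightarrow> I = I' \<and> J = J'"
      using klist_inject[OF assms(1) x(2)] by auto
    then show "f (fst x) (snd x) z * ex (klist I J) (w (klist (fst x) (snd x))) z = (if x = (I, J) then f I J z else 0)"
      using ex_w_sorted[OF klist_props klist_props, of I J I' J' z] length_klist[OF assms(1)] length_klist[OF x(2)] assms(2)
      by (auto simp: x(1))
  qed
  also have "\<dots> = (if (I, J) \<in> pq_index p q then f I J z else 0)"
    by (simp add: finite_pq_index)
  also have "(I, J) \<in> pq_index p q \<longleftrightarrow> p = p' \<and> q = q'"
    using assms(1) by (auto simp: pq_index_def)
  finally show ?thesis .
qed

text \<open>An explicit projection to type (p, q), linear over functions. It serves as the
  computable form of \<open>pq_component\<close>, with which it is identified in
  \<open>pq_component_eq\<close>.\<close>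

definition comp :: "nat \<Rightarrow> nat \<Rightarrow> form \<Rightarrow> form" where
  "comp p q \<omega> = (\<Sum>(I, J)\<in>pq_index p q. fmult (ex (klist I J) \<omega>) (w (klist I J)))"

lemma comp_pq:
  assumes "\<omega> \<in> pq_forms \<theta> p' q'" "p + q = p' + q'"
  shows "comp p q \<omega> = (if p = p' then \<omega> else 0)"
proof -
  obtain f where f: "\<omega> = (\<Sum>(I, J)\<in>pq_index p' q'. fmult (f I J) (w (klist I J)))"
    using assms(1) unfolding pq_forms_eq by blast
  have "comp p q \<omega> = (\<Sum>(I, J)\<in>pq_index p q. fmult (\<lambda>z. if p = p' \<and> q = q' then f I J z else 0) (w (klist I J)))"
    unfolding comp_def
  proof (intro sum.cong refl, clarify)
    fix I J assume "(I, J) \<in> pq_index p q"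
    from ex_pq_sum[OF this, of p' q' f] assms(2)
    have "ex (klist I J) \<omega> = (\<lambda>z. if p = p' \<and> q = q' then f I J z else 0)"
      unfolding f by (intro ext) auto
    then show "fmult (ex (klist I J) \<omega>) (w (klist I J))
        = fmult (\<lambda>z. if p = p' \<and> q = q' then f I J z else 0) (w (klist I J))" by simp
  qed
  also have "\<dots> = (if p = p' then \<omega> else 0)"
  proof (cases "p = p'")
    case True
    then have "q = q'" using assms(2) by simp
    then show ?thesis using True f by simp
  qed (simp add: fmult_zero_left)
  finally show ?thesis .
qed

lemma comp_add: "comp p q (\<omega> + \<eta>) = comp p q \<omega> + comp p q \<eta>"
proof -
  have "ex ks (\<omega> + \<eta>) = (\<lambda>z. ex ks \<omega> z + ex ks \<eta> z)" for ks by (intro ext ex_add)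
  then show ?thesis by (simp add: comp_def split_beta fmult_add_left sum.distrib)
qed

lemma comp_fmult: "comp p q (fmult f \<omega>) = fmult f (comp p q \<omega>)"
proof -
  have "ex ks (fmult f \<omega>) = (\<lambda>z. f z * ex ks \<omega> z)" for ks by (intro ext ex_fmult)
  then show ?thesis by (simp add: comp_def split_beta fmult_sum fmult_fmult)
qed

lemma comp_zero: "comp p q 0 = 0"
  using comp_fmult[of p q "\<lambda>_. 0" 0] by (simp add: fmult_zero_left)

lemma comp_sum: "comp p q (\<Sum>i\<in>I. \<omega> i) = (\<Sum>i\<in>I. comp p q (\<omega> i))"
  by (induction I rule: infinite_finite_induct) (simp_all add: comp_zero comp_add)

lemma ex_comp:
  "(I, J) \<in> pq_index p q \<Longrightarrow> ex (klist I J) (comp p q \<omega>) z = ex (klist I J) \<omega> z"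
  unfolding comp_def using ex_pq_sum[of I J p q p q "\<lambda>I J. ex (klist I J) \<omega>" z] by simp

lemma pq_forms_add:
  assumes "\<omega> \<in> pq_forms \<theta> p q" "\<eta> \<in> pq_forms \<theta> p q"
  shows "\<omega> + \<eta> \<in> pq_forms \<theta> p q"
proof -
  obtain f g where f: "\<omega> = (\<Sum>(I, J)\<in>pq_index p q. fmult (f I J) (w (klist I J)))" "\<forall>I J. f I J \<in> smooth_functions"
    and g: "\<eta> = (\<Sum>(I, J)\<in>pq_index p q. fmult (g I J) (w (klist I J)))" "\<forall>I J. g I J \<in> smooth_functions"
    using assms unfolding pq_forms_eq by blast
  have "\<omega> + \<eta> = (\<Sum>(I, J)\<in>pq_index p q. fmult (\<lambda>z. f I J z + g I J z) (w (klist I J)))"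
    by (simp add: f g split_beta fmult_add_left sum.distrib)
  then show ?thesis using f(2) g(2) unfolding pq_forms_eq
    by (intro CollectI exI[of _ "\<lambda>I J z. f I J z + g I J z"]) (simp add: smooth_functions_add)
qed

lemma pq_forms_fmult:
  assumes "\<omega> \<in> pq_forms \<theta> p q" "h \<in> smooth_functions"
  shows "fmult h \<omega> \<in> pq_forms \<theta> p q"
proof -
  obtain f where f: "\<omega> = (\<Sum>(I, J)\<in>pq_index p q. fmult (f I J) (w (klist I J)))" "\<forall>I J. f I J \<in> smooth_functions"
    using assms unfolding pq_forms_eq by blast
  have "fmult h \<omega> = (\<Sum>(I, J)\<in>pq_index p q. fmult (\<lambda>z. h z * f I J z) (w (klist I J)))"
    by (simp add: f split_beta fmult_sum fmult_fmult)
  then show ?thesis using f(2) assms(2) unfolding pq_forms_eq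
    by (intro CollectI exI[of _ "\<lambda>I J z. h z * f I J z"]) (simp add: smooth_functions_mult)
qed

lemma pq_forms_basis:
  assumes "(I, J) \<in> pq_index p q"
  shows "w (klist I J) \<in> pq_forms \<theta> p q"
proof -
  let ?f = "\<lambda>I' J' z. if (I', J') = (I, J) then 1 else 0 :: complex"
  have "(\<Sum>(I', J')\<in>pq_index p q. fmult (?f I' J') (w (klist I' J')))
      = (\<Sum>x\<in>pq_index p q. if x = (I, J) then w (klist I J) else 0)"
    by (intro sum.cong refl) (auto simp: fmult_one_left fmult_zero_left)
  also have "\<dots> = w (klist I J)" using assms by (simp add: finite_pq_index)
  finally show ?thesis unfolding pq_forms_eq
    by (intro CollectI exI[of _ ?f]) (auto simp: smooth_functions_const)
qed

lemma pq_forms_zero: "0 \<in> pq_forms \<theta> p q"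
  unfolding pq_forms_eq
  by (intro CollectI exI[of _ "\<lambda>I J z. 0"]) (simp add: smooth_functions_const fmult_zero_left split_beta)

lemma pq_forms_T: "\<omega> \<in> pq_forms \<theta> p q \<Longrightarrow> \<omega> \<in> T (p + q)"
proof -
  assume "\<omega> \<in> pq_forms \<theta> p q"
  then obtain f where f: "\<omega> = (\<Sum>(I, J)\<in>pq_index p q. fmult (f I J) (w (klist I J)))" "\<forall>I J. f I J \<in> smooth_functions"
    unfolding pq_forms_eq by blast
  show "\<omega> \<in> T (p + q)"
    unfolding f(1)
  proof (rule T_sum, clarify)
    fix I J assume "(I, J) \<in> pq_index p q"
    then show "fmult (f I J) (w (klist I J)) \<in> T (p + q)"
      using f(2) by (intro T_monomial klist_props length_klist) auto
  qed
qed

text \<open>A monomial with a repeated index vanishes. Any other one is, after sorting, a constant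
  multiple of a basis monomial and is added to the summand of that type.\<close>

lemma T_decompose:
  "\<omega> \<in> T n \<Longrightarrow> \<exists>\<phi>. (\<forall>i\<le>n. \<phi> i \<in> pq_forms \<theta> i (n - i)) \<and> \<omega> = (\<Sum>i\<le>n. \<phi> i)"
proof (induction rule: T.induct)
  case T_zero
  show ?case by (intro exI[of _ "\<lambda>_. 0"]) (simp add: pq_forms_zero)
next
  case (T_step f js \<omega>)
  then obtain \<phi> where \<phi>: "\<forall>i\<le>n. \<phi> i \<in> pq_forms \<theta> i (n - i)" "\<omega> = (\<Sum>i\<le>n. \<phi> i)" by blast
  show ?case
  proof (cases "distinct js")
    case False
    then show ?thesis using \<phi> by (auto simp: w_not_distinct fmult_zero)
  next
    case True
    obtain I J p q where IJ': "(I, J) \<in> pq_index p q" "sort js = klist I J" "p + q = length (sort js)"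
      by (rule klist_surj[of "sort js"]) (use True T_step(2) in simp_all)
    have "p + q = n" using IJ'(3) T_step(3) unfolding length_sort by simp
    note IJ = IJ'(1,2) this
    obtain s where s: "w js = fmult (\<lambda>_. s) (w (klist I J))" using w_sort[of js] IJ(2) by metis
    let ?m = "fmult f (w js)"
    have m: "?m \<in> pq_forms \<theta> p (n - p)"
      unfolding s fmult_fmult using IJ T_step(1) pq_forms_basis[OF IJ(1)]
      by (auto intro!: pq_forms_fmult smooth_functions_mult smooth_functions_const)
    have "(\<Sum>i\<le>n. \<phi> i + (if i = p then ?m else 0)) = ?m + \<omega>"
      using IJ(3) by (simp add: sum.distrib \<phi>(2) add.commute)
    moreover have "\<phi> i + (if i = p then ?m else 0) \<in> pq_forms \<theta> i (n - i)" if "i \<le> n" for i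
      using \<phi>(1) that m by (auto intro!: pq_forms_add pq_forms_zero)
    ultimately show ?thesis by (intro exI[of _ "\<lambda>i. \<phi> i + (if i = p then ?m else 0)"]) simp
  qed
qed

text \<open>For every decomposition into types, \<open>comp p q\<close> keeps the summand of type
  (p, q) and kills the others. So all decompositions agree in that summand, which makes the definite
  description meaningful.\<close>

lemma pq_component_eq:
  assumes "\<omega> \<in> T (p + q)"
  shows "pq_component \<theta> p q \<omega> = comp p q \<omega>" "comp p q \<omega> \<in> pq_forms \<theta> p q"
proof -
  have *: "\<phi> p = comp p q \<omega>"
    if "\<forall>i\<le>p + q. \<phi> i \<in> pq_forms \<theta> i (p + q - i)" "\<omega> = (\<Sum>i\<le>p + q. \<phi> i)" for \<phi>
  proof -
    have "comp p q \<omega> = (\<Sum>i\<le>p + q. if i = p then \<phi> i else 0)"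
      unfolding that(2) comp_sum
    proof (rule sum.cong[OF refl])
      fix i assume i: "i \<in> {..p + q}"
      then show "comp p q (\<phi> i) = (if i = p then \<phi> i else 0)"
        using comp_pq[of "\<phi> i" i "p + q - i" p q] that(1) by auto
    qed
    then show ?thesis by simp
  qed
  obtain \<phi> where \<phi>: "\<forall>i\<le>p + q. \<phi> i \<in> pq_forms \<theta> i (p + q - i)" "\<omega> = (\<Sum>i\<le>p + q. \<phi> i)"
    using T_decompose[OF assms] by blast
  show "pq_component \<theta> p q \<omega> = comp p q \<omega>"
    unfolding pq_component_def
  proof (rule the_equality)
    show "\<exists>\<phi>. (\<forall>i\<le>p + q. \<phi> i \<in> pq_forms \<theta> i (p + q - i)) \<and> \<omega> = (\<Sum>i\<le>p + q. \<phi> i) \<and> comp p q \<omega> = \<phi> p"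
      using \<phi> *[OF \<phi>] by metis
  qed (use * in blast)
  have "\<phi> p \<in> pq_forms \<theta> p (p + q - p)" using \<phi>(1) by (metis le_add1)
  then show "comp p q \<omega> \<in> pq_forms \<theta> p q" using *[OF \<phi>] by simp
qed

lemma delbar_eq:
  assumes "\<omega> \<in> pq_forms \<theta> p q"
  shows "delbar \<theta> p q \<omega> = comp p (Suc q) (ext_deriv \<omega>)" "delbar \<theta> p q \<omega> \<in> pq_forms \<theta> p (Suc q)"
  using pq_component_eq[of "ext_deriv \<omega>" p "Suc q"] ext_deriv_T[OF pq_forms_T[OF assms]]
  by (simp_all add: delbar_def)

lemma del_eq:
  assumes "\<omega> \<in> pq_forms \<theta> p q"
  shows "del \<theta> p q \<omega> = comp (Suc p) q (ext_deriv \<omega>)"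
  using pq_component_eq[of "ext_deriv \<omega>" "Suc p" q] ext_deriv_T[OF pq_forms_T[OF assms]]
  by (simp add: del_def)

lemma pq_forms_fscale: "\<omega> \<in> pq_forms \<theta> p q \<Longrightarrow> fscale c \<omega> \<in> pq_forms \<theta> p q"
  unfolding fscale_def by (rule pq_forms_fmult[OF _ smooth_functions_const])

lemma delbar_linear:
  assumes "\<omega> \<in> pq_forms \<theta> p q" "\<eta> \<in> pq_forms \<theta> p q"
  shows "delbar \<theta> p q (\<omega> + \<eta>) = delbar \<theta> p q \<omega> + delbar \<theta> p q \<eta>"
    "delbar \<theta> p q (fscale c \<omega>) = fscale c (delbar \<theta> p q \<omega>)"
proof -
  have d: "diff_form \<omega>" "diff_form \<eta>" using assms diff_form_T pq_forms_T by blast+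
  show "delbar \<theta> p q (\<omega> + \<eta>) = delbar \<theta> p q \<omega> + delbar \<theta> p q \<eta>"
    using assms d by (simp add: delbar_eq pq_forms_add ext_deriv_add comp_add)
  have "ext_deriv (fscale c \<omega>) = fscale c (ext_deriv \<omega>)"
    using d by (simp add: fscale_def ext_deriv_fmult total_diff_const wedge_zero_left)
  then show "delbar \<theta> p q (fscale c \<omega>) = fscale c (delbar \<theta> p q \<omega>)"
    using assms by (simp add: delbar_eq pq_forms_fscale) (simp add: fscale_def comp_fmult)
qed

end


section \<open>Periods of (2,1)-forms\<close>

lemma mean_sum:
  "(\<And>i. i \<in> I \<Longrightarrow> continuous_on UNIV (f i)) \<Longrightarrow> mean (\<lambda>z. \<Sum>i\<in>I. f i z) = (\<Sum>i\<in>I. mean (f i))"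
proof (induction I rule: infinite_finite_induct)
  case (insert i I)
  then have "continuous_on UNIV (\<lambda>z. \<Sum>i\<in>I. f i z)" by (intro continuous_on_sum) auto
  with insert show ?case by (simp add: mean_add)
qed (simp_all add: mean_const)

text \<open>The leading monomials of \<open>Gamma1\<close> to \<open>Gamma4\<close> in this order;
  index 2 stands for gamma_t.\<close>

definition period_index :: "4 \<Rightarrow> nat list" where
  "period_index i = (if i = 1 then [0, 2, 3] else if i = 2 then [0, 2, 4] else if i = 3 then [1, 2, 3] else [1, 2, 4])"

lemma period_index_props:
  "sorted (period_index i)" "distinct (period_index i)" "set (period_index i) \<subseteq> {..<6}"
  "length (period_index i) = 3" "2 \<in> set (period_index i)"
  by (simp_all add: period_index_def)

lemma period_index_klist: "\<exists>I J. (I, J) \<in> pq_index 2 1 \<and> period_index i = klist I J"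
proof -
  have "({0, 2}, {0}) \<in> pq_index 2 1" "({0, 2}, {1}) \<in> pq_index 2 1"
    "({1, 2}, {0}) \<in> pq_index 2 1" "({1, 2}, {1}) \<in> pq_index 2 1"
    by (auto simp: pq_index_def)
  moreover have "klist {0, 2} {0} = [0, 2, 3]" "klist {0, 2} {1} = [0, 2, 4]"
    "klist {1, 2} {0} = [1, 2, 3]" "klist {1, 2} {1} = [1, 2, 4]"
    by (simp_all add: klist_def nths_Cons)
  ultimately show ?thesis unfolding period_index_def by metis
qed

context heis_coframe
begin

declare w_simps [simp del]

lemma struc_zero: "struc i 2 b = 0" "struc i 5 b = 0" "struc i a 2 = 0" "struc i a 5 = 0"
  by (rule struc_block; simp)+

lemma closed_forms_subspace: "form_subspace (closed_forms \<theta> p q)"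
  unfolding form_subspace_def closed_forms_def
  using comp_zero[of p "Suc q"]
  by (auto simp: pq_forms_zero delbar_eq(1)[OF pq_forms_zero] ext_deriv_zero pq_forms_add pq_forms_fscale
      delbar_linear) (simp add: fun_eq_iff form_apply fscale_apply)

lemma exact_forms_subspace: "form_subspace (exact_forms \<theta> p q)"
proof (cases q)
  case 0
  then show ?thesis by (simp add: exact_forms_def form_subspace_def fun_eq_iff form_apply fscale_apply)
next
  case (Suc r)
  have "0 = delbar \<theta> p r 0" by (simp add: delbar_eq(1)[OF pq_forms_zero] ext_deriv_zero comp_zero)
  moreover have "delbar \<theta> p r \<omega> + delbar \<theta> p r \<eta> = delbar \<theta> p r (\<omega> + \<eta>)"
    "fscale c (delbar \<theta> p r \<omega>) = delbar \<theta> p r (fscale c \<omega>)"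
    if "\<omega> \<in> pq_forms \<theta> p r" "\<eta> \<in> pq_forms \<theta> p r" for \<omega> \<eta> c
    by (simp_all add: delbar_linear[OF that])
  ultimately show ?thesis
    unfolding form_subspace_def exact_forms_def Suc
    by (auto simp: pq_forms_zero pq_forms_add pq_forms_fscale)
qed

lemma dolbeault_subspaces: "dolbeault_subspaces \<theta> p q"
  by unfold_locales (rule closed_forms_subspace exact_forms_subspace)+

lemma exact_forms_pq: "exact_forms \<theta> p q \<subseteq> pq_forms \<theta> p q"
  by (cases q) (auto simp: exact_forms_def pq_forms_zero delbar_eq(2))

text \<open>Sorting contributes a sign that is the same at all points, and a sorted monomial
  contracts to 0 or 1.\<close>

lemma ex_w_const:
  assumes "sorted ks" "distinct ks" "set ks \<subseteq> {..<6}" "set js \<subseteq> {..<6}" "length ks = length js"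
  shows "\<exists>c. \<forall>z. ex ks (w js) z = c"
proof (cases "distinct js")
  case False
  then show ?thesis by (simp add: w_not_distinct ex_zero)
next
  case True
  obtain s where s: "w js = fmult (\<lambda>_. s) (w (sort js))" using w_sort by blast
  show ?thesis
    unfolding s ex_fmult using assms True ex_w_sorted[of ks "sort js"] by (intro exI allI) auto
qed

lemma ex_smooth:
  assumes ks: "sorted ks" "distinct ks" "set ks \<subseteq> {..<6}"
  shows "\<omega> \<in> T (length ks) \<Longrightarrow> ex ks \<omega> \<in> smooth_functions"
proof (induction rule: T.induct)
  case T_zero
  have "ex ks 0 = (\<lambda>z. 0)" by (intro ext ex_zero)
  then show ?case by (simp add: smooth_functions_const)
next
  case (T_step f js \<omega>)
  obtain c where c: "\<And>z. ex ks (w js) z = c" using ex_w_const[OF ks T_step(2)] T_step(3) by metis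
  have "ex ks (fmult f (w js) + \<omega>) = (\<lambda>z. f z * c + ex ks \<omega> z)"
    by (intro ext) (simp add: ex_add ex_fmult c)
  then show ?case using T_step by (simp add: smooth_functions_add smooth_functions_mult smooth_functions_const)
qed

definition period :: "form \<Rightarrow> complex^4" where
  "period \<omega> = (\<chi> i. mean (ex (period_index i) \<omega>))"

lemma ex_period_smooth: "\<omega> \<in> T 3 \<Longrightarrow> ex (period_index i) \<omega> \<in> smooth_functions"
  using ex_smooth[OF period_index_props(1-3)] by (simp add: period_index_props)

lemma period_add: "\<omega> \<in> T 3 \<Longrightarrow> \<eta> \<in> T 3 \<Longrightarrow> period (\<omega> + \<eta>) = period \<omega> + period \<eta>"
proof -
  assume T: "\<omega> \<in> T 3" "\<eta> \<in> T 3"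
  have "ex ks (\<omega> + \<eta>) = (\<lambda>z. ex ks \<omega> z + ex ks \<eta> z)" for ks by (intro ext ex_add)
  then show ?thesis
    using T by (simp add: period_def vec_eq_iff mean_add smooth_functionsD(3)[OF ex_period_smooth])
qed

section \<open>Derivatives of invariant monomials and vanishing of periods on exact forms\<close>

lemma ext_deriv_w_Cons:
  "ext_deriv (w (i # js)) = - (\<Theta> i \<and>\<^sub>f ext_deriv (w js)) + (\<Sum>a<6. \<Sum>b<6. fmult (\<lambda>_. struc i a b) (w (a # b # js)))"
  unfolding w_simps by (rule ext_deriv_\<Theta>_wedge[OF diff_form_w])

lemma ext_deriv_w_flat: "set js \<subseteq> {0, 1, 3, 4} \<Longrightarrow> ext_deriv (w js) = 0"
proof (induction js)
  case Nil
  show ?case by (simp add: ext_deriv_form_one w_simps)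
next
  case (Cons j js)
  then have "struc j a b = 0" for a b by (intro struc_block(3)) auto
  then show ?case using Cons unfolding ext_deriv_w_Cons by (simp add: wedge_zero_right fmult_zero_left)
qed

lemma ext_deriv_w_flat_Cons:
  assumes "set js \<subseteq> {0, 1, 3, 4}"
  shows "ext_deriv (w (i # js)) = (\<Sum>a<6. \<Sum>b<6. fmult (\<lambda>_. struc i a b) (w (a # b # js)))"
  unfolding ext_deriv_w_Cons ext_deriv_w_flat[OF assms] by (simp add: wedge_zero_right)

lemma ext_deriv_w_flat_middle:
  assumes "set js \<subseteq> {0, 1, 3, 4}" "k \<in> {0, 1, 3, 4}"
  shows "ext_deriv (w (k # i # js)) = - (\<Sum>a<6. \<Sum>b<6. fmult (\<lambda>_. struc i a b) (w (k # a # b # js)))"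
proof -
  have "struc k a b = 0" for a b using assms by (intro struc_block(3))
  then show ?thesis
    unfolding ext_deriv_w_Cons[of k] ext_deriv_w_flat_Cons[OF assms(1)]
    by (simp add: fmult_zero_left wedge_sum_right wedge_fmult_right w_simps(2)[symmetric])
qed

lemma mean_D:
  assumes "f \<in> smooth_functions"
  shows "mean (D j f) = 0"
proof -
  have "continuous_on UNIV (\<lambda>z. N k j * frame_deriv k f z)" for k
    by (intro continuous_on_mult continuous_on_const smooth_functionsD(3) frame_deriv_smooth assms)
  then show ?thesis by (simp add: D_def mean_sum mean_cmult mean_frame_deriv assms)
qed

text \<open>Two increasing indices below 3 start with 0 or 1, so each (2,0)-monomial has a closed
  first factor.\<close>

lemma pq_index_2_0:
  assumes "x \<in> pq_index 2 0"
  obtains a b where "klist (fst x) (snd x) = [a, b]" "a \<in> {0, 1}" "b < 6"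
proof -
  have "length (klist (fst x) (snd x)) = 2" using length_klist[of "fst x" "snd x" 2 0] assms by simp
  then obtain a b where ab: "klist (fst x) (snd x) = [a, b]"
    by (auto simp: length_Suc_conv numeral_2_eq_2)
  have "snd x \<subseteq> {..<3}" "card (snd x) = 0" using assms by (auto simp: pq_index_def)
  then have "snd x = {}" using finite_subset[OF _ finite_lessThan] by auto
  then have "set (klist (fst x) (snd x)) \<subseteq> {0, 1, 2}"
    using set_nths_subset[of "[0, 1, 2::nat]" "fst x"] by (simp add: klist_def)
  then have "set [a, b] \<subseteq> {0, 1, 2}" by (simp only: ab)
  moreover have "a \<le> b" using klist_props(1)[of "fst x" "snd x"] by (simp add: ab)
  moreover have "a \<noteq> b" using klist_props(2)[of "fst x" "snd x"] by (simp add: ab)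
  ultimately show ?thesis by (intro that[OF ab]) auto
qed

text \<open>The closed factor \<open>\<Theta> a\<close> stays, and \<open>\<Theta> b\<close> is
  replaced by products of forms other than \<open>\<Theta> 2\<close> and \<open>\<Theta> 5\<close>.
  So no term contains index 2, whereas every period index does.\<close>

lemma ex_ext_deriv_w_2:
  assumes "a \<in> {0, 1}"
  shows "ex (period_index i) (ext_deriv (w [a, b])) z = 0"
proof -
  let ?k = "period_index i"
  have "ex ?k (w [a, c, d]) z = 0" if "c < 6" "d < 6" "c \<noteq> 2" "d \<noteq> 2" for c d
  proof (cases "distinct [a, c, d]")
    case True
    show ?thesis
    proof (rule ccontr)
      assume *: "ex ?k (w [a, c, d]) z \<noteq> 0"
      have "set ?k = set [a, c, d]"
      proof (rule ex_w_nonzero[OF period_index_props(3) _ True _ *])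
        show "set [a, c, d] \<subseteq> {..<6}" using assms that by auto
        show "length ?k = length [a, c, d]" by (simp add: period_index_props(4))
      qed
      then have "2 \<in> set [a, c, d]" using period_index_props(5)[of i] by simp
      then show False using assms that by auto
    qed
  next
    case False
    then show ?thesis by (simp add: w_not_distinct[OF False] ex_zero)
  qed
  then have z: "struc b c d * ex ?k (w [a, c, d]) z = 0" if "c < 6" "d < 6" for c d
    using that by (cases "c = 2 \<or> d = 2") (auto simp: struc_zero)
  have "set [] \<subseteq> {0, 1, 3, 4::nat}" "a \<in> {0, 1, 3, 4}" using assms by auto
  from ext_deriv_w_flat_middle[OF this, of b]
  have "ext_deriv (w [a, b]) = fmult (\<lambda>_. -1) (\<Sum>c<6. \<Sum>d<6. fmult (\<lambda>_. struc b c d) (w [a, c, d]))"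
    by (simp add: fun_eq_iff form_apply)
  then have "ex ?k (ext_deriv (w [a, b])) z = - (\<Sum>c<6. \<Sum>d<6. struc b c d * ex ?k (w [a, c, d]) z)"
    by (simp add: ex_fmult ex_sum)
  also have "(\<Sum>c<6. \<Sum>d<6. struc b c d * ex ?k (w [a, c, d]) z) = 0"
    using z by (intro sum.neutral ballI) simp
  finally show ?thesis by simp
qed

lemma period_exact:
  assumes "\<omega> \<in> exact_forms \<theta> 2 1"
  shows "period \<omega> = 0"
proof -
  obtain \<eta> where \<eta>: "\<eta> \<in> pq_forms \<theta> 2 0" "\<omega> = delbar \<theta> 2 0 \<eta>"
    using assms by (auto simp: exact_forms_def)
  obtain f where f': "\<eta> = (\<Sum>(I, J)\<in>pq_index 2 0. fmult (f I J) (w (klist I J)))" "\<forall>I J. f I J \<in> smooth_functions"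
    using \<eta>(1) unfolding pq_forms_eq by blast
  define g u where "g x = f (fst x) (snd x)" and "u x = klist (fst x) (snd x)" for x
  have g: "g x \<in> smooth_functions" for x using f'(2) by (simp add: g_def)
  have f: "\<eta> = (\<Sum>x\<in>pq_index 2 0. fmult (g x) (w (u x)))"
    by (simp add: f' g_def u_def split_beta)
  have "mean (ex (period_index i) \<omega>) = 0" for i
  proof -
    let ?k = "period_index i"
    obtain I J where IJ: "(I, J) \<in> pq_index 2 1" "?k = klist I J" using period_index_klist by blast
    have flat: "ex ?k (ext_deriv (w (u x))) z = 0" if "x \<in> pq_index 2 0" for x z
      by (rule pq_index_2_0[OF that]) (simp only: u_def ex_ext_deriv_w_2)
    \<comment> \<open>A period index is of type (2,1), so its coefficient in d\<eta> is already that
      of the (2,1)-part.\<close>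
    have "ex ?k \<omega> z = ex ?k (ext_deriv \<eta>) z" for z
      using ex_comp[OF IJ(1)] delbar_eq(1)[OF \<eta>(1)] by (simp add: \<eta>(2) IJ(2))
    moreover have "ext_deriv \<eta> = (\<Sum>x\<in>pq_index 2 0. (\<Sum>j<6. fmult (D j (g x)) (w (j # u x)))
        + fmult (g x) (ext_deriv (w (u x))))"
      unfolding f by (subst ext_deriv_sum)
        (simp_all only: diff_form_fmult diff_form_w smooth_functionsD(4)[OF g] ext_deriv_monomial[OF g])
    ultimately have e: "ex ?k \<omega> z = (\<Sum>x\<in>pq_index 2 0. \<Sum>j<6. D j (g x) z * ex ?k (w (j # u x)) z)" for z
      by (simp add: ex_sum ex_add ex_fmult flat)
    \<comment> \<open>Only the derivatives \<open>D j (g x)\<close> remain, with factors that do not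
      depend on the point; these come out of the mean, and \<open>mean_D\<close> finishes.\<close>
    have "\<exists>c. \<forall>z. ex ?k (w (j # u x)) z = c" if "x \<in> pq_index 2 0" "j < 6" for x j
    proof (rule ex_w_const[OF period_index_props(1-3)])
      show "set (j # u x) \<subseteq> {..<6}" using that klist_props(3)[of "fst x" "snd x"] by (simp add: u_def)
      show "length ?k = length (j # u x)"
        using that length_klist[of "fst x" "snd x" 2 0] by (simp add: period_index_props(4) u_def)
    qed
    then have "\<forall>x\<in>pq_index 2 0. \<forall>j<6. \<exists>c. \<forall>z. ex ?k (w (j # u x)) z = c" by blast
    then obtain c where c: "\<And>x j z. x \<in> pq_index 2 0 \<Longrightarrow> j < 6 \<Longrightarrow> ex ?k (w (j # u x)) z = c x j"
      by metis
    have "ex ?k \<omega> = (\<lambda>z. \<Sum>x\<in>pq_index 2 0. \<Sum>j<6. c x j * D j (g x) z)"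
      by (intro ext, subst e, intro sum.cong refl) (simp add: c)
    moreover have "continuous_on UNIV (\<lambda>z. c x j * D j (g x) z)" for x j
      by (intro continuous_on_mult continuous_on_const smooth_functionsD(3) D_smooth g)
    ultimately show ?thesis
      by (simp add: mean_sum continuous_on_sum mean_cmult mean_D g)
  qed
  then show ?thesis by (simp add: period_def vec_eq_iff)
qed

text \<open>\<open>s 0 1\<close> is \<open>\<sigma>\<^sub>1\<^sub>2\<close>, and \<open>s 0 3\<close>, \<open>s 0 4\<close>, \<open>s 1 3\<close>, \<open>s 1 4\<close> are the coefficients of the
  \<open>(1,1)\<close>-part of \<open>d\<gamma>\<^sub>t\<close>.\<close>

definition s :: "nat \<Rightarrow> nat \<Rightarrow> complex" where
  "s a b = struc 2 a b - struc 2 b a"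

text \<open>Conjugation commutes with d: \<open>\<Theta> 5\<close> is the conjugate of
  \<open>\<Theta> 2\<close>, and the pair 3, 4 is the conjugate of the pair 0, 1.\<close>

lemma s_conj: "struc 5 3 4 - struc 5 4 3 = cnj (s 0 1)"
  using M_conj[of 2 2] N_conj[of 0 0] N_conj[of 0 1] N_conj[of 1 0] N_conj[of 1 1]
  by (simp add: s_def struc_def algebra_simps)

lemma w_swap_tail:
  "w (j # i # js) = fmult (\<lambda>_. -1) (w (i # j # js))" 
  "w (k # j # i # js) = fmult (\<lambda>_. -1) (w (k # i # j # js))"
  "w (k # l # j # i # js) = fmult (\<lambda>_. -1) (w (k # l # i # j # js))"
proof -
  show *: "w (j # i # js) = fmult (\<lambda>_. -1) (w (i # j # js))" for i j js
    unfolding w_swap[of j i js] by (simp add: fun_eq_iff form_apply)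
  show 2: "w (k # j # i # js) = fmult (\<lambda>_. -1) (w (k # i # j # js))" for k i j js
    unfolding w_simps(2)[of k "j # i # js"] w_simps(2)[of k "i # j # js"] *[of j i js] wedge_fmult_right ..
  show "w (k # l # j # i # js) = fmult (\<lambda>_. -1) (w (k # l # i # j # js))"
    unfolding w_simps(2)[of k "l # j # i # js"] w_simps(2)[of k "l # i # j # js"] 2[of l j i js] wedge_fmult_right ..
qed

text \<open>The outer factors k and m are closed, so d falls on gamma_t. Of d gamma_t only the part
  in the two indices c, d complementary to k, m in {0, 1, 3, 4} survives the wedge; the signs come
  from sorting.\<close>

lemma ext_deriv_w_23:
  "ext_deriv (w [0, 2, 3]) = fscale (s 1 4) (w [0, 1, 3, 4])"
  "ext_deriv (w [0, 2, 4]) = fscale (- s 1 3) (w [0, 1, 3, 4])"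
  "ext_deriv (w [1, 2, 3]) = fscale (- s 0 4) (w [0, 1, 3, 4])"
  "ext_deriv (w [1, 2, 4]) = fscale (s 0 3) (w [0, 1, 3, 4])"
proof -
  have sum_eq: "(\<Sum>a<6. \<Sum>b<6. fmult (\<lambda>_. struc 2 a b) (w [k, a, b, m]))
      = fmult (\<lambda>_. struc 2 c d) (w [k, c, d, m]) + fmult (\<lambda>_. struc 2 d c) (w [k, d, c, m])"
    if "(k, m, c, d) \<in> {(0, 3, 1, 4), (0, 4, 1, 3), (1, 3, 0, 4), (1, 4, 0, 3)}" for k m c d
    using that
    by (elim insertE emptyE; simp add: sum_lessThan_6 struc_zero fmult_zero_left fmult_zero w_not_distinct
        add.commute)
  have e: "ext_deriv (w [k, 2, m]) = fscale (- s c d) (w [k, c, d, m])"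
    if "(k, m, c, d) \<in> {(0, 3, 1, 4), (0, 4, 1, 3), (1, 3, 0, 4), (1, 4, 0, 3)}" for k m c d
  proof -
    have "set [m] \<subseteq> {0, 1, 3, 4}" "k \<in> {0, 1, 3, 4}" using that by auto
    then have "ext_deriv (w [k, 2, m])
        = - (fmult (\<lambda>_. struc 2 c d) (w [k, c, d, m]) + fmult (\<lambda>_. struc 2 d c) (w [k, d, c, m]))"
      by (simp only: ext_deriv_w_flat_middle sum_eq[OF that])
    then show ?thesis
      unfolding w_swap_tail(2)[of k d c]
      by (simp add: fun_eq_iff form_apply fscale_apply s_def algebra_simps)
  qed
  have f: "fscale a (fmult (\<lambda>_. -1) \<eta>) = fscale (- a) \<eta>" for a \<eta>
    by (simp add: fun_eq_iff fmult_apply fscale_apply)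
  show "ext_deriv (w [0, 2, 3]) = fscale (s 1 4) (w [0, 1, 3, 4])"
    using e[of 0 3 1 4] unfolding w_swap_tail(3)[of 0 1 4 3 "[]"] f by simp
  show "ext_deriv (w [0, 2, 4]) = fscale (- s 1 3) (w [0, 1, 3, 4])"
    using e[of 0 4 1 3] by simp
  show "ext_deriv (w [1, 2, 3]) = fscale (- s 0 4) (w [0, 1, 3, 4])"
    using e[of 1 3 0 4]
    unfolding w_swap_tail(1)[of 1 0 "[4, 3]"] w_swap_tail(3)[of 0 1 4 3 "[]"] f fmult_fmult
    by (simp add: fmult_one_left)
  show "ext_deriv (w [1, 2, 4]) = fscale (s 0 3) (w [0, 1, 3, 4])"
    using e[of 1 4 0 3] unfolding w_swap_tail(1)[of 1 0 "[3, 4]"] f by simp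
qed

lemma ext_deriv_w_015: "ext_deriv (w [0, 1, 5]) = fscale (cnj (s 0 1)) (w [0, 1, 3, 4])"
proof -
  have step: "ext_deriv (w (k # js)) = - (\<Theta> k \<and>\<^sub>f ext_deriv (w js))" if "k \<in> {0, 1}" for k js
  proof -
    have "struc k a b = 0" for a b using that by (intro struc_block(3)) auto
    then show ?thesis unfolding ext_deriv_w_Cons by (simp add: fmult_zero_left)
  qed
  have "ext_deriv (w [5]) = (\<Sum>a<6. \<Sum>b<6. fmult (\<lambda>_. struc 5 a b) (w [a, b]))"
    by (rule ext_deriv_w_flat_Cons) simp
  then have "ext_deriv (w [0, 1, 5]) = (\<Sum>a<6. \<Sum>b<6. fmult (\<lambda>_. struc 5 a b) (\<Theta> 0 \<and>\<^sub>f \<Theta> 1 \<and>\<^sub>f w [a, b]))"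
    using step[of 0 "[1, 5]"] step[of 1 "[5]"]
    by (simp only: insert_iff simp_thms wedge_minus_right minus_minus wedge_sum_right wedge_fmult_right)
  then have "ext_deriv (w [0, 1, 5]) = (\<Sum>a<6. \<Sum>b<6. fmult (\<lambda>_. struc 5 a b) (w [0, 1, a, b]))"
    by (simp only: w_simps)
  also have "\<dots> = fmult (\<lambda>_. struc 5 3 4) (w [0, 1, 3, 4]) + fmult (\<lambda>_. struc 5 4 3) (w [0, 1, 4, 3])"
    by (simp add: sum_lessThan_6 struc_zero fmult_zero_left fmult_zero w_not_distinct)
  also have "\<dots> = fscale (struc 5 3 4 - struc 5 4 3) (w [0, 1, 3, 4])"
    using w_swap_tail(3)[of 0 1 4 3 "[]"]
    by (simp add: fun_eq_iff form_apply fscale_apply algebra_simps)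
  finally show ?thesis by (simp only: s_conj)
qed

end


section \<open>Coordinates on the span of the Gamma classes\<close>

declare One_nat_def [simp del]

lemma period_index_inject: "period_index i = period_index j \<longleftrightarrow> i = j"
  using exhaust_4[of i] exhaust_4[of j] by (elim disjE) (simp_all add: period_index_def)

text \<open>The passage from \<open>\<Phi>\<close>-coordinates to \<open>K\<close>-coordinates is
  linear, and the columns of its matrix are the \<open>K\<close>-coordinates of the frame
  \<open>e\<close> that \<open>\<Phi>\<close> sends to the standard basis.\<close>

lemma linear_iso_change_of_basis:
  fixes \<Phi> :: "'v \<Rightarrow> complex^'n" and K :: "'v \<Rightarrow> complex^'m"
  assumes M: "Module.module complex_ring M" and \<Phi>: "linear_iso M \<Phi>" and K: "linear_iso M K"
    and e: "\<And>j. e j \<in> carrier M" "\<And>j. \<Phi> (e j) = axis j 1" and X: "X \<in> carrier M"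
  shows "K X = (\<chi> k j. K (e j) $ k) *v \<Phi> X"
proof -
  interpret Module.module complex_ring M by (rule M)
  define g where "g x = K (inv_into (carrier M) \<Phi> x)" for x
  have inj: "inj_on \<Phi> (carrier M)" and surj: "\<Phi> ` carrier M = UNIV"
    using \<Phi> by (auto simp: linear_iso_def bij_betw_def)
  have gK: "g (\<Phi> x) = K x" if "x \<in> carrier M" for x
    using inj that by (simp add: g_def)
  have "Vector_Spaces.linear (*s) (*s) g"
  proof (rule Vector_Spaces.linear_iff[THEN iffD2], intro conjI allI)
    show "vector_space ((*s) :: complex \<Rightarrow> complex^'n \<Rightarrow> _)" "vector_space ((*s) :: complex \<Rightarrow> complex^'m \<Rightarrow> _)"
      by unfold_locales
    fix c x y
    obtain u v where u: "x = \<Phi> u" "u \<in> carrier M" "y = \<Phi> v" "v \<in> carrier M"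
      using surj by (metis UNIV_I imageE)
    have "x + y = \<Phi> (u \<oplus>\<^bsub>M\<^esub> v)" "c *s x = \<Phi> (c \<odot>\<^bsub>M\<^esub> u)"
      using \<Phi> u by (auto simp: linear_iso_def)
    moreover have "u \<oplus>\<^bsub>M\<^esub> v \<in> carrier M" "c \<odot>\<^bsub>M\<^esub> u \<in> carrier M"
      using u by (auto simp: complex_ring_def intro: smult_closed[unfolded complex_ring_def, simplified])
    ultimately show "g (x + y) = g x + g y" "g (c *s x) = c *s g x"
      using K u by (auto simp: gK linear_iso_def)
  qed
  from matrix_works[OF this, of "\<Phi> X"]
  have "K X = matrix g *v \<Phi> X" by (simp add: gK X)
  moreover have "matrix g = (\<chi> k j. K (e j) $ k)"
    using gK[OF e(1)] by (simp add: matrix_def e(2))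
  ultimately show ?thesis by simp
qed

lemma linear_iso_change_of_basis_det:
  fixes \<Phi> K :: "'v \<Rightarrow> complex^'n"
  assumes M: "Module.module complex_ring M" and \<Phi>: "linear_iso M \<Phi>" and K: "linear_iso M K"
    and e: "\<And>j. e j \<in> carrier M" "\<And>j. \<Phi> (e j) = axis j 1"
  shows "det (\<chi> k j. K (e j) $ k) \<noteq> 0"
proof -
  let ?A = "\<chi> k j. K (e j) $ k"
  have "inj ((*v) ?A)"
  proof (rule injI)
    fix x y assume xy: "?A *v x = ?A *v y"
    have "\<Phi> ` carrier M = UNIV" using \<Phi> by (auto simp: linear_iso_def bij_betw_def)
    then obtain u v where u: "x = \<Phi> u" "u \<in> carrier M" "y = \<Phi> v" "v \<in> carrier M"
      by (metis UNIV_I imageE)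
    have "K u = K v"
      using linear_iso_change_of_basis[OF M \<Phi> K e u(2)] linear_iso_change_of_basis[OF M \<Phi> K e u(4)] xy
      by (simp add: u)
    then have "u = v" using K u by (auto simp: linear_iso_def bij_betw_def dest: inj_onD)
    then show "x = y" by (simp add: u)
  qed
  then obtain B where "B ** ?A = mat 1" by (metis matrix_left_invertible_injective)
  then have "det B * det ?A = 1" by (metis det_mul det_I)
  then show ?thesis by auto
qed

context heis_coframe
begin

text \<open>The quotient that makes the two multiples of \<open>w [0, 1, 3, 4]\<close> cancel in
  \<open>ext_deriv_gam\<close>, namely the coefficients of the corrections in \<open>Gamma1\<close>
  to \<open>Gamma4\<close> with their signs.\<close>

definition gam_coef :: "4 \<Rightarrow> complex" where
  "gam_coef i = (if i = 1 then - s 1 4 else if i = 2 then s 1 3 else if i = 3 then s 0 4 else - s 0 3) / cnj (s 0 1)"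

definition gam :: "4 \<Rightarrow> form" where
  "gam i = w (period_index i) + fscale (gam_coef i) (w [0, 1, 5])"

lemma w_pq: 
  "w (period_index i) \<in> pq_forms \<theta> 2 1" "w [0, 1, 5] \<in> pq_forms \<theta> 2 1"
  "w [2] \<in> pq_forms \<theta> 1 0" "w [0, 1] \<in> pq_forms \<theta> 2 0" "w [3, 4] \<in> pq_forms \<theta> 0 2"
  "a \<in> {0, 1} \<Longrightarrow> b \<in> {3, 4} \<Longrightarrow> w [a, b] \<in> pq_forms \<theta> 1 1"
proof -
  show "w (period_index i) \<in> pq_forms \<theta> 2 1"
    using period_index_klist[of i] pq_forms_basis by metis
  have k: "w ks \<in> pq_forms \<theta> p q" if "ks = klist I J" "I \<subseteq> {..<3}" "card I = p" "J \<subseteq> {..<3}" "card J = q"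
    for ks I J p q
    using pq_forms_basis[of I J p q] that by (simp add: pq_index_def)
  show "w [0, 1, 5] \<in> pq_forms \<theta> 2 1" by (rule k[of _ "{0, 1}" "{2}"]) (auto simp: klist_def nths_Cons)
  show "w [2] \<in> pq_forms \<theta> 1 0" by (rule k[of _ "{2}" "{}"]) (auto simp: klist_def nths_Cons)
  show "w [0, 1] \<in> pq_forms \<theta> 2 0" by (rule k[of _ "{0, 1}" "{}"]) (auto simp: klist_def nths_Cons)
  show "w [3, 4] \<in> pq_forms \<theta> 0 2" by (rule k[of _ "{}" "{0, 1}"]) (auto simp: klist_def nths_Cons)
  show "w [a, b] \<in> pq_forms \<theta> 1 1" if "a \<in> {0, 1}" "b \<in> {3, 4}"
  proof -
    have "w [0, 3] \<in> pq_forms \<theta> 1 1" by (rule k[of _ "{0}" "{0}"]) (auto simp: klist_def nths_Cons)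
    moreover have "w [0, 4] \<in> pq_forms \<theta> 1 1" by (rule k[of _ "{0}" "{1}"]) (auto simp: klist_def nths_Cons)
    moreover have "w [1, 3] \<in> pq_forms \<theta> 1 1" by (rule k[of _ "{1}" "{0}"]) (auto simp: klist_def nths_Cons)
    moreover have "w [1, 4] \<in> pq_forms \<theta> 1 1" by (rule k[of _ "{1}" "{1}"]) (auto simp: klist_def nths_Cons)
    ultimately show ?thesis using that by auto
  qed
qed

lemma ext_deriv_\<Theta>2:
  "ext_deriv (w [2]) = fscale (s 0 1) (w [0, 1]) + fscale (s 0 3) (w [0, 3]) + fscale (s 0 4) (w [0, 4])
     + fscale (s 1 3) (w [1, 3]) + fscale (s 1 4) (w [1, 4]) + fscale (s 3 4) (w [3, 4])"
proof -
  have "ext_deriv (w [2]) = (\<Sum>a<6. \<Sum>b<6. fmult (\<lambda>_. struc 2 a b) (w [a, b]))"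
    by (rule ext_deriv_w_flat_Cons) simp
  also have "\<dots> = fmult (\<lambda>_. struc 2 0 1) (w [0, 1]) + fmult (\<lambda>_. struc 2 1 0) (w [1, 0])
    + fmult (\<lambda>_. struc 2 0 3) (w [0, 3]) + fmult (\<lambda>_. struc 2 3 0) (w [3, 0])
    + fmult (\<lambda>_. struc 2 0 4) (w [0, 4]) + fmult (\<lambda>_. struc 2 4 0) (w [4, 0])
    + fmult (\<lambda>_. struc 2 1 3) (w [1, 3]) + fmult (\<lambda>_. struc 2 3 1) (w [3, 1])
    + fmult (\<lambda>_. struc 2 1 4) (w [1, 4]) + fmult (\<lambda>_. struc 2 4 1) (w [4, 1])
    + fmult (\<lambda>_. struc 2 3 4) (w [3, 4]) + fmult (\<lambda>_. struc 2 4 3) (w [4, 3])"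
    by (simp add: sum_lessThan_6 struc_zero fmult_zero_left fmult_zero w_not_distinct add_ac)
  finally show ?thesis
    unfolding w_swap_tail(1)[of 1 0 "[]"] w_swap_tail(1)[of 3 0 "[]"] w_swap_tail(1)[of 3 1 "[]"]
      w_swap_tail(1)[of 4 0 "[]"] w_swap_tail(1)[of 4 1 "[]"] w_swap_tail(1)[of 4 3 "[]"]
    by (simp add: fun_eq_iff form_apply fscale_apply s_def algebra_simps)
qed

lemma comp_fscale: "comp p q (fscale c \<omega>) = fscale c (comp p q \<omega>)"
  by (simp add: fscale_def comp_fmult)

lemma comp_w_2:
  "comp 2 0 (w [0, 1]) = w [0, 1]" "comp 2 0 (w [3, 4]) = 0"
  "comp 1 1 (w [0, 1]) = 0" "comp 1 1 (w [3, 4]) = 0"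
  "a \<in> {0, 1} \<Longrightarrow> b \<in> {3, 4} \<Longrightarrow> comp 2 0 (w [a, b]) = 0"
  "a \<in> {0, 1} \<Longrightarrow> b \<in> {3, 4} \<Longrightarrow> comp 1 1 (w [a, b]) = w [a, b]"
  using comp_pq[OF w_pq(4), of 2 0] comp_pq[OF w_pq(4), of 1 1] comp_pq[OF w_pq(5), of 2 0]
    comp_pq[OF w_pq(5), of 1 1] comp_pq[OF w_pq(6), of a b 2 0] comp_pq[OF w_pq(6), of a b 1 1]
  by simp_all

lemma fscale_zero: "fscale c 0 = 0"
  by (simp add: fscale_def fmult_zero)

lemma del_\<Theta>2: "del \<theta> 1 0 (w [2]) = fscale (s 0 1) (w [0, 1])"
  unfolding del_eq[OF w_pq(3)] ext_deriv_\<Theta>2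
  by (simp add: comp_add comp_fscale comp_w_2 fscale_zero)

lemma delbar_\<Theta>2: "delbar \<theta> 1 0 (w [2]) = fscale (s 0 3) (w [0, 3]) + fscale (s 0 4) (w [0, 4])
     + fscale (s 1 3) (w [1, 3]) + fscale (s 1 4) (w [1, 4])"
proof -
  have "comp 1 (Suc 0) = comp 1 1" by (simp add: One_nat_def)
  then show ?thesis
    unfolding delbar_eq(1)[OF w_pq(3)] ext_deriv_\<Theta>2
    by (simp add: comp_add comp_fscale comp_w_2 fscale_zero)
qed

text \<open>Evaluates the definite description behind \<open>sigma\<close>; contraction in the
  directions 0, 1 recovers the scalar.\<close>

lemma the_del_\<Theta>2: "(THE c. del \<theta> 1 0 (w [2]) = fscale c (w [0, 1])) = s 0 1"
proof (rule the_equality)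
  fix c assume "del \<theta> 1 0 (w [2]) = fscale c (w [0, 1])"
  then have "ex [0, 1] (fscale (s 0 1) (w [0, 1])) 0 = ex [0, 1] (fscale c (w [0, 1])) 0"
    by (simp only: del_\<Theta>2)
  moreover have "ex [0, 1] (w [0, 1]) 0 = 1" by (rule ex_w_self) auto
  ultimately show "c = s 0 1" by (simp add: fscale_def ex_fmult del: ex.simps)
qed (rule del_\<Theta>2)

lemma the_delbar_\<Theta>2:
  "(THE c :: complex^2^2. delbar \<theta> 1 0 (w [2]) = fscale (c $ 1 $ 1) (w [0, 3]) + fscale (c $ 1 $ 2) (w [0, 4])
     + fscale (c $ 2 $ 1) (w [1, 3]) + fscale (c $ 2 $ 2) (w [1, 4]))
   = vector [vector [s 0 3, s 0 4], vector [s 1 3, s 1 4]]" (is "(THE c. ?P c) = ?c")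
proof (rule the_equality)
  show "?P ?c" unfolding delbar_\<Theta>2 by (simp only: vector_2)
  fix c assume c: "?P c"
  have e: "ex ks (w ls) 0 = (if ks = ls then 1 else 0)"
    if "ks \<in> {[0, 3], [0, 4], [1, 3], [1, 4]}" "ls \<in> {[0, 3], [0, 4], [1, 3], [1, 4]}" for ks ls
    by (rule ex_w_sorted) (use that in auto)
  have "ex ks (fscale (s 0 3) (w [0, 3]) + fscale (s 0 4) (w [0, 4])
     + fscale (s 1 3) (w [1, 3]) + fscale (s 1 4) (w [1, 4])) 0
    = ex ks (fscale (c $ 1 $ 1) (w [0, 3]) + fscale (c $ 1 $ 2) (w [0, 4])
     + fscale (c $ 2 $ 1) (w [1, 3]) + fscale (c $ 2 $ 2) (w [1, 4])) 0" for ks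
    using c by (simp only: delbar_\<Theta>2)
  from this[of "[0, 3]"] this[of "[0, 4]"] this[of "[1, 3]"] this[of "[1, 4]"]
  show "c = ?c"
    unfolding fscale_def ex_add ex_fmult by (simp add: e vec_eq_iff forall_2 vector_2 del: ex.simps)
qed

lemma ext_deriv_gam:
  assumes "s 0 1 \<noteq> 0"
  shows "ext_deriv (gam i) = 0"
proof -
  have "ext_deriv (w (period_index i)) = fscale (- gam_coef i * cnj (s 0 1)) (w [0, 1, 3, 4])"
    using exhaust_4[of i] assms ext_deriv_w_23 by (elim disjE) (simp_all add: period_index_def gam_coef_def)
  moreover have "ext_deriv (gam i) = ext_deriv (w (period_index i)) + fscale (gam_coef i) (ext_deriv (w [0, 1, 5]))"
    unfolding gam_def fscale_def
    by (simp add: ext_deriv_add ext_deriv_fmult diff_form_fmult diff_form_w total_diff_const wedge_zero_left)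
  ultimately show ?thesis
    unfolding ext_deriv_w_015 by (simp add: fun_eq_iff form_apply fscale_apply)
qed

lemma gam_pq: "gam i \<in> pq_forms \<theta> 2 1"
  unfolding gam_def by (intro pq_forms_add pq_forms_fscale w_pq)

definition lin :: "complex^4 \<Rightarrow> form" where
  "lin c = (\<Sum>i\<in>UNIV. fscale (c $ i) (gam i))"

lemma pq_forms_sum: "(\<And>i. i \<in> I \<Longrightarrow> \<omega> i \<in> pq_forms \<theta> p q) \<Longrightarrow> (\<Sum>i\<in>I. \<omega> i) \<in> pq_forms \<theta> p q"
  by (induction I rule: infinite_finite_induct) (simp_all add: pq_forms_zero pq_forms_add)

lemma lin_pq: "lin c \<in> pq_forms \<theta> 2 1"
  unfolding lin_def by (intro pq_forms_sum pq_forms_fscale gam_pq)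

lemma diff_form_pq: "\<omega> \<in> pq_forms \<theta> p q \<Longrightarrow> diff_form \<omega>"
  using diff_form_T pq_forms_T by blast

lemma lin_closed:
  assumes "s 0 1 \<noteq> 0"
  shows "lin c \<in> closed_forms \<theta> 2 1"
proof -
  have "ext_deriv (lin c) = (\<Sum>i\<in>UNIV. ext_deriv (fscale (c $ i) (gam i)))"
    unfolding lin_def by (rule ext_deriv_sum) (rule diff_form_pq[OF pq_forms_fscale[OF gam_pq]])
  also have "\<dots> = 0"
    by (simp add: fscale_def ext_deriv_fmult diff_form_pq[OF gam_pq] total_diff_const wedge_zero_left
        ext_deriv_gam[OF assms] fmult_zero)
  finally show ?thesis
    using lin_pq[of c] delbar_eq(1)[OF lin_pq, of c] by (simp add: closed_forms_def comp_zero)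
qed

lemma lin_axis: "lin (axis i 1) = gam i"
proof -
  have "lin (axis i 1) = (\<Sum>j\<in>UNIV. if j = i then gam i else 0)"
    unfolding lin_def by (intro sum.cong refl) (auto simp: axis_def fscale_def fmult_one_left fmult_zero_left)
  then show ?thesis by simp
qed

lemma lin_add: "lin (c + d) = lin c + lin d" and lin_smult: "lin (a *s c) = fscale a (lin c)"
  by (simp_all add: lin_def fun_eq_iff form_apply fscale_apply algebra_simps sum.distrib sum_distrib_left)

lemma lin_subspace: "form_subspace (range lin)"
proof -
  have "lin 0 = 0" using lin_smult[of 0 0] by (simp add: fun_eq_iff fscale_apply form_apply)
  then show ?thesis
    unfolding form_subspace_def
    by (auto simp: lin_add[symmetric] lin_smult[symmetric] intro: range_eqI[of 0 lin 0])
qed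

text \<open>The correction term \<open>w [0, 1, 5]\<close> lacks index 2 and is therefore invisible
  to the periods.\<close>

lemma ex_gam: "ex (period_index j) (gam i) z = (if i = j then 1 else 0)"
proof -
  have "ex (period_index j) (w [0, 1, 5]) z = 0"
  proof (rule ccontr)
    assume "ex (period_index j) (w [0, 1, 5]) z \<noteq> 0"
    then have "set (period_index j) = set [0, 1, 5]"
      by (intro ex_w_nonzero[of _ _ z] period_index_props(3)) (auto simp: period_index_props(4))
    then show False using period_index_props(5)[of j] by auto
  qed
  moreover have "ex (period_index j) (w (period_index i)) z = (if i = j then 1 else 0)"
    by (subst ex_w_sorted) (auto simp: period_index_props period_index_inject)
  ultimately show ?thesis by (simp add: gam_def ex_add fscale_def ex_fmult)
qed

text \<open>The coefficients are constants and so equal their means. With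
  \<open>period_exact\<close> this makes the four classes linearly independent.\<close>

lemma period_lin: "period (lin c) = c"
proof -
  have "ex (period_index j) (lin c) = (\<lambda>z. c $ j)" for j
    by (intro ext) (simp add: lin_def ex_sum fscale_def ex_fmult ex_gam if_distrib[of "\<lambda>x. _ * x"] cong: if_cong)
  then show ?thesis by (simp add: period_def vec_eq_iff mean_const)
qed

abbreviation "dcls \<equiv> dolbeault_class \<theta> 2 1"
abbreviation "H\<gamma> \<equiv> span_module (dolbeault \<theta> 2 1) (dcls ` range gam)"

lemma span_gam:
  assumes "s 0 1 \<noteq> 0"
  shows "H\<gamma> = (dolbeault \<theta> 2 1)\<lparr>carrier := dcls ` range lin\<rparr>"
proof -
  interpret dolbeault_subspaces \<theta> 2 1 by (rule dolbeault_subspaces)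
  show ?thesis
  proof (rule span_module_cls[OF lin_subspace])
    show "range lin \<subseteq> closed_forms \<theta> 2 1" using lin_closed[OF assms] by blast
    show "range gam \<subseteq> range lin" using lin_axis by (metis image_subsetI rangeI)
    fix S' assume S': "form_subspace S'" "range gam \<subseteq> S'"
    have "(\<Sum>i\<in>I. fscale (c $ i) (gam i)) \<in> S'" for c and I :: "4 set"
      by (induction I rule: infinite_finite_induct)
        (use S' in \<open>auto intro!: form_subspaceD[OF S'(1)]\<close>)
    then show "range lin \<subseteq> S'" by (auto simp: lin_def)
  qed
qed

lemma module_H\<gamma>:
  assumes "s 0 1 \<noteq> 0"
  shows "Module.module complex_ring H\<gamma>"
  unfolding span_gam[OF assms]
  by (rule dolbeault_subspaces.module_span_module_cls[OF dolbeault_subspaces lin_subspace])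
    (use lin_closed[OF assms] in blast)

text \<open>Any representative of a class of (2,1)-forms gives the same value, since periods vanish
  on exact forms; see \<open>coord_cls\<close>.\<close>

definition coord :: "form set \<Rightarrow> complex^4" where
  "coord X = period (SOME \<omega>. \<omega> \<in> X)"

lemma coord_cls:
  assumes "\<omega> \<in> pq_forms \<theta> 2 1"
  shows "coord (dcls \<omega>) = period \<omega>"
proof -
  interpret dolbeault_subspaces \<theta> 2 1 by (rule dolbeault_subspaces)
  define \<eta> where "\<eta> = (SOME \<omega>'. \<omega>' \<in> dcls \<omega>)"
  have "\<omega> \<in> dcls \<omega>" using form_subspaceD(1)[OF exact] by (simp add: mem_cls)
  then have "\<eta> \<in> dcls \<omega>" unfolding \<eta>_def by (rule someI[of "\<lambda>\<omega>'. \<omega>' \<in> dcls \<omega>"])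
  then have e: "\<eta> - \<omega> \<in> exact_forms \<theta> 2 1" by (simp add: mem_cls)
  then have T: "\<eta> - \<omega> \<in> T 3" "\<omega> \<in> T 3"
    using exact_forms_pq[of 2 1] pq_forms_T[of _ 2 1] assms by auto
  have "period (\<omega> + (\<eta> - \<omega>)) = period \<omega> + period (\<eta> - \<omega>)" by (rule period_add[OF T(2,1)])
  then show ?thesis using period_exact[OF e] by (simp add: coord_def \<eta>_def[symmetric])
qed

lemma linear_iso_coord:
  assumes "s 0 1 \<noteq> 0"
  shows "linear_iso H\<gamma> coord"
proof -
  interpret dolbeault_subspaces \<theta> 2 1 by (rule dolbeault_subspaces)
  have c: "coord (dcls (lin x)) = x" for x by (simp add: coord_cls[OF lin_pq] period_lin)
  have "bij_betw coord (dcls ` range lin) UNIV"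
    by (rule bij_betwI[of _ _ _ "\<lambda>x. dcls (lin x)"]) (auto simp: c)
  moreover have "coord (X \<oplus>\<^bsub>H\<^esub> Y) = coord X + coord Y" "coord (a \<odot>\<^bsub>H\<^esub> X) = a *s coord X"
    if "X \<in> dcls ` range lin" "Y \<in> dcls ` range lin" for X Y a
    using that by (auto simp: add_cls smult_cls lin_add[symmetric] lin_smult[symmetric] c)
  ultimately show ?thesis
    unfolding span_gam[OF assms] linear_iso_def by auto
qed

end


section \<open>The coframes of the Kuranishi family\<close>

text \<open>The components of the coframe and its conjugate with \<open>t31\<close> and
  \<open>t32\<close> set to 0, hence the coframe over \<open>Delta_gamma\<close>.\<close>

definition Mt :: "param \<Rightarrow> nat \<Rightarrow> nat \<Rightarrow> complex" where
  "Mt t i k =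
     [[1, 0, 0, t $ 1 $ 1, t $ 1 $ 2, 0],
      [0, 1, 0, t $ 2 $ 1, t $ 2 $ 2, 0],
      [0, 0, 1, 0, 0, - det_param t],
      [cnj (t $ 1 $ 1), cnj (t $ 1 $ 2), 0, 1, 0, 0],
      [cnj (t $ 2 $ 1), cnj (t $ 2 $ 2), 0, 0, 1, 0],
      [0, 0, - cnj (det_param t), 0, 0, 1]] ! i ! k"

text \<open>Writing the coframe as \<open>a\<^sub>t = a + T a'\<close> with \<open>a = (\<alpha>, \<beta>)\<close> and \<open>a'\<close> its conjugate, one finds
  \<open>a = (1 - T T')\<inverse> (a\<^sub>t - T a\<^sub>t')\<close>; the following are the adjugate and the determinant of
  \<open>1 - T T'\<close>, where \<open>T'\<close> is the conjugate of \<open>T\<close>.\<close>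

definition adj11 :: "param \<Rightarrow> complex" where
  "adj11 t = 1 - (t $ 2 $ 1 * cnj (t $ 1 $ 2) + t $ 2 $ 2 * cnj (t $ 2 $ 2))"
definition adj12 :: "param \<Rightarrow> complex" where
  "adj12 t = t $ 1 $ 1 * cnj (t $ 1 $ 2) + t $ 1 $ 2 * cnj (t $ 2 $ 2)"
definition adj21 :: "param \<Rightarrow> complex" where
  "adj21 t = t $ 2 $ 1 * cnj (t $ 1 $ 1) + t $ 2 $ 2 * cnj (t $ 2 $ 1)"
definition adj22 :: "param \<Rightarrow> complex" where
  "adj22 t = 1 - (t $ 1 $ 1 * cnj (t $ 1 $ 1) + t $ 1 $ 2 * cnj (t $ 2 $ 1))"

definition ab_det :: "param \<Rightarrow> complex" where
  "ab_det t = adj11 t * adj22 t - adj12 t * adj21 t"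

text \<open>The determinant of the block that expresses gamma_t and its conjugate by gamma and its
  conjugate.\<close>

definition c_det :: "param \<Rightarrow> complex" where
  "c_det t = 1 - det_param t * cnj (det_param t)"

text \<open>The adjugate followed by minus the adjugate times T: the rows for alpha and beta in
  terms of alpha_t, beta_t and their conjugates, before division by \<open>ab_det\<close>.\<close>

definition Nrow :: "param \<Rightarrow> nat \<Rightarrow> complex list" where
  "Nrow t i =
     [[adj11 t, adj12 t, - (adj11 t * t $ 1 $ 1 + adj12 t * t $ 2 $ 1), - (adj11 t * t $ 1 $ 2 + adj12 t * t $ 2 $ 2)],
      [adj21 t, adj22 t, - (adj21 t * t $ 1 $ 1 + adj22 t * t $ 2 $ 1), - (adj21 t * t $ 1 $ 2 + adj22 t * t $ 2 $ 2)]] ! i"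

definition Nt :: "param \<Rightarrow> nat \<Rightarrow> nat \<Rightarrow> complex" where
  "Nt t i k = (let p = (\<lambda>i j. Nrow t i ! j / ab_det t) in
     [[p 0 0, p 0 1, 0, p 0 2, p 0 3, 0],
      [p 1 0, p 1 1, 0, p 1 2, p 1 3, 0],
      [0, 0, 1 / c_det t, 0, 0, det_param t / c_det t],
      [cnj (p 0 2), cnj (p 0 3), 0, cnj (p 0 0), cnj (p 0 1), 0],
      [cnj (p 1 2), cnj (p 1 3), 0, cnj (p 1 0), cnj (p 1 1), 0],
      [0, 0, cnj (det_param t / c_det t), 0, 0, cnj (1 / c_det t)]] ! i ! k)"

definition admissible :: "param set" where
  "admissible = {t. t $ 3 $ 1 = 0 \<and> t $ 3 $ 2 = 0 \<and> ab_det t \<noteq> 0 \<and> c_det t \<noteq> 0}"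

lemma cnj_dets: "cnj (ab_det t) = ab_det t" "cnj (c_det t) = c_det t"
  by (simp_all add: ab_det_def c_det_def adj11_def adj12_def adj21_def adj22_def algebra_simps)

lemma Mt_Nt:
  assumes "ab_det t \<noteq> 0" "c_det t \<noteq> 0" "i < 6" "j < 6"
  shows "(\<Sum>k<6. Mt t i k * Nt t k j) = (if i = j then 1 else 0)"
    and "(\<Sum>k<6. Nt t i k * Mt t k j) = (if i = j then 1 else 0)"
proof -
  note defs = ab_det_def c_det_def adj11_def adj12_def adj21_def adj22_def
  have i: "i = 0 \<or> i = 1 \<or> i = 2 \<or> i = 3 \<or> i = 4 \<or> i = 5" and j: "j = 0 \<or> j = 1 \<or> j = 2 \<or> j = 3 \<or> j = 4 \<or> j = 5"
    using assms less_6_cases by auto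
  show "(\<Sum>k<6. Mt t i k * Nt t k j) = (if i = j then 1 else 0)"
    using i j
    apply (elim disjE)
    apply (simp_all add: sum_lessThan_6 Mt_def Nt_def Nrow_def cnj_dets Let_def)
    apply (simp_all add: divide_simps assms cnj_dets)
    apply (simp_all add: defs algebra_simps)
    done
  show "(\<Sum>k<6. Nt t i k * Mt t k j) = (if i = j then 1 else 0)"
    using i j
    apply (elim disjE)
    apply (simp_all add: sum_lessThan_6 Mt_def Nt_def Nrow_def cnj_dets Let_def)
    apply (simp_all add: divide_simps assms cnj_dets)
    apply (simp_all add: defs algebra_simps)
    done
qed

lemma less_3_cases: "(k::nat) < 3 \<Longrightarrow> k = 0 \<or> k = 1 \<or> k = 2"
  by presburger

lemma heis_coframe_admissible:
  assumes "t \<in> admissible"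
  shows "heis_coframe (Mt t) (Nt t)"
proof
  have a: "ab_det t \<noteq> 0" "c_det t \<noteq> 0" using assms by (auto simp: admissible_def)
  fix i j :: nat
  show "(\<Sum>k<6. Mt t i k * Nt t k j) = (if i = j then 1 else 0)"
    "(\<Sum>k<6. Nt t i k * Mt t k j) = (if i = j then 1 else 0)" if "i < 6" "j < 6"
    using Mt_Nt[OF a that] by blast+
next
  fix i k :: nat assume "i < 3" "k < 3"
  then have ik: "i = 0 \<or> i = 1 \<or> i = 2" "k = 0 \<or> k = 1 \<or> k = 2" by (simp_all add: less_3_cases)
  show "Mt t (i + 3) k = cnj (Mt t i (k + 3)) \<and> Mt t (i + 3) (k + 3) = cnj (Mt t i k)"
    using ik by (elim disjE; simp add: Mt_def)
  show "Nt t (i + 3) k = cnj (Nt t i (k + 3)) \<and> Nt t (i + 3) (k + 3) = cnj (Nt t i k)"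
    using ik by (elim disjE; simp add: Nt_def Let_def)
next
  fix i k :: nat assume ik: "i \<in> {0, 1, 3, 4}" "k \<in> {2, 5}"
  show "Mt t i k = 0" using ik by (elim insertE emptyE; simp add: Mt_def)
  show "Nt t i k = 0" using ik by (elim insertE emptyE; simp add: Nt_def Let_def)
qed

lemma norm_component_le:
  fixes t :: param
  shows "norm (t $ i $ j) \<le> norm t"
  using Finite_Cartesian_Product.norm_nth_le[of t i] Finite_Cartesian_Product.norm_nth_le[of "t $ i" j] by linarith

text \<open>Origin of the radius 1/4: products of two entries are at most 1/16 and sums of two such
  products at most 1/8. So the product of the diagonal entries of the adjugate has modulus at least
  49/64 and that of the others at most 1/64, and |\<open>det_param\<close>| is at most 1/8; neither
  determinant can vanish.\<close>

lemma ball_admissible: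
  assumes "t \<in> Delta_gamma (ball 0 r)" "r \<le> 1 / 4"
  shows "t \<in> admissible"
proof -
  have t: "norm t < 1 / 4" "t $ 3 $ 1 = 0" "t $ 3 $ 2 = 0"
    using assms by (auto simp: Delta_gamma_def)
  have c: "cmod (t $ i $ j) \<le> 1 / 4" for i j using norm_component_le[of t i j] t(1) by linarith
  have m: "cmod (x * y) \<le> 1 / 16" if "cmod x \<le> 1 / 4" "cmod y \<le> 1 / 4" for x y
    using mult_mono[OF that] by (simp add: norm_mult)
  have m2: "cmod (x * y + u * v) \<le> 1 / 8"
    if "cmod x \<le> 1 / 4" "cmod y \<le> 1 / 4" "cmod u \<le> 1 / 4" "cmod v \<le> 1 / 4" for x y u v
    using norm_triangle_ineq[of "x * y" "u * v"] m[OF that(1,2)] m[OF that(3,4)] by linarith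
  have one: "7 / 8 \<le> cmod (1 - x)" if "cmod x \<le> 1 / 8" for x
    using norm_triangle_ineq2[of 1 x] that by simp
  have "7 / 8 \<le> cmod (adj11 t)" "7 / 8 \<le> cmod (adj22 t)" "cmod (adj12 t) \<le> 1 / 8" "cmod (adj21 t) \<le> 1 / 8"
    unfolding adj11_def adj12_def adj21_def adj22_def
    by (intro one m2; simp only: complex_mod_cnj c)+
  then have "7 / 8 * (7 / 8) \<le> cmod (adj11 t * adj22 t)" "cmod (adj12 t * adj21 t) \<le> 1 / 8 * (1 / 8)"
    unfolding norm_mult by (intro mult_mono; simp)+
  then have "ab_det t \<noteq> 0" by (auto simp: ab_det_def)
  moreover have "cmod (det_param t) \<le> 1 / 8"
    using m2[of "t $ 1 $ 1" "t $ 2 $ 2" "- t $ 1 $ 2" "t $ 2 $ 1"] c by (simp add: det_param_def)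
  then have "cmod (det_param t * cnj (det_param t)) \<le> 1 / 8 * (1 / 8)"
    unfolding norm_mult by (intro mult_mono) auto
  then have "c_det t \<noteq> 0" by (auto simp: c_det_def)
  ultimately show ?thesis using t by (simp add: admissible_def)
qed

text \<open>In closed form sigma_12 = - \<open>c_det\<close> / \<open>ab_det\<close>.\<close>

lemma s_nonzero:
  assumes "t \<in> admissible"
  shows "heis_coframe.s (Mt t) (Nt t) 0 1 \<noteq> 0"
proof -
  interpret heis_coframe "Mt t" "Nt t" by (rule heis_coframe_admissible[OF assms])
  have a: "ab_det t \<noteq> 0" "c_det t \<noteq> 0" using assms by (auto simp: admissible_def)
  have 1: "Nt t 0 0 * Nt t 1 1 - Nt t 0 1 * Nt t 1 0 = 1 / ab_det t"
    using a by (simp add: Nt_def Nrow_def Let_def field_simps) (simp add: ab_det_def algebra_simps)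
  \<comment> \<open>The columns of \<open>Nt\<close> for the conjugates are those for alpha_t,
    beta_t multiplied by -T, so their minor gains the factor det(-T) = det T, which is
    \<open>det_param\<close>; conjugation gives the claim.\<close>
  have 2: "Nt t 3 0 * Nt t 4 1 - Nt t 3 1 * Nt t 4 0 = cnj (det_param t) / ab_det t"
  proof -
    have "Nt t 0 3 * Nt t 1 4 - Nt t 0 4 * Nt t 1 3 = (Nt t 0 0 * Nt t 1 1 - Nt t 0 1 * Nt t 1 0) * det_param t"
      using a by (simp add: Nt_def Nrow_def Let_def field_simps) (simp add: det_param_def algebra_simps)
    then have "cnj (Nt t 0 3 * Nt t 1 4 - Nt t 0 4 * Nt t 1 3) = cnj (det_param t / ab_det t)"
      by (simp add: 1)
    then show ?thesis
      using N_conj[of 0 0] N_conj[of 0 1] N_conj[of 1 0] N_conj[of 1 1] by (simp add: cnj_dets)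
  qed
  have "s 0 1 = - (Mt t 2 2 * (Nt t 0 0 * Nt t 1 1 - Nt t 0 1 * Nt t 1 0)
      + Mt t 2 5 * (Nt t 3 0 * Nt t 4 1 - Nt t 3 1 * Nt t 4 0))"
    by (simp add: s_def struc_def algebra_simps)
  also have "\<dots> = - c_det t / ab_det t"
    unfolding 1 2 by (simp add: Mt_def c_det_def diff_divide_distrib)
  finally show ?thesis using a by simp
qed

lemma form_list_eqs:
  assumes "t \<in> admissible"
  shows "heis_coframe.\<Theta> (Mt t) 0 = alpha_t t" "heis_coframe.\<Theta> (Mt t) 1 = beta_t t"
    "heis_coframe.\<Theta> (Mt t) 2 = gamma_t t"
    "heis_coframe.\<Theta> (Mt t) 3 = cnj_form (alpha_t t)" "heis_coframe.\<Theta> (Mt t) 4 = cnj_form (beta_t t)"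
    "heis_coframe.\<Theta> (Mt t) 5 = cnj_form (gamma_t t)"
proof -
  interpret heis_coframe "Mt t" "Nt t" by (rule heis_coframe_admissible[OF assms])
  have t: "t $ 3 $ 1 = 0" "t $ 3 $ 2 = 0" using assms by (auto simp: admissible_def)
  have b: "alpha = base_form 0" "beta = base_form 1" "gamma = base_form 2"
    "cnj_form alpha = base_form 3" "cnj_form beta = base_form 4" "cnj_form gamma = base_form 5"
    by (simp_all add: base_form_def)
  show 0: "\<Theta> 0 = alpha_t t" "\<Theta> 1 = beta_t t" "\<Theta> 2 = gamma_t t"
    unfolding \<Theta>_def alpha_t_def beta_t_def gamma_t_def b(4-6)
    unfolding b(1-3)
    by (simp_all add: sum_lessThan_6 Mt_def t fun_eq_iff form_apply fscale_apply)
  show "\<Theta> 3 = cnj_form (alpha_t t)" "\<Theta> 4 = cnj_form (beta_t t)" "\<Theta> 5 = cnj_form (gamma_t t)"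
    using cnj_\<Theta>[of 0] cnj_\<Theta>[of 1] cnj_\<Theta>[of 2] by (simp_all add: 0)
qed

lemma kuranishi_eqs:
  assumes "t \<in> admissible"
  shows "kuranishi_coframe t = [heis_coframe.\<Theta> (Mt t) 0, heis_coframe.\<Theta> (Mt t) (Suc 0), heis_coframe.\<Theta> (Mt t) 2]"
    "sigma t = heis_coframe.s (Mt t) (Nt t) 0 1"
    "sigma_bar t = vector [vector [heis_coframe.s (Mt t) (Nt t) 0 3, heis_coframe.s (Mt t) (Nt t) 0 4],
       vector [heis_coframe.s (Mt t) (Nt t) 1 3, heis_coframe.s (Mt t) (Nt t) 1 4]]"
    "Gamma1 t = heis_coframe.gam (Mt t) (Nt t) 1" "Gamma2 t = heis_coframe.gam (Mt t) (Nt t) 2"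
    "Gamma3 t = heis_coframe.gam (Mt t) (Nt t) 3" "Gamma4 t = heis_coframe.gam (Mt t) (Nt t) 4"
proof -
  interpret heis_coframe "Mt t" "Nt t" by (rule heis_coframe_admissible[OF assms])
  note \<Theta> = form_list_eqs[OF assms]
  show k: "kuranishi_coframe t = \<theta>"
    using \<Theta>(2) by (simp add: kuranishi_coframe_def \<Theta> One_nat_def)
  have w: "w [i] = \<Theta> i" "w [i, j] = \<Theta> i \<and>\<^sub>f \<Theta> j" "w [i, j, l] = \<Theta> i \<and>\<^sub>f \<Theta> j \<and>\<^sub>f \<Theta> l" for i j l
    by (simp_all add: w_simps wedge_form_one one_form_\<Theta>)
  show sg: "sigma t = s 0 1"
    unfolding sigma_def k using the_del_\<Theta>2 by (simp add: w \<Theta>)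
  show sb: "sigma_bar t = vector [vector [s 0 3, s 0 4], vector [s 1 3, s 1 4]]"
    unfolding sigma_bar_def k using the_delbar_\<Theta>2 by (simp add: w \<Theta>)
  show "Gamma1 t = gam 1" "Gamma2 t = gam 2" "Gamma3 t = gam 3" "Gamma4 t = gam 4"
    unfolding Gamma1_def Gamma2_def Gamma3_def Gamma4_def gam_def sg sb
    by (simp_all add: period_index_def gam_coef_def w \<Theta> vector_2)
      (simp_all add: fun_eq_iff form_apply fscale_apply)
qed

lemma H21_gamma_eq:
  assumes "t \<in> admissible"
  shows "H21_gamma t = span_module (dolbeault (kuranishi_coframe t) 2 1)
    (dolbeault_class (kuranishi_coframe t) 2 1 ` range (heis_coframe.gam (Mt t) (Nt t)))"
  by (simp add: H21_gamma_def H21_def kuranishi_eqs(4-7)[OF assms] UNIV_4)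

lemma zero_admissible: "0 \<in> admissible"
  by (simp add: admissible_def ab_det_def c_det_def adj11_def adj12_def adj21_def adj22_def det_param_def)

text \<open>At t = 0 the coefficients \<open>sigma_bar\<close> vanish, and with them the correction
  terms.\<close>

lemma H21_gamma_zero:
  "H21_gamma 0 = span_module (dolbeault iwasawa_coframe 2 1)
      (dolbeault_class iwasawa_coframe 2 1 `
        {alpha \<and>\<^sub>f gamma \<and>\<^sub>f cnj_form alpha, alpha \<and>\<^sub>f gamma \<and>\<^sub>f cnj_form beta,
         beta \<and>\<^sub>f gamma \<and>\<^sub>f cnj_form alpha, beta \<and>\<^sub>f gamma \<and>\<^sub>f cnj_form beta})"
proof -
  interpret heis_coframe "Mt 0" "Nt 0" by (rule heis_coframe_admissible[OF zero_admissible])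
  have t0: "alpha_t 0 = alpha" "beta_t 0 = beta" "gamma_t 0 = gamma"
    by (simp_all add: alpha_t_def beta_t_def gamma_t_def det_param_def fun_eq_iff form_apply fscale_apply)
  have "s 0 3 = 0" "s 0 4 = 0" "s 1 3 = 0" "s 1 4 = 0"
    by (simp_all add: s_def struc_def Mt_def Nt_def Nrow_def Let_def adj11_def adj12_def adj21_def adj22_def det_param_def)
  then have sb: "sigma_bar 0 = vector [vector [0, 0], vector [0, 0]]"
    by (simp add: kuranishi_eqs(3)[OF zero_admissible])
  have "fscale 0 \<omega> = 0" for \<omega> by (simp add: fun_eq_iff form_apply fscale_apply)
  then have "Gamma1 0 = alpha \<and>\<^sub>f gamma \<and>\<^sub>f cnj_form alpha" "Gamma2 0 = alpha \<and>\<^sub>f gamma \<and>\<^sub>f cnj_form beta"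
    "Gamma3 0 = beta \<and>\<^sub>f gamma \<and>\<^sub>f cnj_form alpha" "Gamma4 0 = beta \<and>\<^sub>f gamma \<and>\<^sub>f cnj_form beta"
    by (simp_all add: Gamma1_def Gamma2_def Gamma3_def Gamma4_def sb vector_2 t0)
  then show ?thesis
    by (simp add: H21_gamma_def H21_def kuranishi_coframe_def iwasawa_coframe_def t0)
qed


section \<open>Smooth dependence on the parameter\<close>

lemma smooth_on_fst:
  assumes "smooth_on U f"
  shows "smooth_on (U \<times> S) (\<lambda>(t, z). f t)"
  unfolding split_beta by (rule smooth_on_compose_linear[OF bounded_linear_fst assms]) auto

lemma smooth_on_snd:
  assumes "smooth_on UNIV f"
  shows "smooth_on (U \<times> S) (\<lambda>(t, z). f z)"
  unfolding split_beta by (rule smooth_on_compose_linear[OF bounded_linear_snd assms]) auto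

lemma smooth_familyD: "smooth_family U \<omega> \<Longrightarrow> smooth_on (U \<times> UNIV) (\<lambda>(t, z). \<omega> t z vs)"
  by (simp add: smooth_family_def)

lemma smooth_family_cong:
  assumes "smooth_family U \<omega>" "\<And>t. t \<in> U \<Longrightarrow> \<omega> t = \<eta> t"
  shows "smooth_family U \<eta>"
  unfolding smooth_family_def
  by (intro allI smooth_on_cong[OF smooth_familyD[OF assms(1)]]) (auto simp: assms(2))

lemma smooth_family_add: "smooth_family U \<omega> \<Longrightarrow> smooth_family U \<eta> \<Longrightarrow> smooth_family U (\<lambda>t. \<omega> t + \<eta> t)"
  unfolding smooth_family_def split_beta by (simp add: form_apply smooth_on_add)

lemma smooth_family_fscale:
  assumes "smooth_on U c" "smooth_family U \<omega>"
  shows "smooth_family U (\<lambda>t. fmult (\<lambda>_. c t) (\<omega> t))"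
  using assms(2) smooth_on_fst[OF assms(1), of UNIV] unfolding smooth_family_def split_beta
  by (auto simp: form_apply intro!: smooth_on_mult)

lemma smooth_family_zero: "smooth_family U (\<lambda>t. 0)"
  unfolding smooth_family_def split_beta by (simp add: form_apply smooth_on_const)

lemma smooth_family_sum:
  "(\<And>i. i \<in> I \<Longrightarrow> smooth_family U (\<omega> i)) \<Longrightarrow> smooth_family U (\<lambda>t. \<Sum>i\<in>I. \<omega> i t)"
  by (induction I rule: infinite_finite_induct) (simp_all add: smooth_family_zero smooth_family_add)

lemma smooth_family_wedge:
  assumes "smooth_family U \<omega>" "smooth_family U \<eta>"
  shows "smooth_family U (\<lambda>t. \<omega> t \<and>\<^sub>f \<eta> t)"
  using assms unfolding smooth_family_def split_beta wedge_def
  by (auto intro!: smooth_on_sum smooth_on_mult smooth_on_const)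

lemma smooth_on_coord: "smooth_on S (\<lambda>z::point. z $ i)" "smooth_on S (\<lambda>z::point. cnj (z $ i))"
  by (rule smooth_on_bounded_linear[OF bounded_linear_vec_nth])
    (rule smooth_on_cnj[OF smooth_on_bounded_linear[OF bounded_linear_vec_nth]])

lemma smooth_family_base_form: 
  assumes "k < 6"
  shows "smooth_family U (\<lambda>t. base_form k)"
  unfolding smooth_family_def
proof
  fix vs
  have "smooth_on UNIV (\<lambda>z. base_form k z vs)"
  proof (cases "length vs = 1")
    case True
    then show ?thesis
      using less_6_cases[OF assms]
      by (elim disjE)
        (auto simp: base_form_eval[folded One_nat_def]
          intro!: smooth_on_const smooth_on_diff smooth_on_mult smooth_on_coord)
  next
    case False
    then have "(\<lambda>z. base_form k z vs) = (\<lambda>z. 0)" using one_formD[OF one_form_base_form[OF assms]] by auto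
    then show ?thesis by (simp add: smooth_on_const)
  qed
  then show "smooth_on (U \<times> UNIV) (\<lambda>(t, z). base_form k z vs)" by (rule smooth_on_snd)
qed

lemma smooth_family_form_one: "smooth_family U (\<lambda>t. form_one)"
  unfolding smooth_family_def form_one_def split_beta by (simp add: smooth_on_const)

lemma smooth_family_base_hook:
  assumes "smooth_family U \<omega>"
  shows "smooth_family U (\<lambda>t. base_hook k (\<omega> t))"
  unfolding smooth_family_def
proof
  fix vs
  let ?f = "\<lambda>z::point. if k = 1 then z $ 1 else if k = 4 then cnj (z $ 1) else 0"
  have "smooth_on UNIV ?f" by (cases "k = 1"; cases "k = 4"; simp add: smooth_on_coord smooth_on_const)
  then have f: "smooth_on (U \<times> UNIV) (\<lambda>p. ?f (snd p))"
    by (rule smooth_on_snd[unfolded split_beta])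
  have o: "smooth_on (U \<times> UNIV) (\<lambda>p. \<omega> (fst p) (snd p) us)" for us
    by (rule smooth_familyD[OF assms, unfolded split_beta])
  have "smooth_on (U \<times> UNIV) (\<lambda>p. 1 / 2 * (\<omega> (fst p) (snd p) (base_vec k # vs)
      + conj_sign k * \<i> * \<omega> (fst p) (snd p) ((\<i> *s base_vec k) # vs))
      + ?f (snd p) * (1 / 2 * (\<omega> (fst p) (snd p) (base_vec 2 # vs)
      + conj_sign k * \<i> * \<omega> (fst p) (snd p) ((\<i> *s base_vec 2) # vs))))"
    by (intro smooth_on_add smooth_on_mult smooth_on_const o f)
  then show "smooth_on (U \<times> UNIV) (\<lambda>(t, z). base_hook k (\<omega> t) z vs)"
    by (rule smooth_on_cong) (clarsimp simp: base_hook_def const_hook_def form_apply insert_vec_def)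
qed

lemma smooth_on_param: "smooth_on S (\<lambda>t::param. t $ i $ j)"
  by (rule smooth_on_bounded_linear[OF bounded_linear_compose[OF bounded_linear_vec_nth bounded_linear_vec_nth]])

lemma smooth_on_det_param: "smooth_on S det_param"
  unfolding det_param_def[abs_def] by (intro smooth_on_diff smooth_on_mult smooth_on_param)

lemma smooth_on_Mt:
  assumes "i < 6" "k < 6"
  shows "smooth_on S (\<lambda>t. Mt t i k)"
  using less_6_cases[OF assms(1)] less_6_cases[OF assms(2)]
  by (elim disjE)
    (simp_all add: Mt_def smooth_on_const smooth_on_param smooth_on_cnj smooth_on_minus smooth_on_det_param)

lemma smooth_on_adj:
  "smooth_on S adj11" "smooth_on S adj12" "smooth_on S adj21" "smooth_on S adj22"
  "smooth_on S ab_det" "smooth_on S c_det"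
proof -
  show *: "smooth_on S adj11" "smooth_on S adj12" "smooth_on S adj21" "smooth_on S adj22"
    unfolding adj11_def[abs_def] adj12_def[abs_def] adj21_def[abs_def] adj22_def[abs_def]
    by (intro smooth_on_diff smooth_on_add smooth_on_mult smooth_on_cnj smooth_on_param smooth_on_const)+
  show "smooth_on S ab_det" "smooth_on S c_det"
    unfolding ab_det_def[abs_def] c_det_def[abs_def]
    by (intro smooth_on_diff smooth_on_mult smooth_on_cnj smooth_on_det_param smooth_on_const *)+
qed

lemma smooth_on_Nt:
  assumes "i < 6" "k < 6" "S \<subseteq> admissible"
  shows "smooth_on S (\<lambda>t. Nt t i k)"
proof -
  have nz: "ab_det t \<noteq> 0" "c_det t \<noteq> 0" if "t \<in> S" for t
    using that assms(3) by (auto simp: admissible_def)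
  have row: "smooth_on S (\<lambda>t. Nrow t a ! b / ab_det t)" if "a \<in> {0, 1}" "b \<in> {0, 1, 2, 3}" for a b
  proof (rule smooth_on_divide[OF _ smooth_on_adj(5) nz(1)])
    show "smooth_on S (\<lambda>t. Nrow t a ! b)"
      using that
      by (elim insertE emptyE)
        (auto simp: Nrow_def intro!: smooth_on_adj smooth_on_minus smooth_on_add smooth_on_diff smooth_on_mult smooth_on_param)
  qed
  have c: "smooth_on S (\<lambda>t. 1 / c_det t)" "smooth_on S (\<lambda>t. det_param t / c_det t)"
    by (intro smooth_on_divide smooth_on_const smooth_on_adj smooth_on_det_param nz; assumption)+
  define p where "p a b t = Nrow t a ! b / ab_det t" for a b t
  have p: "smooth_on S (p a b)" if "a \<in> {0, 1}" "b \<in> {0, 1, 2, 3}" for a b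
    using row[OF that] by (simp add: p_def[abs_def])
  \<comment> \<open>A matrix of functions of t, so that smoothness is checked once per entry and
    then follows for every index by list membership.\<close>
  define fs :: "(param \<Rightarrow> complex) list list" where "fs =
     [[p 0 0, p 0 1, \<lambda>t. 0, p 0 2, p 0 3, \<lambda>t. 0],
      [p 1 0, p 1 1, \<lambda>t. 0, p 1 2, p 1 3, \<lambda>t. 0],
      [\<lambda>t. 0, \<lambda>t. 0, \<lambda>t. 1 / c_det t, \<lambda>t. 0, \<lambda>t. 0, \<lambda>t. det_param t / c_det t],
      [\<lambda>t. cnj (p 0 2 t), \<lambda>t. cnj (p 0 3 t), \<lambda>t. 0, \<lambda>t. cnj (p 0 0 t), \<lambda>t. cnj (p 0 1 t), \<lambda>t. 0],
      [\<lambda>t. cnj (p 1 2 t), \<lambda>t. cnj (p 1 3 t), \<lambda>t. 0, \<lambda>t. cnj (p 1 0 t), \<lambda>t. cnj (p 1 1 t), \<lambda>t. 0],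
      [\<lambda>t. 0, \<lambda>t. 0, \<lambda>t. cnj (det_param t / c_det t), \<lambda>t. 0, \<lambda>t. 0, \<lambda>t. cnj (1 / c_det t)]]"
  have "\<forall>row\<in>set fs. \<forall>f\<in>set row. smooth_on S f"
    unfolding fs_def list.set ball_simps
    by (intro conjI TrueI smooth_on_const c smooth_on_cnj; rule p; simp)
  moreover have "fs ! i ! k \<in> set (fs ! i)" "fs ! i \<in> set fs"
    using assms(1,2) less_6_cases[OF assms(1)] by (auto simp: fs_def intro!: nth_mem)
  ultimately have sm: "smooth_on S (fs ! i ! k)" by blast
  have eq: "(fs ! i ! k) t = Nt t i k" for t
    unfolding Nt_def Let_def fs_def p_def
    using less_6_cases[OF assms(1)] less_6_cases[OF assms(2)] by (elim disjE) simp_all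
  show ?thesis by (rule smooth_on_cong[OF sm]) (rule eq)
qed

text \<open>The defining equations of the constants of \<open>heis_coframe\<close> hold for
  admissible t. So smoothness is shown for an explicit expression and transferred by
  \<open>smooth_on_cong\<close>; the lemmas below proceed in the same way.\<close>

lemma smooth_on_s:
  assumes "a < 6" "b < 6" "S \<subseteq> admissible"
  shows "smooth_on S (\<lambda>t. heis_coframe.s (Mt t) (Nt t) a b)"
proof (rule smooth_on_cong)
  let ?st = "\<lambda>t a b. - (Mt t 2 2 * (Nt t 0 a * Nt t 1 b) + Mt t 2 5 * (Nt t 3 a * Nt t 4 b))"
  show "smooth_on S (\<lambda>t. ?st t a b - ?st t b a)"
    by (intro smooth_on_diff smooth_on_minus smooth_on_add smooth_on_mult smooth_on_Mt smooth_on_Nt assms; simp)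
  fix t assume "t \<in> S"
  then interpret heis_coframe "Mt t" "Nt t" using assms(3) heis_coframe_admissible by blast
  show "?st t a b - ?st t b a = s a b" by (simp add: s_def struc_def)
qed

lemma smooth_family_w:
  assumes "set js \<subseteq> {..<6}" "U \<subseteq> admissible"
  shows "smooth_family U (\<lambda>t. heis_coframe.w (Mt t) js)"
  using assms(1)
proof (induction js)
  case Nil
  show ?case
  proof (rule smooth_family_cong[OF smooth_family_form_one])
    fix t assume "t \<in> U"
    then interpret heis_coframe "Mt t" "Nt t" using assms(2) heis_coframe_admissible by blast
    show "form_one = w []" by (simp add: w_simps)
  qed
next
  case (Cons j js)
  show ?case
  proof (rule smooth_family_cong)
    show "smooth_family U (\<lambda>t. (\<Sum>k<6. fmult (\<lambda>_. Mt t j k) (base_form k)) \<and>\<^sub>f heis_coframe.w (Mt t) js)"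
      using Cons by (intro smooth_family_wedge smooth_family_sum smooth_family_fscale smooth_on_Mt smooth_family_base_form) auto
    fix t assume "t \<in> U"
    then interpret heis_coframe "Mt t" "Nt t" using assms(2) heis_coframe_admissible by blast
    show "(\<Sum>k<6. fmult (\<lambda>_. Mt t j k) (base_form k)) \<and>\<^sub>f w js = w (j # js)"
      by (simp add: w_simps \<Theta>_def)
  qed
qed

lemma smooth_family_gam:
  assumes "U \<subseteq> admissible"
  shows "smooth_family U (\<lambda>t. heis_coframe.gam (Mt t) (Nt t) i)"
proof (rule smooth_family_cong)
  let ?s = "\<lambda>t. heis_coframe.s (Mt t) (Nt t)"
  let ?c = "\<lambda>t. (if i = 1 then - ?s t 1 4 else if i = 2 then ?s t 1 3 else if i = 3 then ?s t 0 4 else - ?s t 0 3) / cnj (?s t 0 1)"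
  have "smooth_on U ?c"
  proof (rule smooth_on_divide)
    show "smooth_on U (\<lambda>t. if i = 1 then - ?s t 1 4 else if i = 2 then ?s t 1 3 else if i = 3 then ?s t 0 4 else - ?s t 0 3)"
      by (cases "i = 1"; cases "i = 2"; cases "i = 3"; simp)
        (intro smooth_on_minus smooth_on_s assms; simp)+
    show "smooth_on U (\<lambda>t. cnj (?s t 0 1))" by (intro smooth_on_cnj smooth_on_s assms) auto
    show "cnj (?s t 0 1) \<noteq> 0" if "t \<in> U" for t using s_nonzero[of t] that assms by auto
  qed
  then show "smooth_family U (\<lambda>t. heis_coframe.w (Mt t) (period_index i)
      + fmult (\<lambda>_. ?c t) (heis_coframe.w (Mt t) [0, 1, 5]))"
    by (intro smooth_family_add smooth_family_fscale smooth_family_w period_index_props assms) auto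
  fix t assume "t \<in> U"
  then interpret heis_coframe "Mt t" "Nt t" using assms heis_coframe_admissible by blast
  show "w (period_index i) + fmult (\<lambda>_. (if i = 1 then - s 1 4 else if i = 2 then s 1 3 else if i = 3 then s 0 4
      else - s 0 3) / cnj (s 0 1)) (w [0, 1, 5]) = gam i"
    by (simp only: gam_def gam_coef_def fscale_def)
qed

lemma smooth_on_ex:
  assumes "set ks \<subseteq> {..<6}" "U \<subseteq> admissible" "smooth_family U \<omega>"
  shows "smooth_on (U \<times> UNIV) (\<lambda>(t, z). heis_coframe.ex (Nt t) ks (\<omega> t) z)"
  using assms(1,3)
proof (induction ks arbitrary: \<omega>)
  case Nil
  show ?case
  proof (rule smooth_on_cong[OF smooth_familyD[OF Nil(2), of "[]"]], clarify)
    fix t z assume "t \<in> U"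
    then interpret heis_coframe "Mt t" "Nt t" using assms(2) heis_coframe_admissible by blast
    show "\<omega> t z [] = ex [] (\<omega> t) z" by simp
  qed
next
  case (Cons k ks)
  have "smooth_family U (\<lambda>t. \<Sum>l<6. fmult (\<lambda>_. Nt t l k) (base_hook l (\<omega> t)))"
    using Cons.prems assms(2)
    by (intro smooth_family_sum smooth_family_fscale smooth_on_Nt smooth_family_base_hook) auto
  from Cons.IH[OF _ this] Cons.prems(1)
  have "smooth_on (U \<times> UNIV) (\<lambda>(t, z). heis_coframe.ex (Nt t) ks (\<Sum>l<6. fmult (\<lambda>_. Nt t l k) (base_hook l (\<omega> t))) z)"
    by simp
  then show ?case
  proof (rule smooth_on_cong, clarify)
    fix t z assume "t \<in> U"
    then interpret heis_coframe "Mt t" "Nt t" using assms(2) heis_coframe_admissible by blast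
    show "ex ks (\<Sum>l<6. fmult (\<lambda>_. Nt t l k) (base_hook l (\<omega> t))) z = ex (k # ks) (\<omega> t) z"
      by (simp add: hook_def)
  qed
qed

text \<open>The base is not open in the parameter space; composing with the projection \<open>t\<^sub>3\<^sub>\<lambda> \<mapsto> 0\<close> extends
  functions on it to an open set, where one can differentiate under the integral.\<close>

definition proj_gamma :: "param \<Rightarrow> param" where
  "proj_gamma t = (\<chi> i j. if i = 3 then 0 else t $ i $ j)"

lemma bounded_linear_proj_gamma: "bounded_linear proj_gamma"
  unfolding linear_conv_bounded_linear[symmetric]
  by (rule linearI) (simp_all add: proj_gamma_def vec_eq_iff)

lemma smooth_on_mean:
  assumes U: "openin (top_of_set (Delta_gamma (ball 0 r))) U" and F: "smooth_on (U \<times> UNIV) (\<lambda>(t, z). F t z)"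
  shows "smooth_on U (\<lambda>t. mean (F t))"
proof -
  obtain V where V: "open V" "U = Delta_gamma (ball 0 r) \<inter> V" using U by (auto simp: openin_open)
  \<comment> \<open>An open set of parameters that contains U and is mapped into U by
    \<open>proj_gamma\<close>, which fixes U pointwise.\<close>
  define W where "W = proj_gamma -` (V \<inter> ball 0 r)"
  have W: "open W"
    unfolding W_def using V(1) linear_continuous_on[OF bounded_linear_proj_gamma, of UNIV]
    by (intro open_vimage open_Int) auto
  have WU: "proj_gamma t \<in> U" if "t \<in> W" for t
    using that by (auto simp: W_def V(2) Delta_gamma_def proj_gamma_def)
  have pU: "proj_gamma t = t" if "t \<in> U" for t
  proof -
    have "t $ 3 $ j = 0" for j using that exhaust_2[of j] by (auto simp: V(2) Delta_gamma_def)
    then show ?thesis by (auto simp: proj_gamma_def vec_eq_iff)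
  qed
  have UW: "U \<subseteq> W" using pU by (auto simp: W_def) (auto simp: V(2) Delta_gamma_def)
  have L: "bounded_linear (\<lambda>p::param \<times> box_point. (proj_gamma (fst p), box_pt (snd p)))"
    by (intro bounded_linear_Pair bounded_linear_compose[OF bounded_linear_proj_gamma bounded_linear_fst]
        bounded_linear_compose[OF bounded_linear_box_pt bounded_linear_snd])
  have "smooth_on (W \<times> UNIV) (\<lambda>p::param \<times> box_point. F (proj_gamma (fst p)) (box_pt (snd p)))"
  proof -
    have "(\<lambda>p. (proj_gamma (fst p), box_pt (snd p))) ` (W \<times> UNIV) \<subseteq> U \<times> UNIV" using WU by auto
    from smooth_on_compose_linear[OF L F this] show ?thesis by simp
  qed
  then have "Ck_on k (W \<times> UNIV) (\<lambda>p::param \<times> box_point. F (proj_gamma (fst p)) (box_pt (snd p)))" for k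
    using W by (intro smooth_on_openD) (auto intro: open_Times)
  from Ck_on_integral[OF W this]
  have "smooth_on W (\<lambda>t. mean (F (proj_gamma t)))"
    unfolding mean_def by (intro smooth_on_openI W) simp
  then show ?thesis
    by (rule smooth_on_cong[OF smooth_on_subset[OF _ UW]]) (simp add: pU)
qed

section \<open>Trivialisations and transition functions\<close>

lemma Delta_gamma_admissible: "r \<le> 1 / 4 \<Longrightarrow> Delta_gamma (ball 0 r) \<subseteq> admissible"
  using ball_admissible by blast

lemma H21_gamma_props:
  assumes "t \<in> admissible"
  shows "Module.module complex_ring (H21_gamma t)" "linear_iso (H21_gamma t) (heis_coframe.coord (Nt t))"
    "heis_coframe.gam (Mt t) (Nt t) j \<in> closed_forms (kuranishi_coframe t) 2 1"
    "dolbeault_class (kuranishi_coframe t) 2 1 (heis_coframe.gam (Mt t) (Nt t) j) \<in> carrier (H21_gamma t)"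
    "heis_coframe.coord (Nt t) (dolbeault_class (kuranishi_coframe t) 2 1 (heis_coframe.gam (Mt t) (Nt t) j)) = axis j 1"
    "\<omega> \<in> closed_forms (kuranishi_coframe t) 2 1 \<Longrightarrow>
      heis_coframe.coord (Nt t) (dolbeault_class (kuranishi_coframe t) 2 1 \<omega>) $ i
        = mean (heis_coframe.ex (Nt t) (period_index i) \<omega>)"
proof -
  interpret heis_coframe "Mt t" "Nt t" by (rule heis_coframe_admissible[OF assms])
  note nz = s_nonzero[OF assms]
  note H = H21_gamma_eq[OF assms] kuranishi_eqs(1)[OF assms]
  show "Module.module complex_ring (H21_gamma t)" unfolding H by (rule module_H\<gamma>[OF nz])
  show "linear_iso (H21_gamma t) coord" unfolding H by (rule linear_iso_coord[OF nz])
  show "gam j \<in> closed_forms (kuranishi_coframe t) 2 1"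
    unfolding H using lin_closed[OF nz, of "axis j 1"] by (simp only: lin_axis)
  have "dcls (gam j) \<in> dcls ` range lin" by (subst lin_axis[symmetric]) blast
  then show "dolbeault_class (kuranishi_coframe t) 2 1 (gam j) \<in> carrier (H21_gamma t)"
    unfolding H span_gam[OF nz] by simp
  show "coord (dolbeault_class (kuranishi_coframe t) 2 1 (gam j)) = axis j 1"
    unfolding H using coord_cls[OF lin_pq, of "axis j 1"] by (simp only: lin_axis period_lin)
      (metis lin_axis period_lin)
  show "coord (dolbeault_class (kuranishi_coframe t) 2 1 \<omega>) $ i = mean (ex (period_index i) \<omega>)"
    if "\<omega> \<in> closed_forms (kuranishi_coframe t) 2 1"
    using that coord_cls[of \<omega>] unfolding H closed_forms_def by (simp add: period_def)
qed

lemma smooth_on_coord_frame: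
  assumes r: "r \<le> 1 / 4" and U: "openin (top_of_set (Delta_gamma (ball 0 r))) U"
    and \<omega>: "smooth_family U \<omega>" "\<And>t. t \<in> U \<Longrightarrow> \<omega> t \<in> closed_forms (kuranishi_coframe t) 2 1"
  shows "smooth_on U (\<lambda>t. heis_coframe.coord (Nt t) (dolbeault_class (kuranishi_coframe t) 2 1 (\<omega> t)) $ i)"
proof (rule smooth_on_cong)
  have UA: "U \<subseteq> admissible" using openin_imp_subset[OF U] Delta_gamma_admissible[OF r] by blast
  show "smooth_on U (\<lambda>t. mean (heis_coframe.ex (Nt t) (period_index i) (\<omega> t)))"
    by (rule smooth_on_mean[OF U smooth_on_ex[OF period_index_props(3) UA \<omega>(1)]])
  show "mean (heis_coframe.ex (Nt t) (period_index i) (\<omega> t))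
      = heis_coframe.coord (Nt t) (dolbeault_class (kuranishi_coframe t) 2 1 (\<omega> t)) $ i" if "t \<in> U" for t
    using H21_gamma_props(6)[OF _ \<omega>(2)[OF that]] UA that by auto
qed

lemma H21_gamma_bundle:
  assumes r: "r \<le> 1 / 4"
  defines "B \<equiv> Delta_gamma (ball 0 r)"
  shows "smooth_vector_bundle B H21_gamma (H21_gamma_atlas B)"
  unfolding smooth_vector_bundle_def
proof (intro conjI)
  have BA: "B \<subseteq> admissible" unfolding B_def by (rule Delta_gamma_admissible[OF r])
  let ?cls = "\<lambda>t. dolbeault_class (kuranishi_coframe t) 2 1"
  let ?K = "\<lambda>t. heis_coframe.coord (Nt t)"
  show "\<forall>t\<in>B. Module.module complex_ring (H21_gamma t)" using BA H21_gamma_props(1) by blast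
  show "\<forall>(U, \<Phi>)\<in>H21_gamma_atlas B. openin (top_of_set B) U \<and> (\<forall>t\<in>U. linear_iso (H21_gamma t) (\<Phi> t))"
    by (auto simp: H21_gamma_atlas_def)
  \<comment> \<open>The period coordinates, with the forms \<open>gam j\<close> as frame, trivialise
    the bundle over the whole base, so the atlas covers it.\<close>
  have "(B, ?K) \<in> H21_gamma_atlas B"
    unfolding H21_gamma_atlas_def
    using H21_gamma_props BA smooth_family_gam[OF BA]
    by (auto intro!: exI[of _ "\<lambda>j t. heis_coframe.gam (Mt t) (Nt t) j"])
  then show "B \<subseteq> \<Union> (fst ` H21_gamma_atlas B)" by force
  show "\<forall>(U, \<Phi>)\<in>H21_gamma_atlas B. \<forall>(V, \<Psi>)\<in>H21_gamma_atlas B. \<forall>x.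
      smooth_on (U \<inter> V) (\<lambda>t. \<Psi> t (inv_into (carrier (H21_gamma t)) (\<Phi> t) x))"
  proof clarify
    fix U V \<Phi> \<Psi> and x :: "complex^4"
    assume "(U, \<Phi>) \<in> H21_gamma_atlas B" "(V, \<Psi>) \<in> H21_gamma_atlas B"
    then obtain \<omega> \<eta> where U: "openin (top_of_set B) U" "\<And>t. t \<in> U \<Longrightarrow> linear_iso (H21_gamma t) (\<Phi> t)"
      "\<And>j. smooth_family U (\<omega> j)" "\<And>j t. t \<in> U \<Longrightarrow> \<omega> j t \<in> closed_forms (kuranishi_coframe t) 2 1"
      "\<And>j t. t \<in> U \<Longrightarrow> ?cls t (\<omega> j t) \<in> carrier (H21_gamma t)"
      "\<And>j t. t \<in> U \<Longrightarrow> \<Phi> t (?cls t (\<omega> j t)) = axis j 1"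
      and V: "openin (top_of_set B) V" "\<And>t. t \<in> V \<Longrightarrow> linear_iso (H21_gamma t) (\<Psi> t)"
      "\<And>j. smooth_family V (\<eta> j)" "\<And>j t. t \<in> V \<Longrightarrow> \<eta> j t \<in> closed_forms (kuranishi_coframe t) 2 1"
      "\<And>j t. t \<in> V \<Longrightarrow> ?cls t (\<eta> j t) \<in> carrier (H21_gamma t)"
      "\<And>j t. t \<in> V \<Longrightarrow> \<Psi> t (?cls t (\<eta> j t)) = axis j 1"
      unfolding H21_gamma_atlas_def by blast
    \<comment> \<open>P and Q hold the period coordinates of the two frames. Computing the period
      coordinates of one class in both ways shows that the transition function is the inverse of Q
      times P.\<close>
    define P where "P t = (\<chi> k j. ?K t (?cls t (\<omega> j t)) $ k)" for t
    define Q where "Q t = (\<chi> k j. ?K t (?cls t (\<eta> j t)) $ k)" for t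
    define X where "X t = inv_into (carrier (H21_gamma t)) (\<Phi> t) x" for t
    have P: "smooth_on (U \<inter> V) (\<lambda>t. P t $ k $ j)" for k j
      using smooth_on_subset[OF smooth_on_coord_frame[OF r U(1)[unfolded B_def] U(3,4)], of "U \<inter> V"]
      by (simp add: P_def)
    have Q: "smooth_on (U \<inter> V) (\<lambda>t. Q t $ k $ j)" for k j
      using smooth_on_subset[OF smooth_on_coord_frame[OF r V(1)[unfolded B_def] V(3,4)], of "U \<inter> V"]
      by (simp add: Q_def)
    have UA: "t \<in> admissible" if "t \<in> U" for t using openin_imp_subset[OF U(1)] BA that by blast
    have X: "X t \<in> carrier (H21_gamma t)" "\<Phi> t (X t) = x" if "t \<in> U" for t
    proof -
      have "x \<in> \<Phi> t ` carrier (H21_gamma t)" using U(2)[OF that] by (auto simp: linear_iso_def bij_betw_def)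
      then show "X t \<in> carrier (H21_gamma t)" "\<Phi> t (X t) = x"
        unfolding X_def by (auto intro: inv_into_into f_inv_into_f)
    qed
    show "smooth_on (U \<inter> V) (\<lambda>t. \<Psi> t (inv_into (carrier (H21_gamma t)) (\<Phi> t) x))"
      unfolding X_def[symmetric]
    proof (rule smooth_on_vec, rule smooth_on_matrix_inverse[OF Q, of "\<lambda>t. P t *v x"])
      show "smooth_on (U \<inter> V) (\<lambda>t. (P t *v x) $ i)" for i
        unfolding matrix_vector_mult_def by (simp, intro smooth_on_sum smooth_on_mult P smooth_on_const)
      fix t assume "t \<in> U \<inter> V"
      then have t: "t \<in> U" "t \<in> V" by auto
      note M = H21_gamma_props(1)[OF UA[OF t(1)]] and K = H21_gamma_props(2)[OF UA[OF t(1)]]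
      show "det (Q t) \<noteq> 0"
        unfolding Q_def by (rule linear_iso_change_of_basis_det[OF M V(2)[OF t(2)] K V(5,6)[OF t(2)]])
      have "?K t (X t) = P t *v x"
        using linear_iso_change_of_basis[OF M U(2)[OF t(1)] K U(5,6)[OF t(1)] X(1)[OF t(1)]] X(2)[OF t(1)]
        by (simp add: P_def)
      moreover have "?K t (X t) = Q t *v \<Psi> t (X t)"
        unfolding Q_def by (rule linear_iso_change_of_basis[OF M V(2)[OF t(2)] K V(5,6)[OF t(2)] X(1)[OF t(1)]])
      ultimately show "Q t *v \<Psi> t (X t) = P t *v x" by simp
    qed
  qed
qed

theorem proposition4p4:
  shows "\<exists>\<epsilon>>0. \<forall>r. 0 < r \<and> r \<le> \<epsilon> \<longrightarrow>
    smooth_vector_bundle (Delta_gamma (ball 0 r)) H21_gamma (H21_gamma_atlas (Delta_gamma (ball 0 r))) \<and>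
    0 \<in> Delta_gamma (ball 0 r) \<and>
    H21_gamma 0 = span_module (dolbeault iwasawa_coframe 2 1)
      (dolbeault_class iwasawa_coframe 2 1 `
        {alpha \<and>\<^sub>f gamma \<and>\<^sub>f cnj_form alpha, alpha \<and>\<^sub>f gamma \<and>\<^sub>f cnj_form beta,
         beta \<and>\<^sub>f gamma \<and>\<^sub>f cnj_form alpha, beta \<and>\<^sub>f gamma \<and>\<^sub>f cnj_form beta})"
proof (intro exI[of _ "1 / 4"] conjI allI impI)
  fix r :: real assume r: "0 < r \<and> r \<le> 1 / 4"
  then show "smooth_vector_bundle (Delta_gamma (ball 0 r)) H21_gamma (H21_gamma_atlas (Delta_gamma (ball 0 r)))"
    by (intro H21_gamma_bundle) simp
  show "0 \<in> Delta_gamma (ball 0 r)" using r by (simp add: Delta_gamma_def)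
qed (simp, rule H21_gamma_zero)

end
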